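(* There exist absolute constants $0<c\le C$ such that for all integers $d\ge1$, $s\in\{1,\dots,d\}$, all $\rho\in[\sqrt d,d]$ and all $\sigma>0$: \[ \sup_{(\boldsymbol\theta,\boldsymbol\Sigma)\in\Theta(s,d,\rho)}\mathbf E_{\boldsymbol\theta,\boldsymbol\Sigma}[(\tilde N-\|\boldsymbol\theta\|_2)^2]\le C\sigma^2\phi(s,\rho^2), \] and \[ c\,\sigma^2\le \inf_{\hat T}\sup_{(\boldsymbol\theta,\boldsymbol\Sigma)\in\Theta(s,d,\rho)}\frac{\mathbf E_{\boldsymbol\theta,\boldsymbol\Sigma}[(\hat T-\|\boldsymbol\theta\|_2)^2]}{\phi(s,\rho^2)}\le C\sigma^2, \] the infimum being over all estimators $\hat T$.
   Context: Model: one observes $\boldsymbol Y=\boldsymbol\theta+\sigma\boldsymbol\varepsilon\in\mathbb R^d$, $\boldsymbol\varepsilon\sim\mathcal N(\boldsymbol0,\boldsymbol\Sigma)$, $\sigma>0$ known; $\mathbf E_{\boldsymbol\theta,\boldsymbol\Sigma}$ is the expectation under this model. $B_0(s,d)=\{\boldsymbol\theta:\|\boldsymbol\theta\|_0\le s\}$. $\Theta(s,d,\rho)=\{(\boldsymbol\theta,\boldsymbol\Sigma):\boldsymbol\theta\in B_0(s,d),\ \boldsymbol\Sigma\text{ covariance matrix with }\boldsymbol\Sigma_{ii}=1\ \forall i,\ \|\boldsymbol\Sigma\|_F\le\rho\}$. For $t>0$: $\phi(s,t)=s\log(1+t/s^2)$ if $s\le\sqrt t$, $\phi(s,t)=\sqrt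 t$ otherwise. Estimator $\tilde N$: let $\tau=3\sqrt{\log(1+\rho^2/s^2)}$, $\beta_s=\mathbf E[Z^2\mid|Z|\ge\tau]$ with $Z\sim\mathcal N(0,1)$, $\sigma_i^2=\boldsymbol\Sigma_{ii}$, \[ \tilde Q=\begin{cases}\sum_{i=1}^d(Y_i^2-\sigma^2\sigma_i^2\beta_s)\mathbb 1\{|Y_i|>\sigma\sigma_i\tau\}, & s\le\rho,\\ \sum_{i=1}^d(Y_i^2-\sigma^2\sigma_i^2), &\text{otherwise},\end{cases}\qquad\tilde N=\sqrt{|\tilde Q|}. \] *)

theory Defs
  imports "HOL-Probability.Probability"
begin

text \<open>Vectors in R^d are functions nat => real (coordinates 0..d-1, zero outside);
 d x d matrices are functions nat => nat => real.\<close>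

definition std_gauss :: "real measure" where
  "std_gauss = density lborel (\<lambda>x. ennreal (std_normal_density x))"

definition l2norm :: "nat \<Rightarrow> (nat \<Rightarrow> real) \<Rightarrow> real" where
  "l2norm d x = sqrt (\<Sum>i<d. (x i)\<^sup>2)"

definition l0norm :: "nat \<Rightarrow> (nat \<Rightarrow> real) \<Rightarrow> nat" where
  "l0norm d x = card {i\<in>{..<d}. x i \<noteq> 0}"

definition frob_norm :: "nat \<Rightarrow> (nat \<Rightarrow> nat \<Rightarrow> real) \<Rightarrow> real" where
  "frob_norm d S = sqrt (\<Sum>i<d. \<Sum>j<d. (S i j)\<^sup>2)"

definition is_cov :: "nat \<Rightarrow> (nat \<Rightarrow> nat \<Rightarrow> real) \<Rightarrow> bool" where
  "is_cov d S \<longleftrightarrow> (\<forall>i<d. \<forall>j<d. S i j = S j i)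
     \<and> (\<forall>x::nat\<Rightarrow>real. 0 \<le> (\<Sum>i<d. \<Sum>j<d. x i * S i j * x j))"

text \<open>A square root factor A with A A^T = S (exists for covariance matrices).\<close>
definition cov_factor :: "nat \<Rightarrow> (nat \<Rightarrow> nat \<Rightarrow> real) \<Rightarrow> (nat \<Rightarrow> nat \<Rightarrow> real)" where
  "cov_factor d S = (SOME A. \<forall>i<d. \<forall>j<d. (\<Sum>k<d. A i k * A j k) = S i j)"

text \<open>Law of Y = theta + sigma * eps, eps ~ N(0, S): image of the standard Gaussian
  vector Z under z \<mapsto> theta + sigma A z with A A^T = S.\<close>
definition obs_law :: "nat \<Rightarrow> (nat \<Rightarrow> real) \<Rightarrow> real \<Rightarrow> (nat \<Rightarrow> nat \<Rightarrow> real) \<Rightarrow> (nat \<Rightarrow> real) measure" where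
  "obs_law d \<theta> \<sigma> S =
     distr (PiM {..<d} (\<lambda>_. std_gauss)) (PiM {..<d} (\<lambda>_. borel))
       (\<lambda>z. \<lambda>i\<in>{..<d}. \<theta> i + \<sigma> * (\<Sum>k<d. cov_factor d S i k * z k))"

definition risk :: "nat \<Rightarrow> ((nat \<Rightarrow> real) \<Rightarrow> real) \<Rightarrow> (nat \<Rightarrow> real) \<Rightarrow> real \<Rightarrow> (nat \<Rightarrow> nat \<Rightarrow> real) \<Rightarrow> ennreal" where
  "risk d T \<theta> \<sigma> S = (\<integral>\<^sup>+ Y. ennreal ((T Y - l2norm d \<theta>)\<^sup>2) \<partial>obs_law d \<theta> \<sigma> S)"

definition Theta :: "nat \<Rightarrow> nat \<Rightarrow> real \<Rightarrow> ((nat \<Rightarrow> real) \<times> (nat \<Rightarrow> nat \<Rightarrow> real)) set" where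
  "Theta s d \<rho> = {(\<theta>, S). (\<forall>i\<ge>d. \<theta> i = 0) \<and> l0norm d \<theta> \<le> s
      \<and> (\<forall>i j. (i \<ge> d \<or> j \<ge> d) \<longrightarrow> S i j = 0)
      \<and> is_cov d S \<and> (\<forall>i<d. S i i = 1) \<and> frob_norm d S \<le> \<rho>}"

definition phi :: "nat \<Rightarrow> real \<Rightarrow> real" where
  "phi s t = (if real s \<le> sqrt t then real s * ln (1 + t / (real s)\<^sup>2) else sqrt t)"

definition estimators :: "nat \<Rightarrow> ((nat \<Rightarrow> real) \<Rightarrow> real) set" where
  "estimators d = borel_measurable (PiM {..<d} (\<lambda>_. borel))"

definition tau :: "nat \<Rightarrow> real \<Rightarrow> real" where
  "tau s \<rho> = 3 * sqrt (ln (1 + \<rho>\<^sup>2 / (real s)\<^sup>2))"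

definition beta :: "nat \<Rightarrow> real \<Rightarrow> real" where
  "beta s \<rho> = (\<integral>z. indicator {z. tau s \<rho> \<le> \<bar>z\<bar>} z * z\<^sup>2 \<partial>std_gauss)
               / measure std_gauss {z. tau s \<rho> \<le> \<bar>z\<bar>}"

text \<open>The estimator N tilde (with sigma_i = Sigma_ii = 1 on Theta).\<close>
definition Q_tilde :: "nat \<Rightarrow> nat \<Rightarrow> real \<Rightarrow> real \<Rightarrow> (nat \<Rightarrow> real) \<Rightarrow> real" where
  "Q_tilde d s \<rho> \<sigma> Y =
     (if real s \<le> \<rho> then
        (\<Sum>i<d. (if \<bar>Y i\<bar> > \<sigma> * tau s \<rho> then (Y i)\<^sup>2 - \<sigma>\<^sup>2 * beta s \<rho> else 0))
      else (\<Sum>i<d. (Y i)\<^sup>2 - \<sigma>\<^sup>2))"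

definition N_tilde :: "nat \<Rightarrow> nat \<Rightarrow> real \<Rightarrow> real \<Rightarrow> (nat \<Rightarrow> real) \<Rightarrow> real" where
  "N_tilde d s \<rho> \<sigma> Y = sqrt \<bar>Q_tilde d s \<rho> \<sigma> Y\<bar>"

end

theory Submission
  imports Defs
begin

text \<open>
  Everything is computed in the space of the standard Gaussian vector \<open>z\<close>: the noise coordinates
  are \<open>\<epsilon>\<^sub>i = \<langle>A\<^sub>i, z\<rangle>\<close> with \<open>A A\<^sup>T = \<Sigma>\<close>.

  Upper bound. With \<open>t = \<parallel>\<theta>\<parallel>\<close>, \<open>U = 2 \<langle>\<theta>, \<epsilon>\<rangle>\<close> and \<open>V = Q - t\<^sup>2 - U\<close> one has
  \<open>(\<surd>|Q| - t)\<^sup>2 \<le> 4 U\<^sup>2 / t\<^sup>2 + 2 |V|\<close>. The first term is controlled by \<open>\<theta>\<^sup>T \<Sigma> \<theta> \<le> min(s, \<rho>) t\<^sup>2\<close>.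
  In the second term the support contributes \<open>O(s \<tau>\<^sup>2)\<close>, because thresholding changes \<open>Y\<^sub>i\<^sup>2\<close> by at
  most \<open>8 \<tau>\<^sup>2\<close>; off the support one sums \<open>g(\<epsilon>\<^sub>i)\<close> for an even centred \<open>g\<close> supported on \<open>|y| > \<tau>\<close>, and
  \<open>|Cov(g(\<epsilon>\<^sub>i), g(\<epsilon>\<^sub>j))| \<le> C \<Sigma>\<^sub>i\<^sub>j\<^sup>2 exp(- \<tau>\<^sup>2 / 9)\<close>, since the density of a bivariate Gaussian relative to
  its marginals is \<open>1 + r u y + O(r\<^sup>2)\<close> and the first two terms integrate to zero. The choice of \<open>\<tau>\<close>
  makes \<open>\<rho>\<^sup>2 exp(- \<tau>\<^sup>2 / 9) \<le> s\<^sup>2\<close>.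

  Lower bound. Let \<open>\<Sigma>\<close> consist of perfectly correlated blocks of size \<open>m \<approx> min(\<rho>\<^sup>2 / d, s)\<close>, so that a
  block acts as a single observation, and group the blocks into \<open>n \<approx> s / m\<close> groups of \<open>k \<approx> d / s\<close>
  blocks. The signal occupies one uniformly chosen block in each group, with amplitude
  \<open>a\<^sup>2 = ln (1 + k / n)\<close>. The likelihood ratio of this mixture against \<open>\<theta> = 0\<close> has second moment
  \<open>(1 + 1 / n)\<^sup>n \<le> e\<close>, so the two hypotheses cannot be separated although the norms differ by
  \<open>\<sigma> a \<surd>(n m)\<close>. For \<open>s > \<rho>\<close> the sparsity \<open>\<lfloor>\<rho>\<rfloor>\<close> is used instead.
\<close>

subsection \<open>Linear images of the standard Gaussian vector\<close>

text \<open>For \<open>c \<noteq> 0\<close> the rotation splits into one-dimensional affine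
  substitutions: \<open>x = c*u - s*z\<close> at fixed \<open>z\<close>, then
  \<open>y = (s*x + z) / c\<close> at fixed \<open>x\<close>. Their Jacobian factors cancel. For
  \<open>c = 0\<close> it is a swap of the coordinates up to signs.\<close>

lemma nn_integral_lborel_rotation:
  fixes K :: "real \<times> real \<Rightarrow> ennreal"
  assumes K[measurable]: "K \<in> borel_measurable (borel \<Otimes>\<^sub>M borel)" and cs: "c\<^sup>2 + s\<^sup>2 = (1::real)"
  shows "(\<integral>\<^sup>+u. \<integral>\<^sup>+z. K (c*u - s*z, s*u + c*z) \<partial>lborel \<partial>lborel) = (\<integral>\<^sup>+u. \<integral>\<^sup>+z. K (u, z) \<partial>lborel \<partial>lborel)"
proof (cases "c = 0")
  case False
  \<comment> \<open>The second coordinate is expressed through the first, so that the inner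
    substitution involves only \<open>x\<close> and \<open>z\<close>.\<close>
  have eq: "K (c*u - s*z, s*u + c*z) = K (-s*z + c*u, (s*(-s*z + c*u) + z) / c)" for u z
  proof -
    have 1: "1 - s\<^sup>2 = c\<^sup>2" using cs by simp
    have "(s*(-s*z + c*u) + z) / c = s*u + (1 - s\<^sup>2) * z / c"
      using False by (simp add: field_simps power2_eq_square)
    also have "\<dots> = s*u + c*z" unfolding 1 using False by (simp add: power2_eq_square)
    finally show ?thesis by (simp add: algebra_simps)
  qed
  define J where "J z = (\<integral>\<^sup>+u. K (-s*z + c*u, (s*(-s*z + c*u) + z) / c) \<partial>lborel)" for z
  have [measurable]: "J \<in> borel_measurable borel" unfolding J_def by simp
  have J: "ennreal \<bar>c\<bar> * J z = (\<integral>\<^sup>+x. K (x, (s*x + z) / c) \<partial>lborel)" for z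
    unfolding J_def using False by (intro nn_integral_real_affine[symmetric]) simp_all
  have 1: "(\<integral>\<^sup>+u. \<integral>\<^sup>+z. K (c*u - s*z, s*u + c*z) \<partial>lborel \<partial>lborel) = (\<integral>\<^sup>+z. J z \<partial>lborel)"
    unfolding eq J_def by (rule lborel_pair.Fubini') simp
  have "ennreal \<bar>c\<bar> * (\<integral>\<^sup>+z. J z \<partial>lborel) = (\<integral>\<^sup>+z. ennreal \<bar>c\<bar> * J z \<partial>lborel)"
    by (rule nn_integral_cmult[symmetric]) simp
  also have "\<dots> = (\<integral>\<^sup>+z. \<integral>\<^sup>+x. K (x, (s*x + z) / c) \<partial>lborel \<partial>lborel)"
    unfolding J ..
  also have "\<dots> = (\<integral>\<^sup>+x. \<integral>\<^sup>+z. K (x, s*x/c + (1/c)*z) \<partial>lborel \<partial>lborel)"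
    by (subst lborel_pair.Fubini') (simp_all add: add_divide_distrib)
  also have "\<dots> = (\<integral>\<^sup>+x. ennreal \<bar>c\<bar> * (\<integral>\<^sup>+y. K (x, y) \<partial>lborel) \<partial>lborel)"
  proof (rule nn_integral_cong)
    fix x :: real
    have "(\<integral>\<^sup>+y. K (x, y) \<partial>lborel) = ennreal \<bar>1/c\<bar> * (\<integral>\<^sup>+z. K (x, s*x/c + (1/c)*z) \<partial>lborel)"
      using False by (subst nn_integral_real_affine[of "\<lambda>y. K (x, y)" "1/c" "s*x/c"]) simp_all
    then have "ennreal \<bar>c\<bar> * (\<integral>\<^sup>+y. K (x, y) \<partial>lborel) = (ennreal \<bar>c\<bar> * ennreal \<bar>1/c\<bar>) * (\<integral>\<^sup>+z. K (x, s*x/c + (1/c)*z) \<partial>lborel)"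
      by (simp add: mult.assoc)
    also have "ennreal \<bar>c\<bar> * ennreal \<bar>1/c\<bar> = 1"
      using False by (simp add: ennreal_mult[symmetric] abs_mult[symmetric])
    finally show "(\<integral>\<^sup>+z. K (x, s*x/c + (1/c)*z) \<partial>lborel) = ennreal \<bar>c\<bar> * (\<integral>\<^sup>+y. K (x, y) \<partial>lborel)" by simp
  qed
  also have "\<dots> = ennreal \<bar>c\<bar> * (\<integral>\<^sup>+x. \<integral>\<^sup>+y. K (x, y) \<partial>lborel \<partial>lborel)"
    by (rule nn_integral_cmult) simp
  finally show ?thesis unfolding 1 using False by (simp add: ennreal_mult_cancel_left)
next
  case True
  then have s: "\<bar>s\<bar> = 1" "s \<noteq> 0" using cs by (auto simp: power2_eq_1_iff)
  have "(\<integral>\<^sup>+u. \<integral>\<^sup>+z. K (- s*z, s*u) \<partial>lborel \<partial>lborel) = (\<integral>\<^sup>+u. \<integral>\<^sup>+z. K (z, s*u) \<partial>lborel \<partial>lborel)"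
  proof (rule nn_integral_cong)
    fix u :: real
    show "(\<integral>\<^sup>+z. K (- s*z, s*u) \<partial>lborel) = (\<integral>\<^sup>+z. K (z, s*u) \<partial>lborel)"
      using s by (subst nn_integral_real_affine[of "\<lambda>z. K (z, s*u)" "-s" 0]) simp_all
  qed
  also have "\<dots> = (\<integral>\<^sup>+z. \<integral>\<^sup>+u. K (z, s*u) \<partial>lborel \<partial>lborel)"
    by (rule lborel_pair.Fubini') simp
  also have "\<dots> = (\<integral>\<^sup>+z. \<integral>\<^sup>+u. K (z, u) \<partial>lborel \<partial>lborel)"
  proof (rule nn_integral_cong)
    fix z :: real
    show "(\<integral>\<^sup>+u. K (z, s*u) \<partial>lborel) = (\<integral>\<^sup>+u. K (z, u) \<partial>lborel)"
      using s by (subst nn_integral_real_affine[of "\<lambda>u. K (z, u)" s 0]) simp_all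
  qed
  finally show ?thesis using True by simp
qed

section \<open>The standard Gaussian measure and its rotation invariance\<close>

lemma sets_std_gauss[simp, measurable_cong]: "sets std_gauss = sets borel"
  by (simp add: std_gauss_def)

lemma space_std_gauss[simp]: "space std_gauss = UNIV"
  by (simp add: std_gauss_def)

lemma prob_space_std_gauss: "prob_space std_gauss"
  unfolding std_gauss_def by (rule prob_space_normal_density) simp

interpretation std_gauss: prob_space std_gauss by (rule prob_space_std_gauss)

interpretation std_gauss_pair: pair_prob_space std_gauss std_gauss ..

interpretation std_gauss_prod: product_prob_space "\<lambda>_. std_gauss" I for I :: "nat set" ..

lemma nn_integral_std_gauss:
  "f \<in> borel_measurable borel \<Longrightarrow>
    (\<integral>\<^sup>+x. f x \<partial>std_gauss) = (\<integral>\<^sup>+x. ennreal (std_normal_density x) * f x \<partial>lborel)"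
  unfolding std_gauss_def by (rule nn_integral_density) simp_all

lemma nn_integral_std_gauss2:
  fixes H :: "real \<times> real \<Rightarrow> ennreal"
  assumes [measurable]: "H \<in> borel_measurable (borel \<Otimes>\<^sub>M borel)"
  shows "(\<integral>\<^sup>+u. \<integral>\<^sup>+z. H (u, z) \<partial>std_gauss \<partial>std_gauss)
     = (\<integral>\<^sup>+u. \<integral>\<^sup>+z. ennreal (std_normal_density u) * ennreal (std_normal_density z) * H (u, z) \<partial>lborel \<partial>lborel)"
  by (simp add: nn_integral_std_gauss nn_integral_cmult[symmetric] mult.assoc)

text \<open>The product density depends only on \<open>u\<^sup>2 + z\<^sup>2\<close>, so it can be
  moved inside the rotated integrand, where Lebesgue measure is invariant.\<close>

lemma nn_integral_std_gauss_rotation: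
  fixes H :: "real \<times> real \<Rightarrow> ennreal"
  assumes H[measurable]: "H \<in> borel_measurable (borel \<Otimes>\<^sub>M borel)" and cs: "c\<^sup>2 + s\<^sup>2 = (1::real)"
  shows "(\<integral>\<^sup>+u. \<integral>\<^sup>+z. H (c*u - s*z, s*u + c*z) \<partial>std_gauss \<partial>std_gauss) = (\<integral>\<^sup>+u. \<integral>\<^sup>+z. H (u, z) \<partial>std_gauss \<partial>std_gauss)"
proof -
  let ?K = "\<lambda>(u, z). ennreal (std_normal_density u) * ennreal (std_normal_density z) * H (u, z)"
  have dens: "ennreal (std_normal_density u) * ennreal (std_normal_density z)
      = ennreal (std_normal_density (c*u - s*z)) * ennreal (std_normal_density (s*u + c*z))" for u z
  proof -
    have "(c*u - s*z)\<^sup>2 + (s*u + c*z)\<^sup>2 = (c\<^sup>2+s\<^sup>2) * (u\<^sup>2 + z\<^sup>2)"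
      by (simp add: power2_eq_square algebra_simps)
    then have "(c*u - s*z)\<^sup>2 + (s*u + c*z)\<^sup>2 = u\<^sup>2 + z\<^sup>2" using cs by simp
    then have "- u\<^sup>2 / 2 + - z\<^sup>2 / 2 = - (c*u - s*z)\<^sup>2 / 2 + - (s*u + c*z)\<^sup>2 / 2" by (simp add: field_simps)
    then show ?thesis
      by (simp add: std_normal_density_def ennreal_mult[symmetric] exp_add[symmetric])
  qed
  have "(\<integral>\<^sup>+u. \<integral>\<^sup>+z. H (c*u - s*z, s*u + c*z) \<partial>std_gauss \<partial>std_gauss)
      = (\<integral>\<^sup>+u. \<integral>\<^sup>+z. ?K (c*u - s*z, s*u + c*z) \<partial>lborel \<partial>lborel)"
    using nn_integral_std_gauss2[of "\<lambda>(u,z). H (c*u - s*z, s*u + c*z)"] by (simp add: dens[symmetric])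
  also have "\<dots> = (\<integral>\<^sup>+u. \<integral>\<^sup>+z. ?K (u, z) \<partial>lborel \<partial>lborel)"
    by (rule nn_integral_lborel_rotation) (use cs in simp_all)
  finally show ?thesis using nn_integral_std_gauss2[of H] by simp
qed

lemma polar_coordinates:
  fixes p q :: real
  obtains R c s where "0 \<le> R" "c\<^sup>2 + s\<^sup>2 = 1" "p = R * c" "q = R * s"
proof (cases "p\<^sup>2 + q\<^sup>2 = 0")
  case True
  then show ?thesis using that[of 0 1 0] by (simp add: sum_power2_eq_zero_iff)
next
  case False
  let ?R = "sqrt (p\<^sup>2 + q\<^sup>2)"
  have "?R \<noteq> 0" "?R\<^sup>2 = p\<^sup>2 + q\<^sup>2" using False by simp_all
  moreover from this have "(p / ?R)\<^sup>2 + (q / ?R)\<^sup>2 = 1"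
    using False by (simp add: power_divide add_divide_distrib[symmetric])
  ultimately show ?thesis using that[of ?R "p / ?R" "q / ?R"] by simp
qed

text \<open>A fresh coordinate \<open>y\<close> is absorbed into a pair in triangular form. One
  rotation in \<open>(u, y)\<close> turns \<open>\<alpha>*u + a*y\<close> into \<open>R*u\<close>; a
  second one merges the two directions left in the second component. The equations update the
  squared norms and the inner product of the two coefficient rows. One choice of numbers must serve
  every \<open>F\<close>, hence the quantifier in the conclusion.\<close>

lemma nn_integral_std_gauss_merge:
  fixes \<alpha> \<beta> \<gamma> a b :: real
  obtains R R2 \<beta>' where "0 \<le> R" "0 \<le> R2" "R\<^sup>2 = \<alpha>\<^sup>2 + a\<^sup>2" "R * \<beta>' = \<alpha> * \<beta> + a * b"
    "\<beta>'\<^sup>2 + R2\<^sup>2 = \<beta>\<^sup>2 + \<gamma>\<^sup>2 + b\<^sup>2"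
    "\<forall>F \<in> borel_measurable (borel \<Otimes>\<^sub>M borel).
     (\<integral>\<^sup>+y. \<integral>\<^sup>+u. \<integral>\<^sup>+v. (F :: real \<times> real \<Rightarrow> ennreal) (\<alpha>*u + a*y, \<beta>*u + \<gamma>* v + b*y) \<partial>std_gauss \<partial>std_gauss \<partial>std_gauss)
      = (\<integral>\<^sup>+u. \<integral>\<^sup>+v. F (R*u, \<beta>'*u + R2* v) \<partial>std_gauss \<partial>std_gauss)"
proof -
  obtain R c s where R: "0 \<le> R" and cs: "c\<^sup>2 + s\<^sup>2 = 1" and pa: "\<alpha> = R * c" "a = R * s"
    by (rule polar_coordinates)
  define \<beta>' b' where "\<beta>' = \<beta>*c + b* s" and "b' = b*c - \<beta>* s"
  obtain R2 c2 s2 where R2: "0 \<le> R2" and cs2: "c2\<^sup>2 + s2\<^sup>2 = 1" and pb: "b' = R2 * c2" "\<gamma> = R2 * s2"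
    by (rule polar_coordinates)
  have lin: "\<alpha>*(c*u - s*y) + a*(s*u + c*y) = R*u" for u y
  proof -
    have "\<alpha>*(c*u - s*y) + a*(s*u + c*y) = R*(c\<^sup>2+s\<^sup>2)*u" unfolding pa by (simp add: algebra_simps power2_eq_square)
    then show ?thesis using cs by simp
  qed
  have lin3: "\<beta>*(c*u - s*y) + \<gamma> * v + b*(s*u + c*y) = \<beta>'*u + (b'*y + \<gamma> * v)" for u v y
    unfolding \<beta>'_def b'_def by (simp add: algebra_simps)
  have lin2: "b'*(c2*y - s2* v) + \<gamma>*(s2*y + c2* v) = R2*y" for v y
  proof -
    have "b'*(c2*y - s2* v) + \<gamma>*(s2*y + c2* v) = R2*(c2\<^sup>2+s2\<^sup>2)*y" unfolding pb by (simp add: algebra_simps power2_eq_square)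
    then show ?thesis using cs2 by simp
  qed
  show ?thesis
  proof (rule that[OF R R2])
    have "\<alpha>\<^sup>2 + a\<^sup>2 = R\<^sup>2 * (c\<^sup>2+s\<^sup>2)" unfolding pa by (simp add: algebra_simps)
    then show "R\<^sup>2 = \<alpha>\<^sup>2 + a\<^sup>2" using cs by simp
    show "R * \<beta>' = \<alpha> * \<beta> + a * b" unfolding pa \<beta>'_def by (simp add: algebra_simps)
    have "R2\<^sup>2 * (c2\<^sup>2 + s2\<^sup>2) = b'\<^sup>2 + \<gamma>\<^sup>2" unfolding pb by (simp add: algebra_simps)
    moreover have "\<beta>'\<^sup>2 + b'\<^sup>2 = (\<beta>\<^sup>2 + b\<^sup>2) * (c\<^sup>2 + s\<^sup>2)" unfolding \<beta>'_def b'_def by (simp add: power2_eq_square algebra_simps)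
    ultimately show "\<beta>'\<^sup>2 + R2\<^sup>2 = \<beta>\<^sup>2 + \<gamma>\<^sup>2 + b\<^sup>2" using cs cs2 by simp
  next
    show "\<forall>F \<in> borel_measurable (borel \<Otimes>\<^sub>M borel).
     (\<integral>\<^sup>+y. \<integral>\<^sup>+u. \<integral>\<^sup>+v. (F :: real \<times> real \<Rightarrow> ennreal) (\<alpha>*u + a*y, \<beta>*u + \<gamma>* v + b*y) \<partial>std_gauss \<partial>std_gauss \<partial>std_gauss)
      = (\<integral>\<^sup>+u. \<integral>\<^sup>+v. F (R*u, \<beta>'*u + R2* v) \<partial>std_gauss \<partial>std_gauss)"
    proof
    fix F :: "real \<times> real \<Rightarrow> ennreal"
    assume [measurable]: "F \<in> borel_measurable (borel \<Otimes>\<^sub>M borel)"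
    define H where "H p = (\<integral>\<^sup>+v. F (\<alpha>*fst p + a* snd p, \<beta>*fst p + \<gamma>* v + b* snd p) \<partial>std_gauss)" for p
    have [measurable]: "H \<in> borel_measurable (borel \<Otimes>\<^sub>M borel)" unfolding H_def by measurable
    have H: "H (c*u - s*y, s*u + c*y) = (\<integral>\<^sup>+v. F (R*u, \<beta>'*u + (b'*y + \<gamma>* v)) \<partial>std_gauss)" for u y
      unfolding H_def by (simp only: fst_conv snd_conv lin lin3)
    have "(\<integral>\<^sup>+y. \<integral>\<^sup>+u. \<integral>\<^sup>+v. F (\<alpha>*u + a*y, \<beta>*u + \<gamma>* v + b*y) \<partial>std_gauss \<partial>std_gauss \<partial>std_gauss)
        = (\<integral>\<^sup>+y. \<integral>\<^sup>+u. H (u, y) \<partial>std_gauss \<partial>std_gauss)" unfolding H_def by simp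
    also have "\<dots> = (\<integral>\<^sup>+u. \<integral>\<^sup>+y. H (u, y) \<partial>std_gauss \<partial>std_gauss)"
      by (rule std_gauss_pair.Fubini') simp
    also have "\<dots> = (\<integral>\<^sup>+u. \<integral>\<^sup>+y. H (c*u - s*y, s*u + c*y) \<partial>std_gauss \<partial>std_gauss)"
      by (rule nn_integral_std_gauss_rotation[symmetric]) (use cs in simp_all)
    also have "\<dots> = (\<integral>\<^sup>+u. \<integral>\<^sup>+y. F (R*u, \<beta>'*u + R2*y) \<partial>std_gauss \<partial>std_gauss)"
    proof (rule nn_integral_cong)
      fix u :: real
      define G where "G p = F (R*u, \<beta>'*u + (b'*fst p + \<gamma>* snd p))" for p
      have [measurable]: "G \<in> borel_measurable (borel \<Otimes>\<^sub>M borel)" unfolding G_def by measurable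
      have "(\<integral>\<^sup>+y. H (c*u - s*y, s*u + c*y) \<partial>std_gauss) = (\<integral>\<^sup>+y. \<integral>\<^sup>+v. G (y, v) \<partial>std_gauss \<partial>std_gauss)"
        unfolding H G_def by simp
      also have "\<dots> = (\<integral>\<^sup>+y. \<integral>\<^sup>+v. G (c2*y - s2* v, s2*y + c2* v) \<partial>std_gauss \<partial>std_gauss)"
        by (rule nn_integral_std_gauss_rotation[symmetric]) (use cs2 in simp_all)
      \<comment> \<open>After the second rotation the integrand is constant in \<open>v\<close>,
        which integrates to one.\<close>
      also have "\<dots> = (\<integral>\<^sup>+y. F (R*u, \<beta>'*u + R2*y) \<partial>std_gauss)"
        unfolding G_def by (simp add: lin2 std_gauss.emeasure_space_1[simplified])
      finally show "(\<integral>\<^sup>+y. H (c*u - s*y, s*u + c*y) \<partial>std_gauss) = (\<integral>\<^sup>+y. F (R*u, \<beta>'*u + R2*y) \<partial>std_gauss)" .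
    qed
    finally show "(\<integral>\<^sup>+y. \<integral>\<^sup>+u. \<integral>\<^sup>+v. F (\<alpha>*u + a*y, \<beta>*u + \<gamma>* v + b*y) \<partial>std_gauss \<partial>std_gauss \<partial>std_gauss)
      = (\<integral>\<^sup>+u. \<integral>\<^sup>+v. F (R*u, \<beta>'*u + R2* v) \<partial>std_gauss \<partial>std_gauss)" .
    qed
  qed
qed

section \<open>Pairs of linear forms in the standard Gaussian vector\<close>

abbreviation gauss_vec :: "nat \<Rightarrow> (nat \<Rightarrow> real) measure" where
  "gauss_vec n \<equiv> PiM {..<n} (\<lambda>_. std_gauss)"

lemma prob_space_gauss_vec: "prob_space (gauss_vec n)"
  by (intro prob_space_PiM prob_space_std_gauss)

lemma sets_gauss_vec: "sets (gauss_vec n) = sets (PiM {..<n} (\<lambda>_. borel))"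
  by (intro sets_PiM_cong) simp_all

lemma gauss_vec_nn_integral_Suc:
  assumes [measurable]: "f \<in> borel_measurable (PiM {..<Suc n} (\<lambda>_. borel))"
  shows "(\<integral>\<^sup>+z. f z \<partial>gauss_vec (Suc n)) = (\<integral>\<^sup>+y. \<integral>\<^sup>+x. f (x(n := y)) \<partial>gauss_vec n \<partial>std_gauss)"
proof -
  have "f \<in> borel_measurable (gauss_vec (Suc n))"
    using assms by (simp add: measurable_cong_sets[OF sets_gauss_vec refl])
  then show ?thesis
    unfolding lessThan_Suc by (intro std_gauss_prod.product_nn_integral_insert_rev) auto
qed

text \<open>The law of two linear forms depends only on the Gram matrix of their coefficients;
  \<open>\<alpha>\<close>, \<open>\<beta>\<close>, \<open>\<gamma>\<close> are the entries of its
  Cholesky factor, built up one coordinate at a time. The inner product appears as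
  \<open>\<alpha> * \<beta>\<close> because \<open>\<alpha>\<close> may vanish.\<close>

lemma gauss_vec_pair_law_aux:
  "\<exists>\<alpha> \<beta> \<gamma>. 0 \<le> \<alpha> \<and> 0 \<le> \<gamma> \<and> \<alpha>\<^sup>2 = (\<Sum>k<n. (a k)\<^sup>2) \<and> \<alpha> * \<beta> = (\<Sum>k<n. a k * b k) \<and> \<beta>\<^sup>2 + \<gamma>\<^sup>2 = (\<Sum>k<n. (b k)\<^sup>2)
    \<and> (\<forall>F \<in> borel_measurable (borel \<Otimes>\<^sub>M borel).
      (\<integral>\<^sup>+z. F (\<Sum>k<n. a k * z k, \<Sum>k<n. b k * z k) \<partial>gauss_vec n) = (\<integral>\<^sup>+u. \<integral>\<^sup>+v. (F (\<alpha>*u, \<beta>*u + \<gamma>* v) :: ennreal) \<partial>std_gauss \<partial>std_gauss))"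
proof (induction n)
  case 0
  show ?case
    by (intro exI[of _ 0]) (simp add: prob_space.emeasure_space_1[OF prob_space_gauss_vec, of 0, simplified] std_gauss.emeasure_space_1[simplified])
next
  case (Suc n)
  then obtain \<alpha> \<beta> \<gamma> where IH: "0 \<le> \<alpha>" "0 \<le> \<gamma>" "\<alpha>\<^sup>2 = (\<Sum>k<n. (a k)\<^sup>2)" "\<alpha> * \<beta> = (\<Sum>k<n. a k * b k)" "\<beta>\<^sup>2 + \<gamma>\<^sup>2 = (\<Sum>k<n. (b k)\<^sup>2)"
    "\<And>F :: real \<times> real \<Rightarrow> ennreal. F \<in> borel_measurable (borel \<Otimes>\<^sub>M borel) \<Longrightarrow>
      (\<integral>\<^sup>+z. F (\<Sum>k<n. a k * z k, \<Sum>k<n. b k * z k) \<partial>gauss_vec n) = (\<integral>\<^sup>+u. \<integral>\<^sup>+v. F (\<alpha>*u, \<beta>*u + \<gamma>* v) \<partial>std_gauss \<partial>std_gauss)"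
    by blast
  obtain R R2 \<beta>' where R: "0 \<le> R" "0 \<le> R2" "R\<^sup>2 = \<alpha>\<^sup>2 + (a n)\<^sup>2" "R * \<beta>' = \<alpha> * \<beta> + a n * b n"
    "\<beta>'\<^sup>2 + R2\<^sup>2 = \<beta>\<^sup>2 + \<gamma>\<^sup>2 + (b n)\<^sup>2"
    "\<forall>F \<in> borel_measurable (borel \<Otimes>\<^sub>M borel).
     (\<integral>\<^sup>+y. \<integral>\<^sup>+u. \<integral>\<^sup>+v. (F :: real \<times> real \<Rightarrow> ennreal) (\<alpha>*u + a n*y, \<beta>*u + \<gamma>* v + b n*y) \<partial>std_gauss \<partial>std_gauss \<partial>std_gauss)
      = (\<integral>\<^sup>+u. \<integral>\<^sup>+v. F (R*u, \<beta>'*u + R2* v) \<partial>std_gauss \<partial>std_gauss)"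
    by (rule nn_integral_std_gauss_merge[of \<alpha> "a n" \<beta> "b n" \<gamma>])
  show ?case
  proof (rule exI[of _ R], rule exI[of _ \<beta>'], rule exI[of _ R2], intro conjI ballI R(1,2))
    fix F :: "real \<times> real \<Rightarrow> ennreal"
    assume F[measurable]: "F \<in> borel_measurable (borel \<Otimes>\<^sub>M borel)"
    have "(\<integral>\<^sup>+z. F (\<Sum>k<Suc n. a k * z k, \<Sum>k<Suc n. b k * z k) \<partial>gauss_vec (Suc n))
       = (\<integral>\<^sup>+y. \<integral>\<^sup>+x. F (\<Sum>k<Suc n. a k * (x(n := y)) k, \<Sum>k<Suc n. b k * (x(n := y)) k) \<partial>gauss_vec n \<partial>std_gauss)"
      by (rule gauss_vec_nn_integral_Suc) measurable
    also have "\<dots> = (\<integral>\<^sup>+y. \<integral>\<^sup>+x. F ((\<Sum>k<n. a k * x k) + a n * y, (\<Sum>k<n. b k * x k) + b n * y) \<partial>gauss_vec n \<partial>std_gauss)"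
      by simp
    also have "\<dots> = (\<integral>\<^sup>+y. \<integral>\<^sup>+u. \<integral>\<^sup>+v. F (\<alpha>*u + a n*y, \<beta>*u + \<gamma>* v + b n*y) \<partial>std_gauss \<partial>std_gauss \<partial>std_gauss)"
    proof (rule nn_integral_cong)
      fix y
      show "(\<integral>\<^sup>+x. F ((\<Sum>k<n. a k * x k) + a n * y, (\<Sum>k<n. b k * x k) + b n * y) \<partial>gauss_vec n)
        = (\<integral>\<^sup>+u. \<integral>\<^sup>+v. F (\<alpha>*u + a n*y, \<beta>*u + \<gamma>* v + b n*y) \<partial>std_gauss \<partial>std_gauss)"
        using IH(6)[of "\<lambda>(p,q). F (p + a n * y, q + b n * y)"] by simp
    qed
    also have "\<dots> = (\<integral>\<^sup>+u. \<integral>\<^sup>+v. F (R*u, \<beta>'*u + R2* v) \<partial>std_gauss \<partial>std_gauss)"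
      using R(6) F by (rule bspec)
    finally show "(\<integral>\<^sup>+z. F (\<Sum>k<Suc n. a k * z k, \<Sum>k<Suc n. b k * z k) \<partial>gauss_vec (Suc n))
      = (\<integral>\<^sup>+u. \<integral>\<^sup>+v. F (R*u, \<beta>'*u + R2* v) \<partial>std_gauss \<partial>std_gauss)" .
  qed (use IH R in auto)
qed

lemma nn_integral_gauss_vec_pair:
  fixes F :: "real \<times> real \<Rightarrow> ennreal"
  assumes a: "(\<Sum>k<n. (a k)\<^sup>2) = 1" and b: "(\<Sum>k<n. (b k)\<^sup>2) = 1"
    and r: "(\<Sum>k<n. a k * b k) = r" and F: "F \<in> borel_measurable (borel \<Otimes>\<^sub>M borel)"
  shows "(\<integral>\<^sup>+z. F (\<Sum>k<n. a k * z k, \<Sum>k<n. b k * z k) \<partial>gauss_vec n)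
    = (\<integral>\<^sup>+u. \<integral>\<^sup>+v. F (u, r*u + sqrt (1 - r\<^sup>2)* v) \<partial>std_gauss \<partial>std_gauss)"
proof -
  obtain \<alpha> \<beta> \<gamma> where *: "0 \<le> \<alpha>" "0 \<le> \<gamma>" "\<alpha>\<^sup>2 = (\<Sum>k<n. (a k)\<^sup>2)" "\<alpha> * \<beta> = (\<Sum>k<n. a k * b k)" "\<beta>\<^sup>2 + \<gamma>\<^sup>2 = (\<Sum>k<n. (b k)\<^sup>2)"
    "\<And>F :: real \<times> real \<Rightarrow> ennreal. F \<in> borel_measurable (borel \<Otimes>\<^sub>M borel) \<Longrightarrow>
      (\<integral>\<^sup>+z. F (\<Sum>k<n. a k * z k, \<Sum>k<n. b k * z k) \<partial>gauss_vec n) = (\<integral>\<^sup>+u. \<integral>\<^sup>+v. F (\<alpha>*u, \<beta>*u + \<gamma>* v) \<partial>std_gauss \<partial>std_gauss)"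
    using gauss_vec_pair_law_aux[of a n b] by blast
  \<comment> \<open>The squares determine \<open>\<alpha>\<close> and \<open>\<gamma>\<close>, since
    both are nonnegative.\<close>
  have \<alpha>: "\<alpha> = 1" using * a by (simp add: power2_eq_1_iff)
  then have \<beta>: "\<beta> = r" using * r by simp
  then have "\<gamma>\<^sup>2 = 1 - r\<^sup>2" using * b by simp
  then have \<gamma>: "\<gamma> = sqrt (1 - r\<^sup>2)" using *(2) by (metis real_sqrt_unique)
  show ?thesis using *(6)[OF F] unfolding \<alpha> \<beta> \<gamma> by simp
qed

lemma abs_inner_unit_le_1:
  fixes a b :: "nat \<Rightarrow> real"
  assumes a: "(\<Sum>k<n. (a k)\<^sup>2) = 1" and b: "(\<Sum>k<n. (b k)\<^sup>2) = 1"
  shows "\<bar>\<Sum>k<n. a k * b k\<bar> \<le> 1"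
proof -
  have "\<bar>\<Sum>k<n. a k * b k\<bar> \<le> (\<Sum>k<n. \<bar>a k * b k\<bar>)" by (rule sum_abs)
  also have "\<dots> \<le> (\<Sum>k<n. ((a k)\<^sup>2 + (b k)\<^sup>2) / 2)"
  proof (rule sum_mono)
    fix k
    have "0 \<le> (\<bar>a k\<bar> - \<bar>b k\<bar>)\<^sup>2" by simp
    then show "\<bar>a k * b k\<bar> \<le> ((a k)\<^sup>2 + (b k)\<^sup>2) / 2" by (simp add: power2_diff abs_mult)
  qed
  also have "\<dots> = 1" using a b by (simp add: sum_divide_distrib[symmetric] sum.distrib)
  finally show ?thesis .
qed

lemma distr_gauss_vec_pair:
  assumes a: "(\<Sum>k<n. (a k)\<^sup>2) = 1" and b: "(\<Sum>k<n. (b k)\<^sup>2) = 1"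
    and r: "(\<Sum>k<n. a k * b k) = r"
  shows "distr (gauss_vec n) (borel \<Otimes>\<^sub>M borel) (\<lambda>z. (\<Sum>k<n. a k * z k, \<Sum>k<n. b k * z k))
    = distr (std_gauss \<Otimes>\<^sub>M std_gauss) (borel \<Otimes>\<^sub>M borel) (\<lambda>(u, v). (u, r*u + sqrt (1 - r\<^sup>2)* v))" (is "?L = ?R")
proof (rule measure_eqI)
  fix A assume "A \<in> sets ?L"
  then have A[measurable]: "A \<in> sets (borel \<Otimes>\<^sub>M borel)" by simp
  have "emeasure ?L A = (\<integral>\<^sup>+x. indicator A x \<partial>?L)" by simp
  also have "\<dots> = (\<integral>\<^sup>+z. indicator A (\<Sum>k<n. a k * z k, \<Sum>k<n. b k * z k) \<partial>gauss_vec n)"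
    by (rule nn_integral_distr) measurable
  also have "\<dots> = (\<integral>\<^sup>+u. \<integral>\<^sup>+v. indicator A (u, r*u + sqrt (1 - r\<^sup>2)* v) \<partial>std_gauss \<partial>std_gauss)"
    by (rule nn_integral_gauss_vec_pair[OF a b r]) measurable
  also have "\<dots> = (\<integral>\<^sup>+p. indicator A (case p of (u, v) \<Rightarrow> (u, r*u + sqrt (1 - r\<^sup>2)* v)) \<partial>(std_gauss \<Otimes>\<^sub>M std_gauss))"
    by (subst std_gauss.nn_integral_fst[symmetric]) simp_all
  also have "\<dots> = (\<integral>\<^sup>+x. indicator A x \<partial>?R)"
    by (rule nn_integral_distr[symmetric]) measurable
  finally show "emeasure ?L A = emeasure ?R A" by simp
qed simp

lemma distr_gauss_vec_inner:
  assumes a: "(\<Sum>k<n. (a k)\<^sup>2) = 1"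
  shows "distr (gauss_vec n) borel (\<lambda>z. \<Sum>k<n. a k * z k) = std_gauss" (is "?L = _")
proof (rule measure_eqI)
  fix A assume "A \<in> sets ?L"
  then have A[measurable]: "A \<in> sets borel" by simp
  have "emeasure ?L A = (\<integral>\<^sup>+x. indicator A x \<partial>?L)" by simp
  also have "\<dots> = (\<integral>\<^sup>+z. indicator A (\<Sum>k<n. a k * z k) \<partial>gauss_vec n)"
    by (rule nn_integral_distr) measurable
  also have "\<dots> = (\<integral>\<^sup>+u. \<integral>\<^sup>+v. indicator A u \<partial>std_gauss \<partial>std_gauss)"
    using nn_integral_gauss_vec_pair[OF a a refl, of "\<lambda>p. indicator A (fst p)"] by simp
  finally show "emeasure ?L A = emeasure std_gauss A" by (simp add: std_gauss.emeasure_space_1[simplified])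
qed simp

section \<open>Factorisation of covariance matrices\<close>

lemma quadratic_form_Suc:
  fixes S :: "nat \<Rightarrow> nat \<Rightarrow> real"
  assumes sym: "\<And>i. i < d \<Longrightarrow> S d i = S i d"
  shows "(\<Sum>i<Suc d. \<Sum>j<Suc d. x i * S i j * x j)
    = (\<Sum>i<d. \<Sum>j<d. x i * S i j * x j) + 2 * x d * (\<Sum>i<d. x i * S i d) + (x d)\<^sup>2 * S d d"
proof -
  have "(\<Sum>j<d. x d * S d j * x j) = x d * (\<Sum>i<d. x i * S i d)"
    unfolding sum_distrib_left by (rule sum.cong) (simp_all add: sym)
  then show ?thesis
    by (simp add: sum.distrib sum_distrib_left sum_distrib_right power2_eq_square algebra_simps)
qed

text \<open>Cholesky factorisation: induction on the dimension through the Schur complement of the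
  last diagonal entry \<open>s\<close>. If \<open>s = 0\<close>, semidefiniteness forces the last
  column to vanish, and division by zero then produces the right zero entries.\<close>

lemma is_cov_factor_exists:
  assumes "is_cov d S"
  shows "\<exists>A :: nat \<Rightarrow> nat \<Rightarrow> real. \<forall>i<d. \<forall>j<d. (\<Sum>k<d. A i k * A j k) = S i j"
  using assms
proof (induction d arbitrary: S)
  case 0
  then show ?case by simp
next
  case (Suc d)
  define s where "s = S d d"
  have sym: "S i j = S j i" if "i < Suc d" "j < Suc d" for i j
    using Suc.prems that unfolding is_cov_def by blast
  have expand: "(\<Sum>i<Suc d. \<Sum>j<Suc d. x i * S i j * x j)
    = (\<Sum>i<d. \<Sum>j<d. x i * S i j * x j) + 2 * x d * (\<Sum>i<d. x i * S i d) + (x d)\<^sup>2 * s" for x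
    unfolding s_def by (rule quadratic_form_Suc) (simp add: sym)
  have nonneg: "0 \<le> (\<Sum>i<d. \<Sum>j<d. x i * S i j * x j) + 2 * x d * (\<Sum>i<d. x i * S i d) + (x d)\<^sup>2 * s" for x
    using Suc.prems unfolding is_cov_def expand[symmetric] by blast
  have s: "0 \<le> s" using nonneg[of "\<lambda>i. if i = d then 1 else 0"] by simp
  have zero: "S i d = 0" if "s = 0" "i < d" for i
  proof (rule ccontr)
    assume "S i d \<noteq> 0"
    \<comment> \<open>At the vector with entries 1 at \<open>i\<close> and \<open>t\<close> at
      \<open>d\<close> the form equals \<open>S i i + 2 * t * S i d\<close>; this \<open>t\<close>
      makes it \<open>-1\<close>.\<close>
    define t where "t = - (S i i + 1) / (2 * S i d)"
    have "(\<Sum>a<d. \<Sum>b<d. (if a = i then 1 else if a = d then t else 0) * S a b * (if b = i then 1 else if b = d then t else 0)) = S i i"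
    proof -
      have "(\<Sum>b<d. (if a = i then 1 else if a = d then t else 0) * S a b * (if b = i then 1 else if b = d then t else 0))
         = (if a = i then S i i else 0)" if "a < d" for a
      proof -
        have "(\<Sum>b<d. (if a = i then 1 else if a = d then t else 0) * S a b * (if b = i then 1 else if b = d then t else 0))
           = (\<Sum>b<d. if b = i then (if a = i then S i i else 0) else 0)"
          using that by (intro sum.cong) auto
        then show ?thesis using \<open>i < d\<close> by simp
      qed
      then show ?thesis using \<open>i < d\<close> by simp
    qed
    moreover have "(\<Sum>a<d. (if a = i then 1 else if a = d then t else 0) * S a d) = S i d"
    proof -
      have "(\<Sum>a<d. (if a = i then 1 else if a = d then t else 0) * S a d) = (\<Sum>a<d. if a = i then S i d else 0)"
        by (intro sum.cong) auto
      then show ?thesis using \<open>i < d\<close> by simp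
    qed
    ultimately have "0 \<le> S i i + 2 * t * S i d"
      using nonneg[of "\<lambda>a. if a = i then 1 else if a = d then t else 0"] that by simp
    moreover have "2 * t * S i d = - (S i i + 1)" using \<open>S i d \<noteq> 0\<close> by (simp add: t_def)
    ultimately show False by simp
  qed
  define S' where "S' i j = S i j - S i d * S j d / s" for i j
  have "is_cov d S'"
    unfolding is_cov_def
  proof (intro conjI allI impI)
    show "S' i j = S' j i" if "i < d" "j < d" for i j
      using sym that by (simp add: S'_def)
    fix x :: "nat \<Rightarrow> real"
    define L where "L = (\<Sum>i<d. x i * S i d)"
    have "(\<Sum>i<d. \<Sum>j<d. x i * S' i j * x j)
        = (\<Sum>i<d. \<Sum>j<d. x i * S i j * x j) - (\<Sum>i<d. \<Sum>j<d. (x i * S i d) * (x j * S j d)) / s"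
      unfolding S'_def sum_divide_distrib sum_subtractf[symmetric]
      by (intro sum.cong refl) (simp add: algebra_simps)
    also have "(\<Sum>i<d. \<Sum>j<d. (x i * S i d) * (x j * S j d)) = L * L"
      unfolding L_def by (rule sum_product[symmetric])
    finally have *: "(\<Sum>i<d. \<Sum>j<d. x i * S' i j * x j) = (\<Sum>i<d. \<Sum>j<d. x i * S i j * x j) - L * L / s" .
    \<comment> \<open>For \<open>s > 0\<close> the last entry \<open>- L / s\<close> minimises the
      form in that coordinate, and the minimum is the form of \<open>S'\<close>.\<close>
    have "0 \<le> (\<Sum>i<d. \<Sum>j<d. x i * S i j * x j) + 2 * (- L / s) * L + (- L / s)\<^sup>2 * s"
      using nonneg[of "x(d := - L / s)"] by (simp add: L_def)
    moreover have "2 * (- L / s) * L + (- L / s)\<^sup>2 * s = - (L * L / s)"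
      by (simp add: power2_eq_square field_simps)
    ultimately show "0 \<le> (\<Sum>i<d. \<Sum>j<d. x i * S' i j * x j)" unfolding * by linarith
  qed
  then obtain A where A: "\<And>i j. i < d \<Longrightarrow> j < d \<Longrightarrow> (\<Sum>k<d. A i k * A j k) = S' i j"
    using Suc.IH by blast
  \<comment> \<open>\<open>A\<close> is extended by a zero row and by the column
    \<open>S i d / sqrt s\<close>, whose entry in row \<open>d\<close> is
    \<open>sqrt s\<close>.\<close>
  define B where "B i k = (if k < d then (if i < d then A i k else 0) else S i d / sqrt s)" for i k
  have "(\<Sum>k<Suc d. B i k * B j k) = S i j" if ij: "i < Suc d" "j < Suc d" for i j
  proof -
    have last: "B i d * B j d = S i d * S j d / s" using s by (simp add: B_def)
    have first: "(\<Sum>k<d. B i k * B j k) = (if i < d \<and> j < d then S' i j else 0)"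
      by (auto simp: B_def A)
    have eq: "(\<Sum>k<Suc d. B i k * B j k) = (if i < d \<and> j < d then S' i j else 0) + S i d * S j d / s"
      by (simp add: first last)
    consider "i < d" "j < d" | "i = d" | "j = d" using ij by linarith
    then show ?thesis
    proof cases
      case 1 then show ?thesis unfolding eq by (simp add: S'_def)
    next
      case 2
      then show ?thesis unfolding eq using ij zero[of j] sym[of j d] by (cases "s = 0"; cases "j = d") (auto simp: s_def)
    next
      case 3
      then show ?thesis unfolding eq using ij zero[of i] sym[of i d] by (cases "s = 0"; cases "i = d") (auto simp: s_def)
    qed
  qed
  then show ?case by blast
qed

lemma cov_factor:
  assumes "is_cov d S" "i < d" "j < d"
  shows "(\<Sum>k<d. cov_factor d S i k * cov_factor d S j k) = S i j"
  using someI_ex[OF is_cov_factor_exists[OF assms(1)]] assms(2,3) unfolding cov_factor_def by blast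

subsection \<open>Lower bound\<close>

lemma nn_integral_std_gauss_shift:
  fixes f :: "real \<Rightarrow> ennreal"
  assumes [measurable]: "f \<in> borel_measurable borel"
  shows "(\<integral>\<^sup>+y. f (y + h) \<partial>std_gauss) = (\<integral>\<^sup>+y. f y * ennreal (exp (h * y - h\<^sup>2 / 2)) \<partial>std_gauss)"
proof -
  have "(\<integral>\<^sup>+y. f y * ennreal (exp (h * y - h\<^sup>2 / 2)) \<partial>std_gauss)
      = (\<integral>\<^sup>+y. ennreal (std_normal_density y) * (f y * ennreal (exp (h * y - h\<^sup>2 / 2))) \<partial>lborel)"
    by (rule nn_integral_std_gauss) simp
  also have "\<dots> = (\<integral>\<^sup>+y. ennreal (std_normal_density (y - h)) * f y \<partial>lborel)"
  proof (rule nn_integral_cong)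
    fix y
    have "std_normal_density (y - h) = std_normal_density y * exp (h * y - h\<^sup>2 / 2)"
      by (simp add: std_normal_density_def exp_add[symmetric] power2_eq_square field_simps)
    then show "ennreal (std_normal_density y) * (f y * ennreal (exp (h * y - h\<^sup>2 / 2))) = ennreal (std_normal_density (y - h)) * f y"
      by (simp add: ennreal_mult mult_ac)
  qed
  also have "\<dots> = (\<integral>\<^sup>+y. ennreal (std_normal_density y) * f (y + h) \<partial>lborel)"
    by (subst nn_integral_real_affine[of _ 1 h]) (simp_all add: add.commute)
  also have "\<dots> = (\<integral>\<^sup>+y. f (y + h) \<partial>std_gauss)"
    by (rule nn_integral_std_gauss[symmetric]) simp
  finally show ?thesis by simp
qed

text \<open>Cameron-Martin formula. The last coordinate is treated by the one-dimensional shift, the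
  others by the induction hypothesis at a fixed value of the last one.\<close>

lemma nn_integral_gauss_vec_shift:
  assumes "F \<in> borel_measurable (PiM {..<n} (\<lambda>_. borel))"
  shows "(\<integral>\<^sup>+z. F (\<lambda>i\<in>{..<n}. z i + h i) \<partial>gauss_vec n)
     = (\<integral>\<^sup>+z. F z * ennreal (exp ((\<Sum>i<n. h i * z i) - (\<Sum>i<n. (h i)\<^sup>2) / 2)) \<partial>gauss_vec n)"
  using assms
proof (induction n arbitrary: F)
  case 0
  then show ?case by (intro nn_integral_cong) (simp add: space_PiM PiE_def extensional_def restrict_def)
next
  case (Suc n)
  note F[measurable] = Suc.prems
  let ?e = "\<lambda>n z. exp ((\<Sum>i<n. h i * z i) - (\<Sum>i<n. (h i)\<^sup>2) / 2)"
  \<comment> \<open>Joint measurability in \<open>(y, x)\<close> makes the partial integral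
    \<open>f\<close> measurable.\<close>
  have [measurable]: "(\<lambda>p. (snd p)(n := fst p)) \<in> borel \<Otimes>\<^sub>M PiM {..<n} (\<lambda>_. borel) \<rightarrow>\<^sub>M PiM {..<Suc n} (\<lambda>_. borel)"
    unfolding lessThan_Suc by (intro measurable_fun_upd[where J="{..<n}"]) auto
  have [measurable]: "(\<lambda>x. x(n := y)) \<in> PiM {..<n} (\<lambda>_. borel) \<rightarrow>\<^sub>M PiM {..<Suc n} (\<lambda>_. borel)" for y :: real
    unfolding lessThan_Suc by (intro measurable_fun_upd[where J="{..<n}"]) auto
  define f where "f y = (\<integral>\<^sup>+x. F (x(n := y)) * ennreal (?e n x) \<partial>gauss_vec n)" for y
  have [measurable]: "f \<in> borel_measurable borel"
  proof -
    have "(\<lambda>y. \<integral>\<^sup>+x. F ((snd (y, x))(n := fst (y, x))) * ennreal (?e n (snd (y,x))) \<partial>gauss_vec n) \<in> borel_measurable borel"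
      by measurable
    then show ?thesis unfolding f_def by simp
  qed
  have "(\<integral>\<^sup>+z. F (\<lambda>i\<in>{..<Suc n}. z i + h i) \<partial>gauss_vec (Suc n))
      = (\<integral>\<^sup>+y. \<integral>\<^sup>+x. F (\<lambda>i\<in>{..<Suc n}. (x(n := y)) i + h i) \<partial>gauss_vec n \<partial>std_gauss)"
    by (rule gauss_vec_nn_integral_Suc) measurable
  also have "\<dots> = (\<integral>\<^sup>+y. \<integral>\<^sup>+x. F ((\<lambda>i\<in>{..<n}. x i + h i)(n := y + h n)) \<partial>gauss_vec n \<partial>std_gauss)"
    by (intro nn_integral_cong arg_cong[where f=F]) (auto simp: fun_eq_iff restrict_def)
  also have "\<dots> = (\<integral>\<^sup>+y. f (y + h n) \<partial>std_gauss)"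
    unfolding f_def
    by (intro nn_integral_cong Suc.IH) measurable
  also have "\<dots> = (\<integral>\<^sup>+y. f y * ennreal (exp (h n * y - (h n)\<^sup>2 / 2)) \<partial>std_gauss)"
    by (rule nn_integral_std_gauss_shift) simp
  also have "\<dots> = (\<integral>\<^sup>+y. \<integral>\<^sup>+x. F (x(n := y)) * ennreal (?e (Suc n) (x(n := y))) \<partial>gauss_vec n \<partial>std_gauss)"
  proof (rule nn_integral_cong)
    fix y
    have "f y * ennreal (exp (h n * y - (h n)\<^sup>2 / 2)) = (\<integral>\<^sup>+x. F (x(n := y)) * ennreal (?e n x) * ennreal (exp (h n * y - (h n)\<^sup>2 / 2)) \<partial>gauss_vec n)"
      unfolding f_def by (rule nn_integral_multc[symmetric]) measurable
    also have "\<dots> = (\<integral>\<^sup>+x. F (x(n := y)) * ennreal (?e (Suc n) (x(n := y))) \<partial>gauss_vec n)"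
      by (intro nn_integral_cong) (simp add: mult.assoc ennreal_mult[symmetric] exp_add[symmetric] algebra_simps add_divide_distrib)
    finally show "f y * ennreal (exp (h n * y - (h n)\<^sup>2 / 2)) = (\<integral>\<^sup>+x. F (x(n := y)) * ennreal (?e (Suc n) (x(n := y))) \<partial>gauss_vec n)" .
  qed
  also have "\<dots> = (\<integral>\<^sup>+z. F z * ennreal (?e (Suc n) z) \<partial>gauss_vec (Suc n))"
    by (rule gauss_vec_nn_integral_Suc[symmetric]) measurable
  finally show ?case .
qed

text \<open>A statistic cannot be close to 0 and, under the density \<open>L\<close>, close to
  \<open>t\<close> if \<open>L\<close> has bounded second moment. Integrating
  \<open>t * L \<le> |T - t| * L + |T| * L\<close> after weighted AM-GM gives
  \<open>t \<le> 3 * R / t + 5 * t / 8\<close>.\<close>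

lemma two_hypotheses_bound:
  fixes T L :: "'z \<Rightarrow> real" and R t :: real
  assumes [measurable]: "T \<in> borel_measurable M" "L \<in> borel_measurable M"
    and L: "\<And>z. 0 \<le> L z" "(\<integral>\<^sup>+z. ennreal (L z) \<partial>M) = 1" "(\<integral>\<^sup>+z. ennreal ((L z)\<^sup>2) \<partial>M) \<le> 3"
    and t: "0 < t" and R: "0 \<le> R"
    and R0: "(\<integral>\<^sup>+z. ennreal ((T z)\<^sup>2) \<partial>M) \<le> ennreal R"
    and R1: "(\<integral>\<^sup>+z. ennreal ((T z - t)\<^sup>2) * ennreal (L z) \<partial>M) \<le> ennreal R"
  shows "t\<^sup>2 / 8 \<le> R"
proof -
  have pt: "t * L z \<le> (1/t) * ((T z - t)\<^sup>2 * L z) + (t/4) * L z + (2/t) * (T z)\<^sup>2 + (t/8) * (L z)\<^sup>2" for z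
  proof -
    \<comment> \<open>The weights here and in the next square are such that the terms free of
      \<open>R\<close> integrate to at most \<open>t / 4 + 3 * t / 8 < t\<close>.\<close>
    have "0 \<le> (1/t) * (\<bar>T z - t\<bar> - t/2)\<^sup>2" using t by simp
    then have "\<bar>T z - t\<bar> \<le> (1/t) * (T z - t)\<^sup>2 + t/4"
      using t by (simp add: power2_diff field_simps power2_eq_square)
    then have "\<bar>T z - t\<bar> * L z \<le> ((1/t) * (T z - t)\<^sup>2 + t/4) * L z" using L(1) by (rule mult_right_mono)
    moreover have "0 \<le> (2/t) * (\<bar>T z\<bar> - t * L z / 4)\<^sup>2" using t by simp
    then have "\<bar>T z\<bar> * L z \<le> (2/t) * (T z)\<^sup>2 + (t/8) * (L z)\<^sup>2"
      using t by (simp add: power2_diff field_simps power2_eq_square)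
    moreover have "t * L z \<le> (\<bar>T z - t\<bar> + \<bar>T z\<bar>) * L z"
      by (rule mult_right_mono) (use L(1) in auto)
    ultimately show ?thesis by (simp add: algebra_simps)
  qed
  have "ennreal t = (\<integral>\<^sup>+z. ennreal t * ennreal (L z) \<partial>M)"
    using L(2) by (simp add: nn_integral_cmult)
  also have "\<dots> \<le> (\<integral>\<^sup>+z. ennreal (1/t) * (ennreal ((T z - t)\<^sup>2) * ennreal (L z)) + ennreal (t/4) * ennreal (L z) + ennreal (2/t) * ennreal ((T z)\<^sup>2) + ennreal (t/8) * ennreal ((L z)\<^sup>2) \<partial>M)"
    using pt t L(1) by (intro nn_integral_mono) (simp add: ennreal_mult[symmetric] ennreal_plus[symmetric] del: ennreal_plus)
  also have "\<dots> = ennreal (1/t) * (\<integral>\<^sup>+z. ennreal ((T z - t)\<^sup>2) * ennreal (L z) \<partial>M) + ennreal (t/4) * (\<integral>\<^sup>+z. ennreal (L z) \<partial>M)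
      + ennreal (2/t) * (\<integral>\<^sup>+z. ennreal ((T z)\<^sup>2) \<partial>M) + ennreal (t/8) * (\<integral>\<^sup>+z. ennreal ((L z)\<^sup>2) \<partial>M)"
    by (simp add: nn_integral_add nn_integral_cmult)
  also have "\<dots> \<le> ennreal (1/t) * ennreal R + ennreal (t/4) * 1 + ennreal (2/t) * ennreal R + ennreal (t/8) * 3"
    using L R0 R1 by (intro add_mono mult_left_mono) auto
  also have "\<dots> = ennreal ((1/t) * R + t/4 + (2/t) * R + (t/8) * 3)"
    using t R by (simp add: ennreal_mult[symmetric] ennreal_plus[symmetric] del: ennreal_plus flip: ennreal_numeral)
  finally have "t \<le> (1/t) * R + t/4 + (2/t) * R + (t/8) * 3"
    using t R by (subst (asm) ennreal_le_iff) auto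
  then show ?thesis using t by (simp add: field_simps power2_eq_square)
qed

abbreviation gauss_lr :: "nat \<Rightarrow> (nat \<Rightarrow> real) \<Rightarrow> (nat \<Rightarrow> real) \<Rightarrow> real" where
  "gauss_lr n h z \<equiv> exp ((\<Sum>i<n. h i * z i) - (\<Sum>i<n. (h i)\<^sup>2) / 2)"

lemma nn_integral_gauss_lr: "(\<integral>\<^sup>+z. ennreal (gauss_lr n h z) \<partial>gauss_vec n) = 1"
  using nn_integral_gauss_vec_shift[of "\<lambda>_. 1" n h] prob_space.emeasure_space_1[OF prob_space_gauss_vec, of n]
  by simp

text \<open>One ratio is absorbed as a shift by \<open>h\<close>, under which the other gains only
  the constant factor \<open>exp (\<Sum>i<n. h i * h' i)\<close>. These are the cross terms in the
  second moment of a mixture.\<close>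

lemma nn_integral_gauss_lr_mult:
  "(\<integral>\<^sup>+z. ennreal (gauss_lr n h z * gauss_lr n h' z) \<partial>gauss_vec n) = ennreal (exp (\<Sum>i<n. h i * h' i))"
proof -
  have "(\<integral>\<^sup>+z. ennreal (gauss_lr n h z * gauss_lr n h' z) \<partial>gauss_vec n)
      = (\<integral>\<^sup>+z. ennreal (gauss_lr n h' z) * ennreal (gauss_lr n h z) \<partial>gauss_vec n)"
    by (simp add: ennreal_mult mult.commute)
  also have "\<dots> = (\<integral>\<^sup>+z. ennreal (gauss_lr n h' (\<lambda>i\<in>{..<n}. z i + h i)) \<partial>gauss_vec n)"
    by (rule nn_integral_gauss_vec_shift[symmetric]) measurable
  also have "\<dots> = (\<integral>\<^sup>+z. ennreal (exp (\<Sum>i<n. h i * h' i)) * ennreal (gauss_lr n h' z) \<partial>gauss_vec n)"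
    by (intro nn_integral_cong)
      (simp add: ennreal_mult[symmetric] exp_add[symmetric] algebra_simps sum.distrib)
  also have "\<dots> = ennreal (exp (\<Sum>i<n. h i * h' i))"
    by (subst nn_integral_cmult) (measurable, simp add: nn_integral_gauss_lr)
  finally show ?thesis .
qed

abbreviation noise :: "nat \<Rightarrow> (nat \<Rightarrow> nat \<Rightarrow> real) \<Rightarrow> nat \<Rightarrow> (nat \<Rightarrow> real) \<Rightarrow> real" where
  "noise d S i z \<equiv> (\<Sum>k<d. cov_factor d S i k * z k)"

lemma risk_eq:
  assumes T: "T \<in> estimators d"
  shows "risk d T \<theta> \<sigma> S
    = (\<integral>\<^sup>+z. ennreal ((T (\<lambda>i\<in>{..<d}. \<theta> i + \<sigma> * noise d S i z) - l2norm d \<theta>)\<^sup>2) \<partial>gauss_vec d)"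
proof -
  have [measurable]: "T \<in> borel_measurable (PiM {..<d} (\<lambda>_. borel))"
    using T by (simp add: estimators_def)
  show ?thesis unfolding risk_def obs_law_def by (rule nn_integral_distr) measurable
qed

text \<open>In the space of \<open>z\<close> the signal \<open>\<theta> c\<close> is a shift by
  \<open>H c\<close>, so the likelihood ratio makes sense even for singular \<open>S\<close>. The
  uniform mixture over \<open>C\<close> is tested against the zero signal; the common norm
  \<open>t\<close> lets it act as a single alternative, and \<open>chi\<close> bounds the second
  moment of its likelihood ratio by 3.\<close>

lemma gaussian_mixture_lower_bound:
  fixes H :: "'c \<Rightarrow> nat \<Rightarrow> real"
  assumes C: "finite C" "C \<noteq> {}"
    and \<theta>: "\<And>c i. c \<in> C \<Longrightarrow> i < d \<Longrightarrow> \<theta> c i = \<sigma> * noise d S i (H c)"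
    and mem: "(\<lambda>_. 0, S) \<in> P" "\<And>c. c \<in> C \<Longrightarrow> (\<theta> c, S) \<in> P"
    and t: "\<And>c. c \<in> C \<Longrightarrow> l2norm d (\<theta> c) = t" "0 < t"
    and chi: "(\<Sum>c\<in>C. \<Sum>c'\<in>C. exp (\<Sum>i<d. H c i * H c' i)) \<le> 3 * (real (card C))\<^sup>2"
    and T: "T \<in> estimators d"
  shows "ennreal (t\<^sup>2 / 8) \<le> (SUP p\<in>P. risk d T (fst p) \<sigma> (snd p))"
proof (cases "(SUP p\<in>P. risk d T (fst p) \<sigma> (snd p))" rule: ennreal_cases)
  case (real R)
  have le: "risk d T \<theta>' \<sigma> S \<le> ennreal R" if "(\<theta>', S) \<in> P" for \<theta>'
    using SUP_upper[OF that, of "\<lambda>p. risk d T (fst p) \<sigma> (snd p)"] real by simp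
  have [measurable]: "T \<in> borel_measurable (PiM {..<d} (\<lambda>_. borel))"
    using T by (simp add: estimators_def)
  \<comment> \<open>The estimator under zero signal, as a function of \<open>z\<close>; under
    \<open>\<theta> c\<close> its argument is shifted by \<open>H c\<close>.\<close>
  define T' where "T' z = T (\<lambda>i\<in>{..<d}. \<sigma> * noise d S i z)" for z
  have T'[measurable]: "T' \<in> borel_measurable (PiM {..<d} (\<lambda>_. borel))" unfolding T'_def by measurable
  have T'2[measurable]: "T' \<in> borel_measurable (gauss_vec d)" unfolding T'_def by measurable
  define N where "N = real (card C)"
  have N: "N > 0" using C by (simp add: N_def card_gt_0_iff)
  define L where "L z = (\<Sum>c\<in>C. gauss_lr d (H c) z) / N" for z
  have [measurable]: "L \<in> borel_measurable (gauss_vec d)" unfolding L_def by measurable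
  have L0: "0 \<le> L z" for z unfolding L_def using N by (intro divide_nonneg_pos sum_nonneg) auto
  have Leq: "ennreal (L z) = ennreal (1/N) * (\<Sum>c\<in>C. ennreal (gauss_lr d (H c) z))" for z
    unfolding L_def using N by (simp add: ennreal_mult[symmetric] sum_nonneg)
  have L1: "(\<integral>\<^sup>+z. ennreal (L z) \<partial>gauss_vec d) = 1"
  proof -
    have "(\<integral>\<^sup>+z. ennreal (L z) \<partial>gauss_vec d) = ennreal (1/N) * (\<Sum>c\<in>C. \<integral>\<^sup>+z. ennreal (gauss_lr d (H c) z) \<partial>gauss_vec d)"
      unfolding Leq by (subst nn_integral_cmult, measurable, subst nn_integral_sum) auto
    also have "\<dots> = ennreal (1/N) * ennreal N"
      unfolding nn_integral_gauss_lr by (simp add: N_def ennreal_of_nat_eq_real_of_nat)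
    finally show ?thesis using N by (simp add: ennreal_mult[symmetric])
  qed
  have L2: "(\<integral>\<^sup>+z. ennreal ((L z)\<^sup>2) \<partial>gauss_vec d) \<le> 3"
  proof -
    have "(L z)\<^sup>2 = (1/N\<^sup>2) * (\<Sum>c\<in>C. \<Sum>c'\<in>C. gauss_lr d (H c) z * gauss_lr d (H c') z)" for z
      unfolding L_def sum_product[symmetric] by (simp add: power2_eq_square)
    then have "ennreal ((L z)\<^sup>2) = ennreal (1/N\<^sup>2) * (\<Sum>c\<in>C. \<Sum>c'\<in>C. ennreal (gauss_lr d (H c) z * gauss_lr d (H c') z))" for z
      by (simp add: ennreal_mult[symmetric] sum_nonneg del: mult_exp_exp)
    then have "(\<integral>\<^sup>+z. ennreal ((L z)\<^sup>2) \<partial>gauss_vec d)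
       = ennreal (1/N\<^sup>2) * (\<Sum>c\<in>C. \<Sum>c'\<in>C. \<integral>\<^sup>+z. ennreal (gauss_lr d (H c) z * gauss_lr d (H c') z) \<partial>gauss_vec d)"
      by (simp only:, subst nn_integral_cmult, measurable, simp add: nn_integral_sum del: mult_exp_exp sum_ennreal)
    also have "\<dots> = ennreal ((1/N\<^sup>2) * (\<Sum>c\<in>C. \<Sum>c'\<in>C. exp (\<Sum>i<d. H c i * H c' i)))"
      unfolding nn_integral_gauss_lr_mult by (simp add: ennreal_mult[symmetric] sum_nonneg)
    also have "\<dots> \<le> ennreal 3"
      using chi N by (intro ennreal_leI) (simp add: N_def field_simps)
    finally show ?thesis by simp
  qed
  have R0: "(\<integral>\<^sup>+z. ennreal ((T' z)\<^sup>2) \<partial>gauss_vec d) \<le> ennreal R"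
    using le[OF mem(1)] unfolding risk_eq[OF T] by (simp add: T'_def l2norm_def)
  have R1: "(\<integral>\<^sup>+z. ennreal ((T' z - t)\<^sup>2) * ennreal (gauss_lr d (H c) z) \<partial>gauss_vec d) \<le> ennreal R" if c: "c \<in> C" for c
  proof -
    have "(\<integral>\<^sup>+z. ennreal ((T' z - t)\<^sup>2) * ennreal (gauss_lr d (H c) z) \<partial>gauss_vec d)
      = (\<integral>\<^sup>+z. ennreal ((T' (\<lambda>i\<in>{..<d}. z i + H c i) - t)\<^sup>2) \<partial>gauss_vec d)"
      by (rule nn_integral_gauss_vec_shift[symmetric]) measurable
    also have "\<dots> = risk d T (\<theta> c) \<sigma> S"
      unfolding risk_eq[OF T] t(1)[OF c] T'_def
      by (intro nn_integral_cong arg_cong[where f=ennreal] arg_cong[where f="\<lambda>x. (T x - t)\<^sup>2"] restrict_ext)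
        (simp add: \<theta>[OF c] algebra_simps sum.distrib)
    finally show ?thesis using le[OF mem(2)[OF c]] by simp
  qed
  have R2: "(\<integral>\<^sup>+z. ennreal ((T' z - t)\<^sup>2) * ennreal (L z) \<partial>gauss_vec d) \<le> ennreal R"
  proof -
    have "(\<integral>\<^sup>+z. ennreal ((T' z - t)\<^sup>2) * ennreal (L z) \<partial>gauss_vec d)
      = (\<integral>\<^sup>+z. ennreal (1/N) * (\<Sum>c\<in>C. ennreal ((T' z - t)\<^sup>2) * ennreal (gauss_lr d (H c) z)) \<partial>gauss_vec d)"
      unfolding Leq sum_distrib_left[symmetric] by (simp add: mult_ac)
    also have "\<dots> = ennreal (1/N) * (\<Sum>c\<in>C. \<integral>\<^sup>+z. ennreal ((T' z - t)\<^sup>2) * ennreal (gauss_lr d (H c) z) \<partial>gauss_vec d)"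
      by (subst nn_integral_cmult, measurable, subst nn_integral_sum) auto
    also have "\<dots> \<le> ennreal (1/N) * (\<Sum>c\<in>C. ennreal R)"
      by (intro mult_left_mono sum_mono R1) auto
    also have "\<dots> = ennreal R"
      using N real by (simp add: ennreal_mult[symmetric] N_def[symmetric] ennreal_of_nat_eq_real_of_nat)
    finally show ?thesis .
  qed
  have "t\<^sup>2 / 8 \<le> R"
    by (rule two_hypotheses_bound[where M="gauss_vec d" and T=T' and L=L]) (use L0 L1 L2 R0 R2 t real in auto)
  then show ?thesis using real by (simp add: ennreal_leI)
next
  case top
  then show ?thesis by (metis top_greatest)
qed

section \<open>Block covariance matrices and the block-sparse prior\<close>

lemma sum_rotate:
  "(\<Sum>i\<in>A. \<Sum>j\<in>B. \<Sum>k\<in>C. f i j k) = (\<Sum>j\<in>B. \<Sum>k\<in>C. \<Sum>i\<in>A. (f i j k :: 'a :: comm_monoid_add))"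
  by (subst sum.swap) (rule sum.cong[OF refl], rule sum.swap)

lemma less_div_times_add: "0 < m \<Longrightarrow> i < i div m * m + (m :: nat)"
  using dividend_less_div_times[of m i] by linarith

text \<open>The coordinates below \<open>N\<close> are cut into blocks of size \<open>m\<close>, represented by their first element; the others form blocks of size one.\<close>
definition block_rep :: "nat \<Rightarrow> nat \<Rightarrow> nat \<Rightarrow> nat" where
  "block_rep m N i = (if i < N then i div m * m else i)"

definition block_cov :: "nat \<Rightarrow> nat \<Rightarrow> nat \<Rightarrow> nat \<Rightarrow> nat \<Rightarrow> real" where
  "block_cov d m N i j = of_bool (i < d \<and> j < d \<and> block_rep m N i = block_rep m N j)"

lemma block_rep_le: "block_rep m N i \<le> i"
  by (simp add: block_rep_def)

lemma block_cov_sym: "block_cov d m N i j = block_cov d m N j i"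
  unfolding block_cov_def by auto

text \<open>The matrix is \<open>B B\<^sup>T\<close> for the incidence matrix \<open>B\<close> of
  coordinates and block representatives, so its quadratic form is the sum of the squared block
  sums.\<close>

lemma is_cov_block_cov: "is_cov d (block_cov d m N)"
  unfolding is_cov_def
proof (intro conjI allI impI block_cov_sym)
  fix x :: "nat \<Rightarrow> real"
  let ?r = "block_rep m N"
  have fac: "block_cov d m N i j = (\<Sum>k<d. of_bool (?r i = k) * of_bool (?r j = k))" if "i < d" "j < d" for i j
  proof -
    have "?r i < d" using block_rep_le[of m N i] that by linarith
    have "(\<Sum>k<d. of_bool (?r i = k) * of_bool (?r j = k)) = (\<Sum>k<d. if ?r i = k then of_bool (?r j = ?r i) else (0::real))"
      by (intro sum.cong) auto
    also have "\<dots> = of_bool (?r j = ?r i)" using \<open>?r i < d\<close> by (subst sum.delta') auto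
    finally show ?thesis using that by (simp add: block_cov_def eq_commute del: sum_of_bool_eq sum_of_bool_mult_eq sum_mult_of_bool_eq)
  qed
  have "(\<Sum>i<d. \<Sum>j<d. x i * block_cov d m N i j * x j)
      = (\<Sum>i<d. \<Sum>j<d. \<Sum>k<d. (x i * of_bool (?r i = k)) * (x j * of_bool (?r j = k)))"
    by (intro sum.cong refl) (simp add: fac sum_distrib_left sum_distrib_right mult_ac del: sum_of_bool_eq sum_of_bool_mult_eq sum_mult_of_bool_eq)
  also have "\<dots> = (\<Sum>k<d. \<Sum>i<d. \<Sum>j<d. (x i * of_bool (?r i = k)) * (x j * of_bool (?r j = k)))"
    by (rule sum_rotate[symmetric])
  also have "\<dots> = (\<Sum>k<d. (\<Sum>i<d. x i * of_bool (?r i = k))\<^sup>2)"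
    by (simp only: power2_eq_square sum_product)
  also have "\<dots> \<ge> 0" by (intro sum_nonneg) simp
  finally show "0 \<le> (\<Sum>i<d. \<Sum>j<d. x i * block_cov d m N i j * x j)" .
qed

text \<open>The entries are 0 or 1, and each block lies in an interval of length \<open>m\<close> or
  is a singleton.\<close>

lemma block_cov_row:
  assumes m: "1 \<le> m"
  shows "(\<Sum>j<d. (block_cov d m N i j)\<^sup>2) \<le> real m"
proof -
  have "{j\<in>{..<d}. block_rep m N i = block_rep m N j} \<subseteq> (if i < N then {i div m * m..<i div m * m + m} else {i})"
  proof (cases "i < N")
    case True
    have "i div m * m \<le> j \<and> j < i div m * m + m" if "block_rep m N i = block_rep m N j" for j
    proof (cases "j < N")
      case jN: True
      then have "i div m * m = j div m * m" using that True by (simp add: block_rep_def)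
      moreover have "j div m * m \<le> j" "j < j div m * m + m"
        using m less_div_times_add[of m j] by auto
      ultimately show ?thesis by simp
    next
      case False
      \<comment> \<open>A coordinate from \<open>N\<close> on represents only itself, whereas the
        representative of \<open>i < N\<close> is below \<open>N\<close>.\<close>
      then have "j = i div m * m" using that True by (simp add: block_rep_def)
      moreover have "i div m * m \<le> i" by simp
      ultimately show ?thesis using False True by linarith
    qed
    then show ?thesis using True by auto
  next
    case False
    have "j = i" if "block_rep m N i = block_rep m N j" for j
      using that False block_rep_le[of m N j] by (auto simp: block_rep_def split: if_splits)
    then show ?thesis using False by auto
  qed
  then have "card {j\<in>{..<d}. block_rep m N i = block_rep m N j} \<le> card (if i < N then {i div m * m..<i div m * m + m} else {i})"
    by (intro card_mono) auto
  also have "\<dots> \<le> m" using m by auto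
  finally have c: "card {j\<in>{..<d}. block_rep m N i = block_rep m N j} \<le> m" .
  have "(\<Sum>j<d. (block_cov d m N i j)\<^sup>2) \<le> (\<Sum>j<d. of_bool (block_rep m N i = block_rep m N j))"
    by (intro sum_mono) (simp add: block_cov_def)
  also have "\<dots> = real (card {j\<in>{..<d}. block_rep m N i = block_rep m N j})"
    by (simp add: of_bool_def sum.If_cases Int_def)
  finally show ?thesis using c by linarith
qed

lemma frob_norm_block_cov:
  assumes m: "1 \<le> m" and \<rho>: "real d * real m \<le> \<rho>\<^sup>2" "0 \<le> \<rho>"
  shows "frob_norm d (block_cov d m N) \<le> \<rho>"
proof -
  have "(\<Sum>i<d. \<Sum>j<d. (block_cov d m N i j)\<^sup>2) \<le> (\<Sum>i<d. real m)"
    by (intro sum_mono block_cov_row m)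
  also have "\<dots> \<le> \<rho>\<^sup>2" using \<rho> by simp
  finally show ?thesis unfolding frob_norm_def using \<rho>(2) by (intro real_le_lsqrt)
qed

text \<open>Describes the signals used below: a combination of these columns is constant on the
  chosen blocks and zero elsewhere. The bound \<open>p * m + m \<le> N\<close> says that block
  \<open>p\<close> is complete.\<close>

lemma block_cov_head:
  assumes m: "1 \<le> m" and p: "p * m + m \<le> N" and N: "N \<le> d"
  shows "block_cov d m N i (p * m) = of_bool (i \<in> {p * m..<p * m + m})"
proof -
  have pm: "p * m < N" "p * m < d" using assms by linarith+
  have rp: "block_rep m N (p * m) = p * m" using pm m by (simp add: block_rep_def)
  have 1: "i div m * m = p * m \<longleftrightarrow> i \<in> {p * m..<p * m + m}"
  proof
    assume "i div m * m = p * m"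
    moreover have "i div m * m \<le> i" "i < i div m * m + m" using m less_div_times_add[of m i] by auto
    ultimately show "i \<in> {p * m..<p * m + m}" by simp
  next
    assume "i \<in> {p * m..<p * m + m}"
    then have "i div m = p" using m by (intro div_nat_eqI) (auto simp: algebra_simps)
    then show "i div m * m = p * m" by simp
  qed
  show ?thesis
  proof (cases "i < N")
    case True
    then show ?thesis using 1 pm N unfolding block_cov_def rp by (simp add: block_rep_def)
  next
    case False
    then have "i \<notin> {p * m..<p * m + m}" "i \<noteq> p * m" using p pm by auto
    then show ?thesis using False unfolding block_cov_def rp by (simp add: block_rep_def)
  qed
qed

text \<open>The exponential factorises over the groups, and in each group exactly one of the
  \<open>k\<close> values agrees with \<open>c g\<close>.\<close>

lemma sum_PiE_matches:
  fixes c :: "nat \<Rightarrow> nat" and x :: real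
  assumes c: "c \<in> PiE {..<n} (\<lambda>_. {..<k})"
  shows "(\<Sum>c'\<in>PiE {..<n} (\<lambda>_. {..<k}). exp (x * (\<Sum>g<n. of_bool (c g = c' g)))) = (exp x + (real k - 1)) ^ n"
proof -
  have "(\<Sum>c'\<in>PiE {..<n} (\<lambda>_. {..<k}). exp (x * (\<Sum>g<n. of_bool (c g = c' g))))
      = (\<Sum>c'\<in>PiE {..<n} (\<lambda>_. {..<k}). \<Prod>g<n. exp (x * of_bool (c g = c' g)))"
    by (simp add: sum_distrib_left exp_sum del: sum_of_bool_eq sum_of_bool_mult_eq sum_mult_of_bool_eq)
  also have "\<dots> = (\<Prod>g<n. \<Sum>y<k. exp (x * of_bool (c g = y)))"
    by (rule prod_sum_PiE[symmetric]) auto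
  also have "\<dots> = (\<Prod>g<n. exp x + (real k - 1))"
  proof (rule prod.cong)
    fix g assume "g \<in> {..<n}"
    then have "c g < k" using c by auto
    have "(\<Sum>y<k. exp (x * of_bool (c g = y))) = (\<Sum>y<k. 1 + (if c g = y then exp x - 1 else 0))"
      by (intro sum.cong) auto
    also have "\<dots> = exp x + (real k - 1)" using \<open>c g < k\<close> by (simp add: sum.distrib)
    finally show "(\<Sum>y<k. exp (x * of_bool (c g = y))) = exp x + (real k - 1)" .
  qed simp
  finally show ?thesis by simp
qed

text \<open>A choice function \<open>c\<close> selects one of \<open>k\<close> blocks in each of
  \<open>n\<close> groups, and the signal has amplitude \<open>\<sigma> * a\<close> on the selected
  blocks. Two such signals interact only through the groups where the choices agree, so the second
  moment of the likelihood ratio is an \<open>n\<close>-fold product.\<close>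

lemma block_lower_bound:
  assumes m: "1 \<le> m" and n: "1 \<le> n" and k: "1 \<le> k" and size: "n * k * m \<le> d" and s: "n * m \<le> s"
    and \<rho>: "real d * real m \<le> \<rho>\<^sup>2" "0 \<le> \<rho>" and \<sigma>: "0 < \<sigma>" and T: "T \<in> estimators d"
  shows "ennreal (\<sigma>\<^sup>2 * (real (n * m) * ln (1 + real k / real n)) / 8) \<le> (SUP p\<in>Theta s d \<rho>. risk d T (fst p) \<sigma> (snd p))"
proof -
  define N where "N = n * k * m"
  define S where "S = block_cov d m N"
  define C where "C = PiE {..<n} (\<lambda>_. {..<k})"
  \<comment> \<open>Global index of the block selected in group \<open>g\<close>; division by
    \<open>k\<close> recovers \<open>g\<close> and \<open>c g\<close>.\<close>
  define p where "p c g = g * k + c g" for c :: "nat \<Rightarrow> nat" and g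
  \<comment> \<open>Then \<open>exp (a\<^sup>2) = 1 + k / n\<close>, and the factor of each group in
    the second moment becomes \<open>k * (1 + 1 / n)\<close>.\<close>
  define a where "a = sqrt (ln (1 + real k / real n))"
  have "0 < ln (1 + real k / real n)" using n k by (intro ln_gt_zero) simp
  then have a: "0 < a" "a\<^sup>2 = ln (1 + real k / real n)" by (simp_all add: a_def)
  have cov: "is_cov d S" unfolding S_def by (rule is_cov_block_cov)
  have pN: "p c g * m + m \<le> N" if "c \<in> C" "g < n" for c g
  proof -
    have "c g < k" using that by (auto simp: C_def)
    then have "p c g + 1 \<le> (g + 1) * k" by (simp add: p_def)
    also have "\<dots> \<le> n * k" using that by (intro mult_right_mono) auto
    finally have "(p c g + 1) * m \<le> n * k * m" by (intro mult_right_mono) auto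
    then show ?thesis by (simp add: N_def algebra_simps)
  qed
  have Nd: "N \<le> d" using size by (simp add: N_def)
  have pd: "p c g * m < d" if "c \<in> C" "g < n" for c g
    using pN[OF that] Nd m by linarith
  have p_eq: "p c g = p c' g' \<longleftrightarrow> g = g' \<and> c g = c' g'" if "c \<in> C" "g < n" "c' \<in> C" "g' < n" for c g c' g'
  proof -
    have lt: "c g < k" "c' g' < k" using that by (auto simp: C_def)
    have "p c g div k = g" "p c g mod k = c g" "p c' g' div k = g'" "p c' g' mod k = c' g'"
      using lt by (simp_all add: p_def)
    then show ?thesis by (metis p_def)
  qed
  have Sp: "S i (p c g * m) = of_bool (i \<in> {p c g * m..<p c g * m + m})" if "c \<in> C" "g < n" for i c g
    unfolding S_def by (rule block_cov_head[OF m pN[OF that] Nd])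
  have Spp: "S (p c g * m) (p c' g' * m) = of_bool (g = g' \<and> c g = c' g')" if "c \<in> C" "g < n" "c' \<in> C" "g' < n" for c g c' g'
  proof -
    have "p c g * m \<in> {p c' g' * m..<p c' g' * m + m} \<longleftrightarrow> p c g = p c' g'"
    proof
      assume "p c g * m \<in> {p c' g' * m..<p c' g' * m + m}"
      then have "p c g * m div m = p c' g'" by (intro div_nat_eqI) (auto simp: algebra_simps)
      then show "p c g = p c' g'" using m by simp
    qed (use m in auto)
    then show ?thesis using Sp[OF that(3,4)] p_eq[OF that] by simp
  qed
  \<comment> \<open>Because \<open>A A\<^sup>T = S\<close>, applying \<open>A\<close> to its own row
    \<open>p c g * m\<close> yields that column of \<open>S\<close>, the indicator of the selected
    block.\<close>
  define H where "H c j = a * (\<Sum>g<n. cov_factor d S (p c g * m) j)" for c j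
  define \<theta> where "\<theta> c i = \<sigma> * a * (\<Sum>g<n. S i (p c g * m))" for c i
  have noise: "\<theta> c i = \<sigma> * noise d S i (H c)" if "c \<in> C" "i < d" for c i
  proof -
    have "noise d S i (H c) = a * (\<Sum>j<d. \<Sum>g<n. cov_factor d S i j * cov_factor d S (p c g * m) j)"
      unfolding H_def sum_distrib_left by (intro sum.cong refl) (simp add: mult_ac)
    also have "\<dots> = a * (\<Sum>g<n. S i (p c g * m))"
      by (subst sum.swap) (use cov_factor[OF cov that(2)] pd that in simp)
    finally show ?thesis by (simp add: \<theta>_def)
  qed
  have HH: "(\<Sum>j<d. H c j * H c' j) = a\<^sup>2 * (\<Sum>g<n. of_bool (c g = c' g))" if c: "c \<in> C" "c' \<in> C" for c c'
  proof -
    have "H c j * H c' j = a\<^sup>2 * (\<Sum>g<n. \<Sum>g'<n. cov_factor d S (p c g * m) j * cov_factor d S (p c' g' * m) j)" for j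
      unfolding H_def sum_product[symmetric] by (simp add: power2_eq_square mult_ac)
    then have "(\<Sum>j<d. H c j * H c' j) = a\<^sup>2 * (\<Sum>j<d. \<Sum>g<n. \<Sum>g'<n. cov_factor d S (p c g * m) j * cov_factor d S (p c' g' * m) j)"
      by (simp only: sum_distrib_left)
    also have "\<dots> = a\<^sup>2 * (\<Sum>g<n. \<Sum>g'<n. \<Sum>j<d. cov_factor d S (p c g * m) j * cov_factor d S (p c' g' * m) j)"
      by (subst sum_rotate) (rule refl)
    also have "\<dots> = a\<^sup>2 * (\<Sum>g<n. \<Sum>g'<n. of_bool (g = g' \<and> c g = c' g'))"
      using c by (intro arg_cong[where f="\<lambda>x. a\<^sup>2 * x"] sum.cong refl) (simp add: cov_factor[OF cov] pd Spp)
    also have "\<dots> = a\<^sup>2 * (\<Sum>g<n. \<Sum>g'<n. if g = g' then of_bool (c g = c' g) else 0)"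
      by (intro arg_cong[where f="\<lambda>x. a\<^sup>2 * x"] sum.cong refl) auto
    also have "\<dots> = a\<^sup>2 * (\<Sum>g<n. of_bool (c g = c' g))" by simp
    finally show ?thesis .
  qed
  have SS: "(\<Sum>i<d. S i (p c g * m) * S i (p c g' * m)) = (if g = g' then real m else 0)" if "c \<in> C" "g < n" "g' < n" for c g g'
  proof (cases "g = g'")
    case True
    have "(\<Sum>i<d. S i (p c g * m) * S i (p c g' * m)) = (\<Sum>i<d. of_bool (i \<in> {p c g * m..<p c g * m + m}))"
      unfolding True[symmetric] using Sp[OF that(1,2)] by (intro sum.cong) auto
    also have "\<dots> = real (card ({..<d} \<inter> {p c g * m..<p c g * m + m}))"
      by (simp add: of_bool_def sum.If_cases Int_def)
    also have "{..<d} \<inter> {p c g * m..<p c g * m + m} = {p c g * m..<p c g * m + m}"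
      using pN[OF that(1,2)] Nd by auto
    finally show ?thesis using True by simp
  next
    case False
    then have "p c g \<noteq> p c g'" using p_eq that by blast
    have "S i (p c g * m) * S i (p c g' * m) = 0" for i
    proof (rule ccontr)
      assume "S i (p c g * m) * S i (p c g' * m) \<noteq> 0"
      then have "i \<in> {p c g * m..<p c g * m + m}" "i \<in> {p c g' * m..<p c g' * m + m}"
        using Sp[OF that(1,2), of i] Sp[OF that(1,3), of i] by (auto split: if_splits)
      then have "i div m = p c g" "i div m = p c g'" by (auto intro!: div_nat_eqI simp: algebra_simps)
      then show False using \<open>p c g \<noteq> p c g'\<close> by simp
    qed
    then show ?thesis using False by (simp only: sum.neutral_const if_False)
  qed
  have norm: "l2norm d (\<theta> c) = \<sigma> * a * sqrt (real (n * m))" if c: "c \<in> C" for c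
  proof -
    have "(\<Sum>i<d. (\<theta> c i)\<^sup>2) = (\<sigma> * a)\<^sup>2 * (\<Sum>i<d. \<Sum>g<n. \<Sum>g'<n. S i (p c g * m) * S i (p c g' * m))"
      unfolding \<theta>_def sum_product[symmetric] sum_distrib_left by (simp add: power2_eq_square mult_ac sum_distrib_left)
    also have "\<dots> = (\<sigma> * a)\<^sup>2 * (\<Sum>g<n. \<Sum>g'<n. \<Sum>i<d. S i (p c g * m) * S i (p c g' * m))"
      by (subst sum_rotate) (rule refl)
    also have "\<dots> = (\<sigma> * a)\<^sup>2 * (\<Sum>g<n. \<Sum>g'<n. if g = g' then real m else 0)"
      using SS[OF c] by (intro arg_cong[where f="\<lambda>x. (\<sigma> * a)\<^sup>2 * x"] sum.cong refl) auto
    also have "\<dots> = (\<sigma> * a)\<^sup>2 * real (n * m)" by simp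
    finally show ?thesis unfolding l2norm_def using a \<sigma> by (simp add: real_sqrt_mult)
  qed
  have l0: "l0norm d (\<theta> c) \<le> s" if c: "c \<in> C" for c
  proof -
    have "{i\<in>{..<d}. \<theta> c i \<noteq> 0} \<subseteq> (\<Union>g<n. {p c g * m..<p c g * m + m})"
    proof
      fix i assume "i \<in> {i\<in>{..<d}. \<theta> c i \<noteq> 0}"
      then obtain g where "g < n" "S i (p c g * m) \<noteq> 0"
        unfolding \<theta>_def by (auto elim!: sum.not_neutral_contains_not_neutral)
      then show "i \<in> (\<Union>g<n. {p c g * m..<p c g * m + m})" using Sp[OF c \<open>g < n\<close>, of i] by (auto split: if_splits)
    qed
    then have "card {i\<in>{..<d}. \<theta> c i \<noteq> 0} \<le> card (\<Union>g<n. {p c g * m..<p c g * m + m})"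
      by (intro card_mono) auto
    also have "\<dots> \<le> (\<Sum>g<n. card {p c g * m..<p c g * m + m})" by (rule card_UN_le) simp
    also have "\<dots> = n * m" by simp
    finally show ?thesis using s by (simp add: l0norm_def)
  qed
  have S_diag: "S i i = 1" if "i < d" for i using that by (simp add: S_def block_cov_def)
  have S_out: "S i j = 0" if "i \<ge> d \<or> j \<ge> d" for i j using that by (auto simp: S_def block_cov_def)
  have frob: "frob_norm d S \<le> \<rho>" unfolding S_def by (rule frob_norm_block_cov) fact+
  have mem: "(\<theta> c, S) \<in> Theta s d \<rho>" if "c \<in> C" for c
    using l0[OF that] cov frob S_diag S_out unfolding Theta_def by (auto simp: \<theta>_def)
  have mem0: "(\<lambda>_. 0, S) \<in> Theta s d \<rho>"
    using cov frob S_diag S_out unfolding Theta_def by (auto simp: l0norm_def)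
  have C: "finite C" "C \<noteq> {}" "card C = k ^ n"
    unfolding C_def using k by (auto intro!: finite_PiE simp: PiE_eq_empty_iff card_PiE lessThan_empty_iff)
  \<comment> \<open>After normalisation by the squared number of choices only
    \<open>(1 + 1 / n) ^ n \<le> exp 1 \<le> 3\<close> remains.\<close>
  have chi: "(\<Sum>c\<in>C. \<Sum>c'\<in>C. exp (\<Sum>j<d. H c j * H c' j)) \<le> 3 * (real (card C))\<^sup>2"
  proof -
    have "(\<Sum>c\<in>C. \<Sum>c'\<in>C. exp (\<Sum>j<d. H c j * H c' j)) = (\<Sum>c\<in>C. (exp (a\<^sup>2) + (real k - 1)) ^ n)"
      using sum_PiE_matches[of _ n k "a\<^sup>2"] by (intro sum.cong refl) (simp add: HH C_def[symmetric])
    also have "\<dots> = real (k ^ n) * (real k * (1 + 1 / real n)) ^ n"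
    proof -
      have "exp (a\<^sup>2) = 1 + real k / real n" using n k by (simp add: a add_pos_nonneg)
      then have "exp (a\<^sup>2) + (real k - 1) = real k * (1 + 1 / real n)" by (simp add: algebra_simps)
      then show ?thesis using C by simp
    qed
    also have "\<dots> = (real k ^ n)\<^sup>2 * (1 + 1 / real n) ^ n"
      by (simp add: power_mult_distrib power2_eq_square)
    also have "\<dots> \<le> (real k ^ n)\<^sup>2 * 3"
    proof (rule mult_left_mono)
      have "(1 + 1 / real n) ^ n \<le> exp (1 / real n) ^ n" using exp_ge_add_one_self[of "1 / real n"] by (intro power_mono) auto
      also have "\<dots> = exp 1" using n by (simp add: exp_of_nat_mult[symmetric])
      also have "\<dots> \<le> 3" by (rule exp_le)
      finally show "(1 + 1 / real n) ^ n \<le> 3" .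
    qed simp
    finally show ?thesis using C by simp
  qed
  have "ennreal ((\<sigma> * a * sqrt (real (n * m)))\<^sup>2 / 8) \<le> (SUP p\<in>Theta s d \<rho>. risk d T (fst p) \<sigma> (snd p))"
    using gaussian_mixture_lower_bound[OF C(1,2) noise mem0 mem norm _ chi T] \<sigma> a m n by simp
  also have "(\<sigma> * a * sqrt (real (n * m)))\<^sup>2 / 8 = \<sigma>\<^sup>2 * (real (n * m) * ln (1 + real k / real n)) / 8"
    using a by (simp add: power_mult_distrib)
  finally show ?thesis .
qed

text \<open>The block size is the largest one compatible with the Frobenius bound, capped at
  \<open>s\<close>. The final factor 8 is a factor 2 from rounding times a factor 4 from comparing
  logarithms.\<close>

lemma block_sizes_exist:
  fixes s d :: nat and \<rho> :: real
  assumes s: "1 \<le> s" "s \<le> d" and \<rho>: "sqrt (real d) \<le> \<rho>" "\<rho> \<le> real d"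
  obtains m n k :: nat where "1 \<le> m" "1 \<le> n" "1 \<le> k" "n * k * m \<le> d" "n * m \<le> s" "real d * real m \<le> \<rho>\<^sup>2"
    "real s * ln (1 + \<rho>\<^sup>2 / (real s)\<^sup>2) \<le> 8 * (real (n * m) * ln (1 + real k / real n))"
proof -
  have d: "0 < real d" using s by simp
  have "0 \<le> \<rho>" using \<rho>(1) real_sqrt_ge_zero[of "real d"] d by linarith
  have \<rho>d: "real d \<le> \<rho>\<^sup>2" using \<rho>(1) by (metis real_sqrt_le_iff real_sqrt_abs abs_of_nonneg \<open>0 \<le> \<rho>\<close>)
  define x where "x = \<rho>\<^sup>2 / (real s)\<^sup>2"
  have x0: "0 \<le> x" by (simp add: x_def)
  \<comment> \<open>Comparing fourth powers absorbs constants, and even a square, inside the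
    logarithm at the price of a factor 4.\<close>
  have ln4: "ln (1 + x) \<le> 4 * ln (1 + y)" if "1 + x \<le> (1 + y) ^ 4" "0 \<le> y" for y
  proof -
    have "ln (1 + x) \<le> ln ((1 + y) ^ 4)" using that x0 by (subst ln_le_cancel_iff) auto
    also have "\<dots> = 4 * ln (1 + y)" using that by (subst ln_realpow) auto
    finally show ?thesis .
  qed
  define m0 where "m0 = nat \<lfloor>\<rho>\<^sup>2 / real d\<rfloor>"
  have q1: "1 \<le> \<rho>\<^sup>2 / real d" using \<rho>d d by simp
  then have m0_1: "1 \<le> m0" unfolding m0_def by (intro le_nat_floor) simp
  have m0_le: "real m0 \<le> \<rho>\<^sup>2 / real d" using q1 by (simp add: m0_def)
  have m0_ge: "\<rho>\<^sup>2 / real d \<le> 2 * real m0"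
  proof -
    have "\<rho>\<^sup>2 / real d < real m0 + 1" using q1 by (simp add: m0_def)
    then show ?thesis using m0_1 by linarith
  qed
  show ?thesis
  proof (cases "m0 \<le> s")
    case True
    \<comment> \<open>Rounding in \<open>m0\<close> and in \<open>k\<close> costs a factor 2 each,
      which gives \<open>x / 4 \<le> k / n\<close>; rounding in \<open>n\<close> costs the factor 2
      in \<open>s \<le> 2 * n * m0\<close>.\<close>
    define n where "n = s div m0"
    define k where "k = d div (n * m0)"
    have n: "1 \<le> n" using True m0_1 by (simp add: n_def Suc_le_eq div_greater_zero_iff)
    have nm: "n * m0 \<le> s" by (simp add: n_def)
    have nm0: "0 < n * m0" using n m0_1 by simp
    have "s < n * m0 + m0" unfolding n_def using m0_1 by (intro less_div_times_add) simp
    also have "\<dots> \<le> 2 * (n * m0)" using n by simp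
    finally have s2: "real s \<le> 2 * real (n * m0)" by linarith
    have k: "1 \<le> k" using nm s nm0 by (simp add: k_def Suc_le_eq div_greater_zero_iff)
    have knm: "k * (n * m0) \<le> d" by (simp add: k_def)
    have "d < k * (n * m0) + n * m0" unfolding k_def using nm0 by (intro less_div_times_add) simp
    also have "\<dots> \<le> 2 * (k * (n * m0))" using k by simp
    finally have "real d \<le> real (2 * (k * (n * m0)))" by linarith
    then have d2: "real d \<le> 2 * real k * real n * real m0" by simp
    have "x / 4 \<le> real k / real n"
    proof -
      have "x / 4 = (\<rho>\<^sup>2 / real d) * real d / (4 * (real s)\<^sup>2)" using d by (simp add: x_def)
      also have "\<dots> \<le> (2 * real m0) * real d / (4 * (real s)\<^sup>2)"
        using m0_ge by (intro divide_right_mono mult_right_mono) auto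
      also have "\<dots> \<le> (2 * real m0) * real d / (4 * (real (n * m0))\<^sup>2)"
        using nm nm0 s by (intro divide_left_mono mult_left_mono power_mono mult_pos_pos) (auto simp del: of_nat_mult)
      also have "\<dots> = real d / (2 * real n * real n * real m0)"
        using m0_1 n by (simp add: power2_eq_square)
      also have "\<dots> \<le> (2 * real k * real n * real m0) / (2 * real n * real n * real m0)"
        using d2 by (intro divide_right_mono) auto
      also have "\<dots> = real k / real n" using m0_1 n by simp
      finally show ?thesis .
    qed
    then have "1 + x \<le> (1 + real k / real n) ^ 4"
    proof -
      have "1 + x \<le> (1 + x / 4) ^ 4" using Bernoulli_inequality[of "x/4" 4] x0 by simp
      also have "\<dots> \<le> (1 + real k / real n) ^ 4" using \<open>x / 4 \<le> real k / real n\<close> x0 by (intro power_mono) auto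
      finally show ?thesis .
    qed
    then have l: "ln (1 + x) \<le> 4 * ln (1 + real k / real n)" by (rule ln4) simp
    have "real s * ln (1 + x) \<le> (2 * real (n * m0)) * (4 * ln (1 + real k / real n))"
      using s2 l x0 by (intro mult_mono) auto
    then show ?thesis using that[of m0 n k] m0_1 n k knm nm m0_le d by (simp add: x_def mult_ac field_simps)
  next
    case False
    \<comment> \<open>Here one block of size \<open>s\<close> carries the whole signal, so
      \<open>n = 1\<close>. The assumption \<open>\<rho> \<le> d\<close> gives
      \<open>x \<le> 4 * k\<^sup>2\<close>.\<close>
    define k where "k = d div s"
    have k: "1 \<le> k" using s by (simp add: k_def Suc_le_eq div_greater_zero_iff)
    have ks: "k * s \<le> d" by (simp add: k_def)
    have "d < k * s + s" unfolding k_def using s by (intro less_div_times_add) simp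
    also have "\<dots> \<le> 2 * (k * s)" using k by simp
    finally have "real d \<le> real (2 * (k * s))" by linarith
    then have "real d \<le> 2 * real k * real s" by simp
    then have "\<rho> \<le> 2 * real k * real s" using \<rho> by linarith
    then have "\<rho> / real s \<le> 2 * real k" using s by (simp add: field_simps)
    then have "(\<rho> / real s)\<^sup>2 \<le> (2 * real k)\<^sup>2" using \<open>0 \<le> \<rho>\<close> by (intro power_mono) auto
    then have "x \<le> 4 * (real k)\<^sup>2" by (simp add: x_def power_divide power_mult_distrib)
    then have "1 + x \<le> (1 + real k) ^ 4"
    proof -
      have "(1 + real k) ^ 4 = 1 + 4 * real k + 6 * (real k)\<^sup>2 + 4 * (real k)^3 + (real k)^4"
        by (simp add: numeral_eq_Suc algebra_simps)
      moreover have "0 \<le> 4 * real k + 2 * (real k)\<^sup>2 + 4 * (real k)^3 + (real k)^4" by simp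
      ultimately show ?thesis using \<open>x \<le> 4 * (real k)\<^sup>2\<close> by linarith
    qed
    then have "ln (1 + x) \<le> 4 * ln (1 + real k)" by (rule ln4) simp
    then have "real s * ln (1 + x) \<le> real s * (4 * ln (1 + real k))" by (intro mult_left_mono) auto
    moreover have "0 \<le> real s * ln (1 + real k)" by simp
    ultimately have l: "real s * ln (1 + x) \<le> 8 * (real s * ln (1 + real k))" by linarith
    have "real d * real s \<le> real d * real m0" using False by (intro mult_left_mono) auto
    also have "\<dots> \<le> \<rho>\<^sup>2" using m0_le d by (simp add: field_simps)
    finally show ?thesis using that[of s 1 k] s k ks l by (simp add: x_def)
  qed
qed

lemma sup_risk_lower_bound_log:
  assumes s: "1 \<le> s" "s \<le> d" and \<rho>: "sqrt (real d) \<le> \<rho>" "\<rho> \<le> real d" and \<sigma>: "0 < \<sigma>" and T: "T \<in> estimators d"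
  shows "ennreal (\<sigma>\<^sup>2 * (real s * ln (1 + \<rho>\<^sup>2 / (real s)\<^sup>2)) / 64) \<le> (SUP p\<in>Theta s d \<rho>. risk d T (fst p) \<sigma> (snd p))"
proof -
  have \<rho>0: "0 \<le> \<rho>" using \<rho>(1) real_sqrt_ge_zero[of "real d"] by linarith
  obtain m n k :: nat where *: "1 \<le> m" "1 \<le> n" "1 \<le> k" "n * k * m \<le> d" "n * m \<le> s" "real d * real m \<le> \<rho>\<^sup>2"
    and l: "real s * ln (1 + \<rho>\<^sup>2 / (real s)\<^sup>2) \<le> 8 * (real (n * m) * ln (1 + real k / real n))"
    by (rule block_sizes_exist[OF s \<rho>])
  have "\<sigma>\<^sup>2 * (real s * ln (1 + \<rho>\<^sup>2 / (real s)\<^sup>2)) / 64 \<le> \<sigma>\<^sup>2 * (8 * (real (n * m) * ln (1 + real k / real n))) / 64"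
    using l by (intro divide_right_mono mult_left_mono) auto
  then have "ennreal (\<sigma>\<^sup>2 * (real s * ln (1 + \<rho>\<^sup>2 / (real s)\<^sup>2)) / 64)
    \<le> ennreal (\<sigma>\<^sup>2 * (real (n * m) * ln (1 + real k / real n)) / 8)"
    by (intro ennreal_leI) (simp add: mult_ac)
  also have "\<dots> \<le> (SUP p\<in>Theta s d \<rho>. risk d T (fst p) \<sigma> (snd p))"
    by (rule block_lower_bound[OF * \<rho>0 \<sigma> T])
  finally show ?thesis .
qed

text \<open>For \<open>s \<le> \<rho>\<close> this is the logarithmic bound with a smaller constant.
  For larger \<open>s\<close> the class contains the one with sparsity about \<open>\<rho>\<close>,
  at which the logarithm is of constant order and the rate is already \<open>\<rho>\<close>.\<close>

lemma sup_risk_lower_bound: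
  assumes s: "1 \<le> s" "s \<le> d" and \<rho>: "sqrt (real d) \<le> \<rho>" "\<rho> \<le> real d" and \<sigma>: "0 < \<sigma>" and T: "T \<in> estimators d"
  shows "ennreal (\<sigma>\<^sup>2 * phi s (\<rho>\<^sup>2) / 256) \<le> (SUP p\<in>Theta s d \<rho>. risk d T (fst p) \<sigma> (snd p))"
proof -
  have "1 \<le> sqrt (real d)" using s by simp
  then have \<rho>1: "1 \<le> \<rho>" using \<rho>(1) by linarith
  show ?thesis
  proof (cases "real s \<le> \<rho>")
    case True
    have "ennreal (\<sigma>\<^sup>2 * phi s (\<rho>\<^sup>2) / 256) \<le> ennreal (\<sigma>\<^sup>2 * (real s * ln (1 + \<rho>\<^sup>2 / (real s)\<^sup>2)) / 64)"
      using True \<rho>1 by (intro ennreal_leI) (simp add: phi_def field_simps)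
    also have "\<dots> \<le> (SUP p\<in>Theta s d \<rho>. risk d T (fst p) \<sigma> (snd p))" by (rule sup_risk_lower_bound_log) fact+
    finally show ?thesis .
  next
    case False
    \<comment> \<open>Since \<open>\<rho> \<ge> 1\<close>, rounding down loses at most a factor 2;
      the logarithm is at least 1/2, which accounts for \<open>256 = 4 * 64\<close>.\<close>
    define s0 where "s0 = nat \<lfloor>\<rho>\<rfloor>"
    have s0: "1 \<le> s0" "real s0 \<le> \<rho>" unfolding s0_def using \<rho>1 by (auto intro: le_nat_floor)
    have "\<rho> < real s0 + 1" using \<rho>1 by (simp add: s0_def)
    then have s02: "\<rho> / 2 \<le> real s0" using s0 by linarith
    have s0s: "s0 \<le> s" using s0 False by linarith
    have "\<rho>\<^sup>2 / (real s0)\<^sup>2 = (\<rho> / real s0)\<^sup>2" by (simp add: power_divide)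
    moreover have "1 \<le> \<rho> / real s0" using s0 by simp
    ultimately have "1 \<le> \<rho>\<^sup>2 / (real s0)\<^sup>2" by (simp add: one_le_power)
    then have "ln 2 \<le> ln (1 + \<rho>\<^sup>2 / (real s0)\<^sup>2)" by simp
    then have "1 / 2 \<le> ln (1 + \<rho>\<^sup>2 / (real s0)\<^sup>2)" using ln2_ge_two_thirds by linarith
    then have "(\<rho> / 2) * (1 / 2) \<le> real s0 * ln (1 + \<rho>\<^sup>2 / (real s0)\<^sup>2)"
      using s02 \<rho>1 by (intro mult_mono) auto
    then have "\<sigma>\<^sup>2 * \<rho> \<le> \<sigma>\<^sup>2 * (4 * (real s0 * ln (1 + \<rho>\<^sup>2 / (real s0)\<^sup>2)))"
      by (intro mult_left_mono) auto
    then have "ennreal (\<sigma>\<^sup>2 * phi s (\<rho>\<^sup>2) / 256) \<le> ennreal (\<sigma>\<^sup>2 * (real s0 * ln (1 + \<rho>\<^sup>2 / (real s0)\<^sup>2)) / 64)"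
      using False \<rho>1 by (intro ennreal_leI) (simp add: phi_def mult_ac)
    also have "\<dots> \<le> (SUP p\<in>Theta s0 d \<rho>. risk d T (fst p) \<sigma> (snd p))"
      using s0 s0s s by (intro sup_risk_lower_bound_log \<rho> \<sigma> T) auto
    also have "\<dots> \<le> (SUP p\<in>Theta s d \<rho>. risk d T (fst p) \<sigma> (snd p))"
      using s0s by (intro SUP_subset_mono) (auto simp: Theta_def)
    finally show ?thesis .
  qed
qed

subsection \<open>Covariance of even functions of correlated Gaussians\<close>

lemma integral_std_gauss:
  fixes f :: "real \<Rightarrow> real"
  assumes "f \<in> borel_measurable borel"
  shows "(\<integral>x. f x \<partial>std_gauss) = (\<integral>x. std_normal_density x * f x \<partial>lborel)"
  unfolding std_gauss_def using assms by (subst integral_density) auto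

lemma integrable_std_gauss:
  fixes f :: "real \<Rightarrow> real"
  assumes "f \<in> borel_measurable borel"
  shows "integrable std_gauss f \<longleftrightarrow> integrable lborel (\<lambda>x. std_normal_density x * f x)"
  unfolding std_gauss_def using assms by (subst integrable_density) auto

lemma integrable_std_gauss_power [simp, intro]: "integrable std_gauss (\<lambda>x. x ^ k)"
  using integrable_std_normal_moment by (simp add: integrable_std_gauss)

lemma std_gauss_moments [simp]:
  "(\<integral>x. x \<partial>std_gauss) = 0" "(\<integral>x. x\<^sup>2 \<partial>std_gauss) = 1" "(\<integral>x. x ^ 4 \<partial>std_gauss) = 3"
  using integral_std_normal_moment_odd[of 0] integral_std_normal_moment_even[of 1] integral_std_normal_moment_even[of 2]
  by (simp_all add: integral_std_gauss fact_numeral)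

lemma integrable_std_gauss_id [simp, intro]: "integrable std_gauss (\<lambda>x. x)"
  using integrable_std_gauss_power[of 1] by simp

text \<open>As \<open>1/2 - 2/5 = 1/10\<close>, the product with the density is a multiple of the
  centred Gaussian density of variance 5. This function serves as the integrable majorant
  below.\<close>

lemma std_gauss_exp_square:
  "integrable std_gauss (\<lambda>x. exp (2 * x\<^sup>2 / 5))" "(\<integral>x. exp (2 * x\<^sup>2 / 5) \<partial>std_gauss) = sqrt 5"
proof -
  have *: "std_normal_density x * exp (2 * x\<^sup>2 / 5) = sqrt 5 * normal_density 0 (sqrt 5) x" for x
  proof -
    have "sqrt 10 = sqrt 2 * sqrt 5" by (simp add: real_sqrt_mult[symmetric])
    then show ?thesis by (simp add: normal_density_def real_sqrt_mult exp_add[symmetric] field_simps)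
  qed
  show "integrable std_gauss (\<lambda>x. exp (2 * x\<^sup>2 / 5))"
    by (subst integrable_std_gauss) (simp_all add: * )
  show "(\<integral>x. exp (2 * x\<^sup>2 / 5) \<partial>std_gauss) = sqrt 5"
    by (subst integral_std_gauss) (simp_all add: * )
qed

lemma integral_std_gauss_reflect:
  fixes f :: "real \<Rightarrow> real"
  assumes [measurable]: "f \<in> borel_measurable borel"
  shows "(\<integral>x. f (- x) \<partial>std_gauss) = (\<integral>x. f x \<partial>std_gauss)"
proof -
  have "(\<integral>x. std_normal_density x * f x \<partial>lborel) = (\<integral>x. std_normal_density (- x) * f (- x) \<partial>lborel)"
    using lborel_integral_real_affine[of "-1" "\<lambda>x. std_normal_density x * f x" 0] by simp
  then show ?thesis by (simp add: integral_std_gauss std_normal_density_def)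
qed

section \<open>The Mehler kernel and its first-order expansion\<close>

lemma abs_exp_minus_linear:
  fixes t :: real
  shows "\<bar>exp t - 1 - t\<bar> \<le> t\<^sup>2 * exp \<bar>t\<bar>"
proof -
  obtain \<xi> where \<xi>: "\<bar>\<xi>\<bar> \<le> \<bar>t\<bar>" "exp t = (\<Sum>m<2. (t ^ m) / fact m) + (exp \<xi> / fact 2) * t ^ 2"
    using Maclaurin_exp_le[of t 2] by blast
  have "exp t - 1 - t = exp \<xi> / 2 * t\<^sup>2" using \<xi>(2) by (simp add: numeral_2_eq_2)
  then have "\<bar>exp t - 1 - t\<bar> = exp \<xi> / 2 * t\<^sup>2" by (simp only:) (simp add: abs_mult)
  also have "\<dots> \<le> exp \<bar>t\<bar> * t\<^sup>2"
  proof (rule mult_right_mono)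
    have "exp \<xi> \<le> exp \<bar>t\<bar>" using \<xi>(1) by simp
    then show "exp \<xi> / 2 \<le> exp \<bar>t\<bar>" using exp_gt_zero[of \<xi>] by linarith
  qed simp
  finally show ?thesis by (simp add: mult.commute)
qed

text \<open>Density at \<open>(u, y)\<close> of a standard bivariate Gaussian with correlation \<open>r\<close>, relative to the product of its marginals.\<close>
definition mehler :: "real \<Rightarrow> real \<Rightarrow> real \<Rightarrow> real" where
  "mehler r u y = exp (- (r\<^sup>2 * u\<^sup>2 - 2 * r * u * y + r\<^sup>2 * y\<^sup>2) / (2 * (1 - r\<^sup>2))) / sqrt (1 - r\<^sup>2)"

lemma borel_measurable_mehler [measurable]: "mehler r u \<in> borel_measurable borel"
  unfolding mehler_def by measurable

text \<open>The kernel is \<open>A * exp (- w) * exp t\<close> with \<open>A - 1\<close>,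
  \<open>w\<close> and \<open>t - r*u*y\<close> of order \<open>r\<^sup>2\<close>. Replacing one
  factor at a time leaves four differences, each bounded by \<open>r\<^sup>2\<close> times a
  polynomial in \<open>N\<close> times \<open>E\<close>.\<close>

lemma abs_mehler_minus_linear:
  assumes r: "\<bar>r\<bar> \<le> 1 / 4"
  shows "\<bar>mehler r u y - 1 - r * u * y\<bar> \<le> 162 * r\<^sup>2 * exp ((u\<^sup>2 + y\<^sup>2) / 4)"
proof -
  define N p w t A where "N = u\<^sup>2 + y\<^sup>2" and "p = 1 - r\<^sup>2" and "w = r\<^sup>2 * N / (2 * p)" and "t = r * u * y / p" and "A = 1 / sqrt p"
  have N0: "0 \<le> N" by (simp add: N_def)
  have "r\<^sup>2 \<le> (1/4)\<^sup>2" using r by (subst abs_le_square_iff[symmetric]) simp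
  then have p: "15/16 \<le> p" "p \<le> 1" by (auto simp: p_def power2_eq_square)
  have p1: "1 / p \<le> 16 / 15" using p by (simp add: field_simps)
  have h: "mehler r u y = A * (exp (- w) * exp t)"
  proof -
    have e: "- (r\<^sup>2 * u\<^sup>2 - 2 * r * u * y + r\<^sup>2 * y\<^sup>2) / (2 * (1 - r\<^sup>2)) = - w + t"
      using p unfolding w_def t_def N_def p_def[symmetric] by (simp add: field_simps)
    show ?thesis unfolding mehler_def e exp_add A_def p_def by simp
  qed
  have uy: "\<bar>u * y\<bar> \<le> N / 2"
  proof -
    have "0 \<le> (\<bar>u\<bar> - \<bar>y\<bar>)\<^sup>2" by simp
    then show ?thesis by (simp add: N_def power2_diff abs_mult)
  qed
  have ruy: "\<bar>r * u * y\<bar> \<le> \<bar>r\<bar> * (N / 2)"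
    using mult_left_mono[OF uy, of "\<bar>r\<bar>"] by (simp add: abs_mult mult.assoc)
  have tr: "\<bar>t\<bar> \<le> \<bar>r\<bar> * N * (8/15)"
  proof -
    have "\<bar>t\<bar> = \<bar>r * u * y\<bar> * (1/p)" using p by (simp add: t_def)
    also have "\<dots> \<le> (\<bar>r\<bar> * (N / 2)) * (16/15)" using ruy p1 p N0 by (intro mult_mono) auto
    finally show ?thesis by (simp add: mult_ac)
  qed
  have tN: "\<bar>t\<bar> \<le> 2 * N / 15"
  proof -
    have "\<bar>r\<bar> * N * (8/15) \<le> (1/4) * N * (8/15)" using r N0 by (intro mult_right_mono) auto
    then show ?thesis using tr by linarith
  qed
  have t2: "t\<^sup>2 \<le> r\<^sup>2 * N\<^sup>2"
  proof -
    have "\<bar>t\<bar> \<le> \<bar>r\<bar> * N" using tr N0 mult_nonneg_nonneg[of "\<bar>r\<bar>" N] by linarith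
    then have "\<bar>t\<bar>\<^sup>2 \<le> (\<bar>r\<bar> * N)\<^sup>2" by (intro power_mono) auto
    then show ?thesis by (simp add: power_mult_distrib)
  qed
  \<comment> \<open>The exponent comes from \<open>|t| \<le> 2 * N / 15\<close>; it leaves
    \<open>1/4 - 2/15 = 7/60\<close> to absorb the polynomial factor.\<close>
  define E where "E = exp (2 * N / 15)"
  have E1: "1 \<le> E" using N0 by (simp add: E_def)
  have eE: "exp t \<le> E" "exp \<bar>t\<bar> \<le> E" using tN by (auto simp: E_def)
  have w0: "0 \<le> w" using p N0 by (simp add: w_def)
  have wN: "w \<le> r\<^sup>2 * N"
  proof -
    have "w = r\<^sup>2 * N * (1 / (2 * p))" by (simp add: w_def)
    also have "\<dots> \<le> r\<^sup>2 * N * 1" using p N0 by (intro mult_left_mono) auto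
    finally show ?thesis by simp
  qed
  have A: "1 \<le> A" "A - 1 \<le> 2 * r\<^sup>2"
  proof -
    have sp: "p \<le> sqrt p" "sqrt p \<le> 1" "0 < sqrt p"
      using p by (auto intro!: real_le_rsqrt simp: power2_eq_square mult_left_le_one_le)
    then show "1 \<le> A" by (simp add: A_def)
    have "A \<le> 1 / p" unfolding A_def using sp p by (intro divide_left_mono) auto
    also have "\<dots> = 1 + r\<^sup>2 * (1 / p)" using p by (simp add: p_def field_simps)
    also have "\<dots> \<le> 1 + r\<^sup>2 * 2" using p1 by (intro add_left_mono mult_left_mono) auto
    finally show "A - 1 \<le> 2 * r\<^sup>2" by simp
  qed
  have 1: "\<bar>(A - 1) * (exp (- w) * exp t)\<bar> \<le> 2 * r\<^sup>2 * E"
  proof -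
    have "exp (- w) * exp t \<le> 1 * E" using w0 eE by (intro mult_mono) auto
    then have "(A - 1) * (exp (- w) * exp t) \<le> 2 * r\<^sup>2 * E" using A by (intro mult_mono) auto
    then show ?thesis using A by (simp add: abs_mult)
  qed
  have 2: "\<bar>(exp (- w) - 1) * exp t\<bar> \<le> r\<^sup>2 * N * E"
  proof -
    have "1 - exp (- w) \<le> w" using exp_ge_add_one_self[of "- w"] by linarith
    then have "(1 - exp (- w)) * exp t \<le> r\<^sup>2 * N * E" using wN eE N0 by (intro mult_mono) auto
    moreover have "\<bar>(exp (- w) - 1) * exp t\<bar> = (1 - exp (- w)) * exp t" using w0 by (simp add: abs_mult)
    ultimately show ?thesis by simp
  qed
  have 3: "\<bar>exp t - 1 - t\<bar> \<le> r\<^sup>2 * N\<^sup>2 * E"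
  proof -
    have "t\<^sup>2 * exp \<bar>t\<bar> \<le> (r\<^sup>2 * N\<^sup>2) * E" using t2 eE by (intro mult_mono) auto
    then show ?thesis using abs_exp_minus_linear[of t] by linarith
  qed
  have 4: "\<bar>t - r * u * y\<bar> \<le> r\<^sup>2 * N * E"
  proof -
    have "t - r * u * y = r * u * y * (r\<^sup>2 * (1 / p))" using p by (simp add: t_def p_def field_simps)
    then have "\<bar>t - r * u * y\<bar> = \<bar>r * u * y\<bar> * (r\<^sup>2 * (1 / p))" using p by (simp add: abs_mult)
    also have "\<dots> \<le> (\<bar>r\<bar> * (N / 2)) * (r\<^sup>2 * 2)"
      using ruy p1 p N0 by (intro mult_mono) auto
    also have "\<dots> = \<bar>r\<bar> * (r\<^sup>2 * N)" by simp
    also have "\<dots> \<le> 1 * (r\<^sup>2 * N)" using r N0 by (intro mult_right_mono) auto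
    also have "\<dots> \<le> r\<^sup>2 * N * E" using mult_left_mono[OF E1, of "r\<^sup>2 * N"] N0 by simp
    finally show ?thesis .
  qed
  have "mehler r u y - 1 - r * u * y = (A - 1) * (exp (- w) * exp t) + (exp (- w) - 1) * exp t + (exp t - 1 - t) + (t - r * u * y)"
    unfolding h by (simp add: algebra_simps)
  then have "\<bar>mehler r u y - 1 - r * u * y\<bar> \<le> 2 * r\<^sup>2 * E + r\<^sup>2 * N * E + r\<^sup>2 * N\<^sup>2 * E + r\<^sup>2 * N * E"
    using 1 2 3 4 by linarith
  also have "\<dots> = r\<^sup>2 * E * (2 + 2 * N + N\<^sup>2)" by (simp add: algebra_simps)
  \<comment> \<open>The constant 162 makes the quadratic Taylor coefficient
    \<open>162 * (7/60)\<^sup>2 / 2\<close> exceed 1; the lower coefficients are then large enough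
    as well.\<close>
  also have "\<dots> \<le> r\<^sup>2 * E * (162 * exp (7 * N / 60))"
  proof (rule mult_left_mono)
    have "162 * (1 + 7 * N / 60 + (7 * N / 60)\<^sup>2 / 2) \<le> 162 * exp (7 * N / 60)"
      using N0 by (intro mult_left_mono exp_lower_Taylor_quadratic) simp_all
    moreover have "2 + 2 * N + N\<^sup>2 \<le> 162 * (1 + 7 * N / 60 + (7 * N / 60)\<^sup>2 / 2)"
      using N0 by (simp add: power2_eq_square field_simps)
    ultimately show "2 + 2 * N + N\<^sup>2 \<le> 162 * exp (7 * N / 60)" by (rule order_trans[rotated])
  qed (use E1 in simp)
  also have "\<dots> = 162 * r\<^sup>2 * (E * exp (7 * N / 60))" by simp
  also have "E * exp (7 * N / 60) = exp (N / 4)" unfolding E_def exp_add[symmetric] by (simp add: field_simps)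
  finally show ?thesis by (simp add: N_def)
qed

text \<open>Given the first coordinate \<open>u\<close>, the second is Gaussian with mean
  \<open>r * u\<close> and variance \<open>1 - r\<^sup>2\<close>; completing the square identifies
  \<open>mehler r u\<close> as the density of this law relative to \<open>std_gauss\<close>.\<close>

lemma integral_std_gauss_mehler:
  fixes g :: "real \<Rightarrow> real"
  assumes [measurable]: "g \<in> borel_measurable borel" and r: "\<bar>r\<bar> < 1"
  shows "(\<integral>v. g (r * u + sqrt (1 - r\<^sup>2) * v) \<partial>std_gauss) = (\<integral>y. g y * mehler r u y \<partial>std_gauss)"
proof -
  define q where "q = sqrt (1 - r\<^sup>2)"
  have r2: "r\<^sup>2 < 1" using r by (simp add: abs_square_less_1)
  then have q: "0 < q" "q\<^sup>2 = 1 - r\<^sup>2" by (simp_all add: q_def)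
  have dens: "std_normal_density y * mehler r u y = std_normal_density ((y - r * u) / q) / q" for y
  proof -
    have "- y\<^sup>2 / 2 + - (r\<^sup>2 * u\<^sup>2 - 2 * r * u * y + r\<^sup>2 * y\<^sup>2) / (2 * (1 - r\<^sup>2))
        = (- y\<^sup>2 * (1 - r\<^sup>2) - (r\<^sup>2 * u\<^sup>2 - 2 * r * u * y + r\<^sup>2 * y\<^sup>2)) / (2 * (1 - r\<^sup>2))"
      using r2 by (simp add: field_simps)
    also have "- y\<^sup>2 * (1 - r\<^sup>2) - (r\<^sup>2 * u\<^sup>2 - 2 * r * u * y + r\<^sup>2 * y\<^sup>2) = - (y - r * u)\<^sup>2"
      by (simp add: power2_eq_square algebra_simps)
    also have "- (y - r * u)\<^sup>2 / (2 * (1 - r\<^sup>2)) = - ((y - r * u) / q)\<^sup>2 / 2"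
      unfolding power_divide q(2) by simp
    finally have e: "exp (- ((y - r * u) / q)\<^sup>2 / 2) = exp (- y\<^sup>2 / 2) * exp (- (r\<^sup>2 * u\<^sup>2 - 2 * r * u * y + r\<^sup>2 * y\<^sup>2) / (2 * (1 - r\<^sup>2)))"
      by (metis exp_add)
    show ?thesis
      unfolding mehler_def std_normal_density_def q_def[symmetric] e by simp
  qed
  have "(\<integral>y. g y * mehler r u y \<partial>std_gauss) = (\<integral>y. std_normal_density ((y - r * u) / q) / q * g y \<partial>lborel)"
    by (subst integral_std_gauss) (simp_all add: dens[symmetric] mult_ac)
  also have "\<dots> = q * (\<integral>v. std_normal_density v / q * g (r * u + q * v) \<partial>lborel)"
    by (subst lborel_integral_real_affine[of q _ "r * u"]) (use q in simp_all)
  also have "\<dots> = (\<integral>v. std_normal_density v * g (r * u + q * v) \<partial>lborel)"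
    using q by simp
  also have "\<dots> = (\<integral>v. g (r * u + q * v) \<partial>std_gauss)"
    by (rule integral_std_gauss[symmetric]) simp
  finally show ?thesis by (simp add: q_def)
qed

section \<open>Integrals of functions of one or two linear forms\<close>

lemma integral_gauss_vec_inner:
  fixes f :: "real \<Rightarrow> real"
  assumes a: "(\<Sum>k<n. (a k)\<^sup>2) = 1" and [measurable]: "f \<in> borel_measurable borel"
  shows "(\<integral>z. f (\<Sum>k<n. a k * z k) \<partial>gauss_vec n) = (\<integral>x. f x \<partial>std_gauss)"
    and "integrable (gauss_vec n) (\<lambda>z. f (\<Sum>k<n. a k * z k)) \<longleftrightarrow> integrable std_gauss f"
proof -
  have m: "(\<lambda>z. \<Sum>k<n. a k * z k) \<in> gauss_vec n \<rightarrow>\<^sub>M borel" by measurable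
  show "(\<integral>z. f (\<Sum>k<n. a k * z k) \<partial>gauss_vec n) = (\<integral>x. f x \<partial>std_gauss)"
    using integral_distr[OF m, of f] by (simp add: distr_gauss_vec_inner[OF a])
  show "integrable (gauss_vec n) (\<lambda>z. f (\<Sum>k<n. a k * z k)) \<longleftrightarrow> integrable std_gauss f"
    using integrable_distr_eq[OF m, of f] by (simp add: distr_gauss_vec_inner[OF a])
qed

lemma integral_gauss_vec_pair:
  fixes F :: "real \<times> real \<Rightarrow> real"
  assumes a: "(\<Sum>k<n. (a k)\<^sup>2) = 1" and b: "(\<Sum>k<n. (b k)\<^sup>2) = 1"
    and r: "(\<Sum>k<n. a k * b k) = r" and F[measurable]: "F \<in> borel_measurable (borel \<Otimes>\<^sub>M borel)"
    and int: "integrable (gauss_vec n) (\<lambda>z. F (\<Sum>k<n. a k * z k, \<Sum>k<n. b k * z k))"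
  shows "(\<integral>z. F (\<Sum>k<n. a k * z k, \<Sum>k<n. b k * z k) \<partial>gauss_vec n)
    = (\<integral>u. \<integral>v. F (u, r * u + sqrt (1 - r\<^sup>2) * v) \<partial>std_gauss \<partial>std_gauss)"
proof -
  let ?T = "\<lambda>p. (fst p, r * fst p + sqrt (1 - r\<^sup>2) * snd p)"
  let ?D = "distr (gauss_vec n) (borel \<Otimes>\<^sub>M borel) (\<lambda>z. (\<Sum>k<n. a k * z k, \<Sum>k<n. b k * z k))"
  have D: "?D = distr (std_gauss \<Otimes>\<^sub>M std_gauss) (borel \<Otimes>\<^sub>M borel) ?T"
    using distr_gauss_vec_pair[OF a b r] by (simp add: case_prod_beta')
  \<comment> \<open>Integrability is transported through the common law first, since Fubini for
    real-valued integrands requires it.\<close>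
  have "integrable ?D F" using int by (subst integrable_distr_eq) measurable
  then have i: "integrable (std_gauss \<Otimes>\<^sub>M std_gauss) (\<lambda>p. F (?T p))"
    unfolding D by (subst (asm) integrable_distr_eq) measurable
  have "(\<integral>z. F (\<Sum>k<n. a k * z k, \<Sum>k<n. b k * z k) \<partial>gauss_vec n) = (\<integral>p. F p \<partial>?D)"
    by (rule integral_distr[symmetric]) measurable
  also have "\<dots> = (\<integral>p. F (?T p) \<partial>(std_gauss \<Otimes>\<^sub>M std_gauss))"
    unfolding D by (rule integral_distr) measurable
  also have "\<dots> = (\<integral>u. \<integral>v. F (?T (u, v)) \<partial>std_gauss \<partial>std_gauss)"
    by (rule std_gauss_pair.integral_fst'[OF i, symmetric])
  finally show ?thesis by simp
qed

lemma integrable_gauss_vec_mult: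
  fixes f h :: "real \<Rightarrow> real"
  assumes a: "(\<Sum>k<n. (a k)\<^sup>2) = 1" and b: "(\<Sum>k<n. (b k)\<^sup>2) = 1"
    and [measurable]: "f \<in> borel_measurable borel" "h \<in> borel_measurable borel"
    and f: "integrable std_gauss (\<lambda>y. (f y)\<^sup>2)" and h: "integrable std_gauss (\<lambda>y. (h y)\<^sup>2)"
  shows "integrable (gauss_vec n) (\<lambda>z. f (\<Sum>k<n. a k * z k) * h (\<Sum>k<n. b k * z k))"
proof (rule Bochner_Integration.integrable_bound)
  show "integrable (gauss_vec n) (\<lambda>z. (f (\<Sum>k<n. a k * z k))\<^sup>2 + (h (\<Sum>k<n. b k * z k))\<^sup>2)"
    using integral_gauss_vec_inner(2)[OF a, of "\<lambda>y. (f y)\<^sup>2"] integral_gauss_vec_inner(2)[OF b, of "\<lambda>y. (h y)\<^sup>2"] f h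
    by simp
  show "AE z in gauss_vec n. norm (f (\<Sum>k<n. a k * z k) * h (\<Sum>k<n. b k * z k)) \<le> norm ((f (\<Sum>k<n. a k * z k))\<^sup>2 + (h (\<Sum>k<n. b k * z k))\<^sup>2)"
  proof (rule AE_I2)
    fix z
    have "\<bar>x * y\<bar> \<le> \<bar>x\<^sup>2 + y\<^sup>2\<bar>" for x y :: real
    proof -
      have "0 \<le> (\<bar>x\<bar> - \<bar>y\<bar>)\<^sup>2" by simp
      then have "2 * \<bar>x * y\<bar> \<le> x\<^sup>2 + y\<^sup>2" by (simp add: power2_diff abs_mult)
      moreover have "0 \<le> x\<^sup>2 + y\<^sup>2" by simp
      ultimately show ?thesis by linarith
    qed
    then show "norm (f (\<Sum>k<n. a k * z k) * h (\<Sum>k<n. b k * z k)) \<le> norm ((f (\<Sum>k<n. a k * z k))\<^sup>2 + (h (\<Sum>k<n. b k * z k))\<^sup>2)"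
      by simp
  qed
qed measurable

section \<open>Covariances of centred even functions supported on the tails\<close>

lemma square_le_exp: "(x::real) \<ge> 0 \<Longrightarrow> x\<^sup>2 \<le> 2 * exp x"
  using exp_lower_Taylor_quadratic[of x] by simp

lemma self_le_exp: "(x::real) \<le> exp x"
  using exp_ge_add_one_self[of x] by linarith

text \<open>Collects what the covariance estimate uses about the thresholded and centred squares
  that are summed off the support.\<close>

locale tail_function =
  fixes g :: "real \<Rightarrow> real" and \<tau> :: real
  assumes meas [measurable]: "g \<in> borel_measurable borel"
    and \<tau>: "0 \<le> \<tau>"
    and even: "\<And>y. g (- y) = g y"
    and tail: "\<And>y. \<bar>y\<bar> \<le> \<tau> \<Longrightarrow> g y = 0"
    and bound: "\<And>y. \<bar>g y\<bar> \<le> 8 * y\<^sup>2"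
    and mean: "(\<integral>y. g y \<partial>std_gauss) = 0"
begin

text \<open>Where \<open>g\<close> does not vanish, \<open>y\<^sup>2 \<ge> \<tau>\<^sup>2\<close>
  and the exponential is at least 1. The rate 1/18 is half of the rate 1/9 wanted for a product of
  two such functions.\<close>

lemma abs_le_exp: "\<bar>g y\<bar> \<le> 8 * y\<^sup>2 * exp ((y\<^sup>2 - \<tau>\<^sup>2) / 18)"
proof (cases "\<bar>y\<bar> \<le> \<tau>")
  case True
  then show ?thesis by (simp add: tail)
next
  case False
  then have "\<tau>\<^sup>2 \<le> y\<^sup>2" using \<tau> by (simp add: abs_le_square_iff[symmetric])
  then have "1 \<le> exp ((y\<^sup>2 - \<tau>\<^sup>2) / 18)" by simp
  then have "8 * y\<^sup>2 * 1 \<le> 8 * y\<^sup>2 * exp ((y\<^sup>2 - \<tau>\<^sup>2) / 18)" by (intro mult_left_mono) auto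
  then show ?thesis using bound[of y] by linarith
qed

lemma weighted_le: "\<bar>g y\<bar> * exp (y\<^sup>2 / 4) \<le> 88 * exp (- \<tau>\<^sup>2 / 18) * exp (2 * y\<^sup>2 / 5)"
proof -
  have "\<bar>g y\<bar> * exp (y\<^sup>2 / 4) \<le> (8 * y\<^sup>2 * exp ((y\<^sup>2 - \<tau>\<^sup>2) / 18)) * exp (y\<^sup>2 / 4)"
    using abs_le_exp by (rule mult_right_mono) simp
  also have "\<dots> = exp (- \<tau>\<^sup>2 / 18) * (8 * y\<^sup>2) * exp (11 * y\<^sup>2 / 36)"
    by (simp add: exp_add[symmetric] field_simps)
  \<comment> \<open>The exponent left over is \<open>2/5 - 11/36 = 17/180\<close>, and
    \<open>8 * 180 / 17 \<le> 88\<close>.\<close>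
  also have "\<dots> \<le> exp (- \<tau>\<^sup>2 / 18) * (88 * exp (17 * y\<^sup>2 / 180)) * exp (11 * y\<^sup>2 / 36)"
  proof (intro mult_right_mono mult_left_mono)
    have "8 * y\<^sup>2 \<le> 88 * e" if "17 * y\<^sup>2 / 180 \<le> e" "0 < e" for e :: real using that by linarith
    then show "8 * y\<^sup>2 \<le> 88 * exp (17 * y\<^sup>2 / 180)" using self_le_exp exp_gt_zero by blast
  qed simp_all
  also have "\<dots> = 88 * exp (- \<tau>\<^sup>2 / 18) * exp (2 * y\<^sup>2 / 5)"
    by (simp add: exp_add[symmetric] field_simps)
  finally show ?thesis .
qed

lemma integrable_weighted: "integrable std_gauss (\<lambda>y. \<bar>g y\<bar> * exp (y\<^sup>2 / 4))"
  by (rule Bochner_Integration.integrable_bound[OF integrable_mult_right[OF std_gauss_exp_square(1), of "88 * exp (- \<tau>\<^sup>2 / 18)"]])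
    (use weighted_le in \<open>auto intro!: AE_I2\<close>)

lemma integral_weighted: "(\<integral>y. \<bar>g y\<bar> * exp (y\<^sup>2 / 4) \<partial>std_gauss) \<le> 88 * exp (- \<tau>\<^sup>2 / 18) * sqrt 5"
proof -
  have "(\<integral>y. \<bar>g y\<bar> * exp (y\<^sup>2 / 4) \<partial>std_gauss) \<le> (\<integral>y. 88 * exp (- \<tau>\<^sup>2 / 18) * exp (2 * y\<^sup>2 / 5) \<partial>std_gauss)"
    by (rule integral_mono[OF integrable_weighted integrable_mult_right[OF std_gauss_exp_square(1)] weighted_le])
  then show ?thesis by (simp add: std_gauss_exp_square)
qed

lemma square_le: "(g y)\<^sup>2 \<le> 1600 * exp (- \<tau>\<^sup>2 / 9) * exp (2 * y\<^sup>2 / 5)"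
proof -
  have "(g y)\<^sup>2 \<le> (8 * y\<^sup>2 * exp ((y\<^sup>2 - \<tau>\<^sup>2) / 18))\<^sup>2"
    using abs_le_exp[of y] by (subst abs_le_square_iff[symmetric]) simp
  also have "\<dots> = exp (- \<tau>\<^sup>2 / 9) * (64 * (y\<^sup>2)\<^sup>2) * exp (y\<^sup>2 / 9)"
    by (simp add: power_mult_distrib exp_of_nat_mult[symmetric] exp_add[symmetric] flip: exp_double)
  \<comment> \<open>Here \<open>2/5 - 1/9 = 13/45\<close>, and the second-order bound
    \<open>x\<^sup>2 \<le> 2 * exp x\<close> absorbs the fourth power of \<open>y\<close>.\<close>
  also have "\<dots> \<le> exp (- \<tau>\<^sup>2 / 9) * (1600 * exp (13 * y\<^sup>2 / 45)) * exp (y\<^sup>2 / 9)"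
  proof (intro mult_right_mono mult_left_mono)
    have *: "64 * x \<le> 1600 * e" if "169 * x / 2025 \<le> 2 * e" "0 < e" for e x :: real using that by linarith
    have "169 * (y\<^sup>2)\<^sup>2 / 2025 \<le> 2 * exp (13 * y\<^sup>2 / 45)"
      using square_le_exp[of "13 * y\<^sup>2 / 45"] by (simp add: power_mult_distrib power_divide)
    then show "64 * (y\<^sup>2)\<^sup>2 \<le> 1600 * exp (13 * y\<^sup>2 / 45)" using * exp_gt_zero by blast
  qed simp_all
  also have "\<dots> = 1600 * exp (- \<tau>\<^sup>2 / 9) * exp (2 * y\<^sup>2 / 5)"
    by (simp add: exp_add[symmetric] field_simps)
  finally show ?thesis .
qed

lemma integrable_square: "integrable std_gauss (\<lambda>y. (g y)\<^sup>2)"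
  by (rule Bochner_Integration.integrable_bound[OF integrable_mult_right[OF std_gauss_exp_square(1), of "1600 * exp (- \<tau>\<^sup>2 / 9)"]])
    (use square_le in \<open>auto intro!: AE_I2\<close>)

lemma integral_square: "(\<integral>y. (g y)\<^sup>2 \<partial>std_gauss) \<le> 1600 * exp (- \<tau>\<^sup>2 / 9) * sqrt 5"
proof -
  have "(\<integral>y. (g y)\<^sup>2 \<partial>std_gauss) \<le> (\<integral>y. 1600 * exp (- \<tau>\<^sup>2 / 9) * exp (2 * y\<^sup>2 / 5) \<partial>std_gauss)"
    by (rule integral_mono[OF integrable_square integrable_mult_right[OF std_gauss_exp_square(1)] square_le])
  then show ?thesis by (simp add: std_gauss_exp_square)
qed

lemma integrable_g: "integrable std_gauss g"
  by (rule Bochner_Integration.integrable_bound[OF integrable_mult_right[OF integrable_std_gauss_power[of 2], of 8]])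
    (use bound in \<open>auto intro!: AE_I2\<close>)

lemma integrable_g_times: "integrable std_gauss (\<lambda>y. g y * y)"
proof (rule Bochner_Integration.integrable_bound[OF Bochner_Integration.integrable_add[OF integrable_square integrable_std_gauss_power[of 2]]])
  show "AE y in std_gauss. norm (g y * y) \<le> norm ((g y)\<^sup>2 + y\<^sup>2)"
  proof (rule AE_I2)
    fix y
    have "0 \<le> (\<bar>g y\<bar> - \<bar>y\<bar>)\<^sup>2" by simp
    then have "2 * \<bar>g y * y\<bar> \<le> (g y)\<^sup>2 + y\<^sup>2" by (simp add: power2_diff abs_mult)
    moreover have "0 \<le> (g y)\<^sup>2 + y\<^sup>2" by simp
    ultimately show "norm (g y * y) \<le> norm ((g y)\<^sup>2 + y\<^sup>2)" unfolding real_norm_def by linarith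
  qed
qed simp

lemma integral_g_times: "(\<integral>y. g y * y \<partial>std_gauss) = 0"
proof -
  have "(\<integral>y. g y * y \<partial>std_gauss) = (\<integral>y. g (- y) * (- y) \<partial>std_gauss)"
    by (rule integral_std_gauss_reflect[symmetric]) simp
  also have "\<dots> = - (\<integral>y. g y * y \<partial>std_gauss)" by (simp add: even)
  finally show ?thesis by simp
qed

text \<open>Evenness and centring kill the terms \<open>1\<close> and \<open>r u y\<close> of the Mehler kernel, leaving a remainder of order \<open>r\<^sup>2\<close>.\<close>
lemma abs_mehler_operator_le:
  assumes r: "\<bar>r\<bar> \<le> 1 / 4"
  shows "\<bar>\<integral>v. g (r * u + sqrt (1 - r\<^sup>2) * v) \<partial>std_gauss\<bar> \<le> (162 * r\<^sup>2 * (88 * exp (- \<tau>\<^sup>2 / 18) * sqrt 5)) * exp (u\<^sup>2 / 4)"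
proof -
  define D where "D y = g y * (mehler r u y - 1 - r * u * y)" for y
  have [measurable]: "D \<in> borel_measurable borel" unfolding D_def by measurable
  have D_le: "\<bar>D y\<bar> \<le> 162 * r\<^sup>2 * exp (u\<^sup>2 / 4) * (\<bar>g y\<bar> * exp (y\<^sup>2 / 4))" for y
  proof -
    have "\<bar>D y\<bar> \<le> \<bar>g y\<bar> * (162 * r\<^sup>2 * exp ((u\<^sup>2 + y\<^sup>2) / 4))"
      unfolding D_def abs_mult by (intro mult_left_mono abs_mehler_minus_linear r) simp
    also have "exp ((u\<^sup>2 + y\<^sup>2) / 4) = exp (u\<^sup>2 / 4) * exp (y\<^sup>2 / 4)" by (simp add: exp_add[symmetric] add_divide_distrib)
    finally show ?thesis by (simp add: mult_ac)
  qed
  have iD: "integrable std_gauss D"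
    by (rule Bochner_Integration.integrable_bound[OF integrable_mult_right[OF integrable_weighted, of "162 * r\<^sup>2 * exp (u\<^sup>2 / 4)"]])
      (use D_le in \<open>auto intro!: AE_I2 simp: abs_mult\<close>)
  have "(\<integral>v. g (r * u + sqrt (1 - r\<^sup>2) * v) \<partial>std_gauss) = (\<integral>y. g y * mehler r u y \<partial>std_gauss)"
    using r by (intro integral_std_gauss_mehler) auto
  also have "\<dots> = (\<integral>y. D y + (g y + r * u * (g y * y)) \<partial>std_gauss)"
    by (intro Bochner_Integration.integral_cong refl) (simp add: D_def algebra_simps)
  also have "\<dots> = (\<integral>y. D y \<partial>std_gauss)"
    using iD integrable_g integrable_g_times by (simp add: mean integral_g_times)
  finally have "\<bar>\<integral>v. g (r * u + sqrt (1 - r\<^sup>2) * v) \<partial>std_gauss\<bar> \<le> (\<integral>y. \<bar>D y\<bar> \<partial>std_gauss)"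
    using integral_abs_bound[of std_gauss D] by simp
  also have "\<dots> \<le> (\<integral>y. 162 * r\<^sup>2 * exp (u\<^sup>2 / 4) * (\<bar>g y\<bar> * exp (y\<^sup>2 / 4)) \<partial>std_gauss)"
    using iD by (intro integral_mono D_le integrable_abs integrable_mult_right integrable_weighted)
  also have "\<dots> = 162 * r\<^sup>2 * exp (u\<^sup>2 / 4) * (\<integral>y. \<bar>g y\<bar> * exp (y\<^sup>2 / 4) \<partial>std_gauss)" by simp
  also have "\<dots> \<le> 162 * r\<^sup>2 * exp (u\<^sup>2 / 4) * (88 * exp (- \<tau>\<^sup>2 / 18) * sqrt 5)"
    by (intro mult_left_mono integral_weighted) simp
  finally show ?thesis by (simp add: mult_ac)
qed

text \<open>AM-GM and the equality of the two marginal laws. The bound does not see the correlation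
  and is meant for correlations away from zero.\<close>

lemma integrable_pair:
  assumes a: "(\<Sum>k<n. (a k)\<^sup>2) = 1" and b: "(\<Sum>k<n. (b k)\<^sup>2) = 1"
  shows "integrable (gauss_vec n) (\<lambda>z. g (\<Sum>k<n. a k * z k) * g (\<Sum>k<n. b k * z k))"
    and "\<bar>\<integral>z. g (\<Sum>k<n. a k * z k) * g (\<Sum>k<n. b k * z k) \<partial>gauss_vec n\<bar> \<le> (\<integral>y. (g y)\<^sup>2 \<partial>std_gauss)"
proof -
  let ?f = "\<lambda>z. g (\<Sum>k<n. a k * z k) * g (\<Sum>k<n. b k * z k)"
  let ?w = "\<lambda>z. ((g (\<Sum>k<n. a k * z k))\<^sup>2 + (g (\<Sum>k<n. b k * z k))\<^sup>2) / 2"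
  have sq: "integrable (gauss_vec n) (\<lambda>z. (g (\<Sum>k<n. a k * z k))\<^sup>2)" "integrable (gauss_vec n) (\<lambda>z. (g (\<Sum>k<n. b k * z k))\<^sup>2)"
    using integral_gauss_vec_inner(2)[OF a, of "\<lambda>y. (g y)\<^sup>2"] integral_gauss_vec_inner(2)[OF b, of "\<lambda>y. (g y)\<^sup>2"] integrable_square by simp_all
  have iw: "integrable (gauss_vec n) ?w" using sq by simp
  have le: "\<bar>?f z\<bar> \<le> ?w z" for z
  proof -
    have "0 \<le> (\<bar>g (\<Sum>k<n. a k * z k)\<bar> - \<bar>g (\<Sum>k<n. b k * z k)\<bar>)\<^sup>2" by simp
    then show ?thesis by (simp add: power2_diff abs_mult)
  qed
  show i: "integrable (gauss_vec n) ?f"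
    by (rule integrable_gauss_vec_mult[OF a b meas meas integrable_square integrable_square])
  have "\<bar>\<integral>z. ?f z \<partial>gauss_vec n\<bar> \<le> (\<integral>z. \<bar>?f z\<bar> \<partial>gauss_vec n)" by (rule integral_abs_bound)
  also have "\<dots> \<le> (\<integral>z. ?w z \<partial>gauss_vec n)" by (intro integral_mono le iw integrable_abs i)
  also have "\<dots> = (\<integral>y. (g y)\<^sup>2 \<partial>std_gauss)"
    using sq integral_gauss_vec_inner(1)[OF a, of "\<lambda>y. (g y)\<^sup>2"] integral_gauss_vec_inner(1)[OF b, of "\<lambda>y. (g y)\<^sup>2"] by simp
  finally show "\<bar>\<integral>z. ?f z \<partial>gauss_vec n\<bar> \<le> (\<integral>y. (g y)\<^sup>2 \<partial>std_gauss)" .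
qed

text \<open>For small \<open>r\<close>, conditioning on the first form and applying the Mehler bound
  yields \<open>r\<^sup>2\<close> and one factor \<open>exp (- \<tau>\<^sup>2 / 18)\<close>;
  integrating against \<open>g\<close> yields the second such factor. For \<open>|r| > 1/4\<close>
  the second moment suffices.\<close>

lemma covariance_bound:
  assumes a: "(\<Sum>k<n. (a k)\<^sup>2) = 1" and b: "(\<Sum>k<n. (b k)\<^sup>2) = 1" and r: "(\<Sum>k<n. a k * b k) = r"
  shows "\<bar>\<integral>z. g (\<Sum>k<n. a k * z k) * g (\<Sum>k<n. b k * z k) \<partial>gauss_vec n\<bar> \<le> 10000000 * r\<^sup>2 * exp (- \<tau>\<^sup>2 / 9)"
proof (cases "\<bar>r\<bar> \<le> 1 / 4")
  case True
  define B where "B = 88 * exp (- \<tau>\<^sup>2 / 18) * sqrt 5"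
  have B0: "0 \<le> B" by (simp add: B_def)
  define G where "G u = (\<integral>v. g (r * u + sqrt (1 - r\<^sup>2) * v) \<partial>std_gauss)" for u
  have G: "\<bar>G u\<bar> \<le> (162 * r\<^sup>2 * B) * exp (u\<^sup>2 / 4)" for u
    unfolding G_def B_def by (rule abs_mehler_operator_le[OF True])
  have "(\<integral>z. g (\<Sum>k<n. a k * z k) * g (\<Sum>k<n. b k * z k) \<partial>gauss_vec n) = (\<integral>u. g u * G u \<partial>std_gauss)"
    using integral_gauss_vec_pair[OF a b r, of "\<lambda>p. g (fst p) * g (snd p)"] integrable_pair(1)[OF a b]
    by (simp add: G_def)
  then have "\<bar>\<integral>z. g (\<Sum>k<n. a k * z k) * g (\<Sum>k<n. b k * z k) \<partial>gauss_vec n\<bar> \<le> (\<integral>u. \<bar>g u * G u\<bar> \<partial>std_gauss)"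
    using integral_abs_bound[of std_gauss "\<lambda>u. g u * G u"] by simp
  also have "\<dots> \<le> (\<integral>u. (162 * r\<^sup>2 * B) * (\<bar>g u\<bar> * exp (u\<^sup>2 / 4)) \<partial>std_gauss)"
  proof (rule integral_mono')
    show "integrable std_gauss (\<lambda>u. (162 * r\<^sup>2 * B) * (\<bar>g u\<bar> * exp (u\<^sup>2 / 4)))"
      by (intro integrable_mult_right integrable_weighted)
    show "\<bar>g u * G u\<bar> \<le> (162 * r\<^sup>2 * B) * (\<bar>g u\<bar> * exp (u\<^sup>2 / 4))" for u
      using mult_left_mono[OF G, of "\<bar>g u\<bar>" u] by (simp add: abs_mult mult_ac)
  qed (use B0 in simp)
  also have "\<dots> = (162 * r\<^sup>2 * B) * (\<integral>u. \<bar>g u\<bar> * exp (u\<^sup>2 / 4) \<partial>std_gauss)" by simp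
  also have "\<dots> \<le> (162 * r\<^sup>2 * B) * B"
    using integral_weighted B0 unfolding B_def[symmetric] by (intro mult_left_mono) auto
  \<comment> \<open>The constant is \<open>162 * 88 * 88 * 5\<close>.\<close>
  also have "\<dots> = 6272640 * r\<^sup>2 * exp (- \<tau>\<^sup>2 / 9)"
  proof -
    have "exp (- \<tau>\<^sup>2 / 18) * exp (- \<tau>\<^sup>2 / 18) = exp (- \<tau>\<^sup>2 / 9)" by (simp add: exp_add[symmetric])
    moreover have "(162 * r\<^sup>2 * B) * B = 162 * 88 * 88 * (sqrt 5 * sqrt 5) * r\<^sup>2 * (exp (- \<tau>\<^sup>2 / 18) * exp (- \<tau>\<^sup>2 / 18))"
      unfolding B_def by (simp only: mult_ac)
    ultimately show ?thesis by simp
  qed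
  also have "\<dots> \<le> 10000000 * r\<^sup>2 * exp (- \<tau>\<^sup>2 / 9)" by (intro mult_right_mono) auto
  finally show ?thesis .
next
  case False
  \<comment> \<open>The missing factor \<open>r\<^sup>2\<close> is supplied by
    \<open>1 \<le> 16 * r\<^sup>2\<close>.\<close>
  then have "(1/4)\<^sup>2 \<le> r\<^sup>2" by (subst abs_le_square_iff[symmetric]) simp
  then have r2: "1 \<le> 16 * r\<^sup>2" by (simp add: power2_eq_square)
  have s5: "sqrt 5 \<le> 3" by (intro real_le_lsqrt) auto
  have "\<bar>\<integral>z. g (\<Sum>k<n. a k * z k) * g (\<Sum>k<n. b k * z k) \<partial>gauss_vec n\<bar> \<le> 1600 * exp (- \<tau>\<^sup>2 / 9) * sqrt 5"
    using integrable_pair(2)[OF a b] integral_square by linarith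
  also have "\<dots> \<le> 1600 * exp (- \<tau>\<^sup>2 / 9) * 3" using s5 by (intro mult_left_mono) auto
  also have "\<dots> = 4800 * exp (- \<tau>\<^sup>2 / 9) * 1" by simp
  also have "\<dots> \<le> 4800 * exp (- \<tau>\<^sup>2 / 9) * (16 * r\<^sup>2)" using r2 by (intro mult_left_mono) auto
  also have "\<dots> = 76800 * (r\<^sup>2 * exp (- \<tau>\<^sup>2 / 9))" by simp
  also have "\<dots> \<le> 10000000 * (r\<^sup>2 * exp (- \<tau>\<^sup>2 / 9))" by (intro mult_right_mono) auto
  finally show ?thesis by simp
qed

end

subsection \<open>Upper bound\<close>

text \<open>Let \<open>J c\<close> be the second moment over \<open>|z| \<ge> c\<close>. The
  substitution \<open>z = 2 * w\<close> shows \<open>J (2 * \<tau>) \<le> J \<tau> / 2\<close>,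
  because the density drops by a factor 16 or more there. On
  \<open>\<tau> \<le> |z| < 2 * \<tau>\<close> the square is at most
  \<open>4 * \<tau>\<^sup>2\<close>, and solving for \<open>J \<tau>\<close> gives the
  bound.\<close>

lemma std_gauss_tail_second_moment:
  assumes \<tau>: "0 \<le> \<tau>" "9 * ln 2 \<le> \<tau>\<^sup>2"
  shows "(\<integral>z. indicator {z. \<tau> \<le> \<bar>z\<bar>} z * z\<^sup>2 \<partial>std_gauss) \<le> 8 * \<tau>\<^sup>2 * measure std_gauss {z. \<tau> \<le> \<bar>z\<bar>}"
proof -
  define J where "J c = (\<integral>z. indicator {z. c \<le> \<bar>z\<bar>} z * z\<^sup>2 \<partial>std_gauss)" for c :: real
  have iJ: "integrable std_gauss (\<lambda>z. indicator {z. c \<le> \<bar>z\<bar>} z * z\<^sup>2)" for c :: real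
    by (rule Bochner_Integration.integrable_bound[OF integrable_std_gauss_power[of 2]]) (auto split: split_indicator)
  have iJ': "integrable lborel (\<lambda>w. std_normal_density w * (indicator {z. c \<le> \<bar>z\<bar>} w * w\<^sup>2))" for c :: real
    using iJ[of c] by (subst (asm) integrable_std_gauss) auto
  have "J (2 * \<tau>) = (\<integral>z. std_normal_density z * (indicator {z. 2 * \<tau> \<le> \<bar>z\<bar>} z * z\<^sup>2) \<partial>lborel)"
    unfolding J_def by (rule integral_std_gauss) simp
  also have "\<dots> = 2 * (\<integral>w. std_normal_density (2 * w) * (indicator {z. 2 * \<tau> \<le> \<bar>z\<bar>} (2 * w) * (2 * w)\<^sup>2) \<partial>lborel)"
    by (subst lborel_integral_real_affine[of 2 _ 0]) simp_all
  also have "\<dots> \<le> 2 * (\<integral>w. (1 / 4) * (std_normal_density w * (indicator {z. \<tau> \<le> \<bar>z\<bar>} w * w\<^sup>2)) \<partial>lborel)"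
  proof (intro mult_left_mono integral_mono')
    fix w :: real
    show "std_normal_density (2 * w) * (indicator {z. 2 * \<tau> \<le> \<bar>z\<bar>} (2 * w) * (2 * w)\<^sup>2)
        \<le> (1 / 4) * (std_normal_density w * (indicator {z. \<tau> \<le> \<bar>z\<bar>} w * w\<^sup>2))"
    proof (cases "\<tau> \<le> \<bar>w\<bar>")
      case True
      then have "\<tau>\<^sup>2 \<le> w\<^sup>2" using \<tau> by (simp add: abs_le_square_iff[symmetric])
      then have "4 * ln 2 \<le> 3 * w\<^sup>2 / 2" using \<tau>(2) ln2_ge_two_thirds by linarith
      then have "exp (4 * ln 2) \<le> exp (3 * w\<^sup>2 / 2)" by simp
      moreover have "exp (4 * ln 2) = (16::real)" using exp_of_nat_mult[of 4 "ln 2 :: real"] by simp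
      ultimately have e: "exp (- (3 * w\<^sup>2 / 2)) \<le> 1 / 16" by (simp add: exp_minus field_simps)
      have "std_normal_density (2 * w) = std_normal_density w * exp (- (3 * w\<^sup>2 / 2))"
        by (simp add: std_normal_density_def exp_add[symmetric] power_mult_distrib field_simps)
      also have "\<dots> \<le> std_normal_density w * (1 / 16)" using e by (intro mult_left_mono) auto
      finally have "std_normal_density (2 * w) * (4 * w\<^sup>2) \<le> (std_normal_density w * (1 / 16)) * (4 * w\<^sup>2)"
        by (intro mult_right_mono) auto
      then show ?thesis using True by (simp add: power_mult_distrib abs_mult)
    next
      case False
      then have "\<not> 2 * \<tau> \<le> \<bar>2 * w\<bar>" by (simp add: abs_mult)
      then show ?thesis using False by simp
    qed
  qed (auto intro!: iJ' integrable_mult_right)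
  also have "\<dots> = J \<tau> / 2"
    unfolding J_def by (subst integral_std_gauss) simp_all
  finally have J2: "J (2 * \<tau>) \<le> J \<tau> / 2" .
  have iP: "integrable std_gauss (\<lambda>z. indicator {z. \<tau> \<le> \<bar>z\<bar>} z :: real)"
    by (rule integrable_real_indicator) (auto simp: std_gauss.emeasure_eq_measure)
  have "J \<tau> \<le> (\<integral>z. 4 * \<tau>\<^sup>2 * indicator {z. \<tau> \<le> \<bar>z\<bar>} z + indicator {z. 2 * \<tau> \<le> \<bar>z\<bar>} z * z\<^sup>2 \<partial>std_gauss)"
    unfolding J_def
  proof (rule integral_mono[OF iJ])
    show "integrable std_gauss (\<lambda>z. 4 * \<tau>\<^sup>2 * indicator {z. \<tau> \<le> \<bar>z\<bar>} z + indicator {z. 2 * \<tau> \<le> \<bar>z\<bar>} z * z\<^sup>2)"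
      by (intro Bochner_Integration.integrable_add integrable_mult_right iP iJ)
    fix z :: real
    show "indicator {z. \<tau> \<le> \<bar>z\<bar>} z * z\<^sup>2 \<le> 4 * \<tau>\<^sup>2 * indicator {z. \<tau> \<le> \<bar>z\<bar>} z + indicator {z. 2 * \<tau> \<le> \<bar>z\<bar>} z * z\<^sup>2"
    proof (cases "2 * \<tau> \<le> \<bar>z\<bar>")
      case True
      then show ?thesis using \<tau> by simp
    next
      case False
      then have "\<bar>z\<bar> \<le> \<bar>2 * \<tau>\<bar>" using \<tau> by simp
      then have "z\<^sup>2 \<le> (2 * \<tau>)\<^sup>2" by (simp only: abs_le_square_iff)
      then show ?thesis using False by (simp add: power_mult_distrib split: split_indicator)
    qed
  qed
  also have "\<dots> = 4 * \<tau>\<^sup>2 * measure std_gauss {z. \<tau> \<le> \<bar>z\<bar>} + J (2 * \<tau>)"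
    using iP iJ by (simp add: J_def)
  finally have "J \<tau> \<le> 8 * \<tau>\<^sup>2 * measure std_gauss {z. \<tau> \<le> \<bar>z\<bar>}" using J2 by linarith
  then show ?thesis by (simp add: J_def)
qed

section \<open>The hard threshold and its centring constant\<close>

definition hard_threshold :: "real \<Rightarrow> real \<Rightarrow> real \<Rightarrow> real" where
  "hard_threshold \<tau> \<beta> y = (if \<tau> < \<bar>y\<bar> then y\<^sup>2 - \<beta> else 0)"

lemma tau_square:
  assumes "1 \<le> s" "real s \<le> \<rho>"
  shows "(tau s \<rho>)\<^sup>2 = 9 * ln (1 + \<rho>\<^sup>2 / (real s)\<^sup>2)" "9 * ln 2 \<le> (tau s \<rho>)\<^sup>2" "0 \<le> tau s \<rho>"
proof -
  have "(real s)\<^sup>2 \<le> \<rho>\<^sup>2" using assms by (intro power_mono) auto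
  then have *: "1 \<le> \<rho>\<^sup>2 / (real s)\<^sup>2" using assms by simp
  then have "ln 2 \<le> ln (1 + \<rho>\<^sup>2 / (real s)\<^sup>2)" by simp
  moreover have l: "0 \<le> ln (1 + \<rho>\<^sup>2 / (real s)\<^sup>2)" using * by simp
  then show "(tau s \<rho>)\<^sup>2 = 9 * ln (1 + \<rho>\<^sup>2 / (real s)\<^sup>2)" by (simp add: tau_def power_mult_distrib)
  ultimately show "9 * ln 2 \<le> (tau s \<rho>)\<^sup>2" by simp
  show "0 \<le> tau s \<rho>" using l by (simp add: tau_def)
qed

lemma beta_bounds:
  assumes "1 \<le> s" "real s \<le> \<rho>"
  shows "0 \<le> beta s \<rho>" "beta s \<rho> \<le> 8 * (tau s \<rho>)\<^sup>2"
proof -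
  note t = tau_square[OF assms]
  show "0 \<le> beta s \<rho>" unfolding beta_def by (intro divide_nonneg_nonneg Bochner_Integration.integral_nonneg) auto
  show "beta s \<rho> \<le> 8 * (tau s \<rho>)\<^sup>2"
  \<comment> \<open>If the tail had measure zero, \<open>beta\<close> would be 0 by the convention
    for division by zero.\<close>
  proof (cases "measure std_gauss {z. tau s \<rho> \<le> \<bar>z\<bar>} = 0")
    case False
    then have "0 < measure std_gauss {z. tau s \<rho> \<le> \<bar>z\<bar>}" by (simp add: zero_less_measure_iff)
    then show ?thesis using std_gauss_tail_second_moment[OF t(3,2)] by (simp add: beta_def divide_le_eq)
  qed (simp add: beta_def)
qed

text \<open>The conditional second moment \<open>beta\<close> is exactly the constant that centres
  the thresholded square. The growth bound follows from
  \<open>beta s \<rho> \<le> 8 * (tau s \<rho>)\<^sup>2\<close>, as only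
  \<open>|y| > tau s \<rho>\<close> matters.\<close>

lemma tail_function_hard_threshold:
  assumes "1 \<le> s" "real s \<le> \<rho>"
  shows "tail_function (hard_threshold (tau s \<rho>) (beta s \<rho>)) (tau s \<rho>)"
proof
  note t = tau_square[OF assms] and b = beta_bounds[OF assms]
  let ?\<tau> = "tau s \<rho>" and ?\<beta> = "beta s \<rho>"
  let ?g = "hard_threshold ?\<tau> ?\<beta>"
  show m: "?g \<in> borel_measurable borel" unfolding hard_threshold_def by measurable
  show "0 \<le> ?\<tau>" by (rule t)
  show "?g (- y) = ?g y" for y by (simp add: hard_threshold_def)
  show "?g y = 0" if "\<bar>y\<bar> \<le> ?\<tau>" for y using that by (simp add: hard_threshold_def)
  show "\<bar>?g y\<bar> \<le> 8 * y\<^sup>2" for y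
  proof (cases "?\<tau> < \<bar>y\<bar>")
    case True
    then have "?\<tau>\<^sup>2 \<le> y\<^sup>2" using t(3) by (simp add: abs_le_square_iff[symmetric])
    then show ?thesis using True b unfolding hard_threshold_def abs_le_iff by simp
  qed (simp add: hard_threshold_def)
  show "(\<integral>y. ?g y \<partial>std_gauss) = 0"
  proof -
    let ?I = "\<lambda>y. indicator {z. ?\<tau> \<le> \<bar>z\<bar>} y :: real"
    have i1: "integrable std_gauss (\<lambda>y. ?I y * y\<^sup>2)"
      by (rule Bochner_Integration.integrable_bound[OF integrable_std_gauss_power[of 2]]) (auto split: split_indicator)
    have i2: "integrable std_gauss ?I"
      by (rule integrable_real_indicator) (auto simp: std_gauss.emeasure_eq_measure)
    have "(\<integral>y. ?g y \<partial>std_gauss) = (\<integral>y. std_normal_density y * ?g y \<partial>lborel)" using m by (rule integral_std_gauss)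
    also have "\<dots> = (\<integral>y. std_normal_density y * (?I y * y\<^sup>2 - ?\<beta> * ?I y) \<partial>lborel)"
    proof (rule integral_cong_AE)
      \<comment> \<open>The estimator thresholds with a strict inequality and \<open>beta\<close>
        uses a weak one; they differ on a null set.\<close>
      have "AE y in lborel. y \<noteq> ?\<tau>" "AE y in lborel. y \<noteq> - ?\<tau>" by (rule AE_lborel_singleton)+
      then show "AE y in lborel. std_normal_density y * ?g y = std_normal_density y * (?I y * y\<^sup>2 - ?\<beta> * ?I y)"
        by eventually_elim (auto simp: hard_threshold_def split: split_indicator)
    qed (use m in measurable)
    also have "\<dots> = (\<integral>y. ?I y * y\<^sup>2 - ?\<beta> * ?I y \<partial>std_gauss)" by (rule integral_std_gauss[symmetric]) simp
    also have "\<dots> = (\<integral>y. ?I y * y\<^sup>2 \<partial>std_gauss) - ?\<beta> * measure std_gauss {z. ?\<tau> \<le> \<bar>z\<bar>}"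
      using i1 i2 by simp
    also have "\<dots> = 0"
    proof (cases "measure std_gauss {z. ?\<tau> \<le> \<bar>z\<bar>} = 0")
      case True
      have "(\<integral>y. ?I y * y\<^sup>2 \<partial>std_gauss) \<le> 0" using std_gauss_tail_second_moment[OF t(3,2)] True by simp
      moreover have "0 \<le> (\<integral>y. ?I y * y\<^sup>2 \<partial>std_gauss)" by (intro Bochner_Integration.integral_nonneg) auto
      ultimately show ?thesis using True by simp
    next
      case False
      then show ?thesis by (simp add: beta_def)
    qed
    finally show ?thesis .
  qed
qed

text \<open>With \<open>q = sqrt |Q|\<close> one has \<open>|q - t| * (q + t) \<le> |U| + V\<close>.
  If \<open>V\<close> dominates, \<open>q + t \<ge> |q - t|\<close> gives
  \<open>(q - t)\<^sup>2 \<le> 2 * V\<close>. If \<open>U\<close> dominates,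
  \<open>q + t \<ge> t\<close> gives \<open>|q - t| \<le> 2 * |U| / t\<close>, where
  \<open>t > 0\<close> because \<open>U \<noteq> 0\<close>.\<close>

lemma sqrt_abs_error_le:
  fixes Q t U V :: real
  assumes t: "0 \<le> t" and U0: "t = 0 \<Longrightarrow> U = 0" and V: "\<bar>Q - t\<^sup>2 - U\<bar> \<le> V"
  shows "(sqrt \<bar>Q\<bar> - t)\<^sup>2 \<le> 4 / t\<^sup>2 * U\<^sup>2 + 2 * V"
proof -
  define q where "q = sqrt \<bar>Q\<bar>"
  have q: "0 \<le> q" "q\<^sup>2 = \<bar>Q\<bar>" by (simp_all add: q_def)
  have "\<bar>\<bar>Q\<bar> - t\<^sup>2\<bar> \<le> \<bar>Q - t\<^sup>2\<bar>" by (smt (verit) zero_le_power2)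
  then have UV: "\<bar>q\<^sup>2 - t\<^sup>2\<bar> \<le> \<bar>U\<bar> + V" unfolding q using V by linarith
  have fac: "\<bar>q\<^sup>2 - t\<^sup>2\<bar> = \<bar>q - t\<bar> * (q + t)"
  proof -
    have "q\<^sup>2 - t\<^sup>2 = (q - t) * (q + t)" by (simp add: power2_eq_square algebra_simps)
    then show ?thesis using q(1) t by (simp only: abs_mult abs_of_nonneg add_nonneg_nonneg)
  qed
  have V0: "0 \<le> V" using V by linarith
  show ?thesis unfolding q_def[symmetric]
  proof (cases "\<bar>U\<bar> \<le> V")
    case True
    have "(q - t)\<^sup>2 = \<bar>q - t\<bar> * \<bar>q - t\<bar>" by (simp add: power2_eq_square)
    also have "\<dots> \<le> \<bar>q - t\<bar> * (q + t)" using q t by (intro mult_left_mono) auto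
    also have "\<dots> \<le> 2 * V" using UV True fac by linarith
    finally show "(q - t)\<^sup>2 \<le> 4 / t\<^sup>2 * U\<^sup>2 + 2 * V" by (smt (verit) zero_le_power2 divide_nonneg_nonneg mult_nonneg_nonneg)
  next
    case False
    then have "U \<noteq> 0" using V0 by auto
    then have tp: "0 < t" using U0 t by fastforce
    have "\<bar>q - t\<bar> * t \<le> \<bar>q - t\<bar> * (q + t)" using q by (intro mult_left_mono) auto
    also have "\<dots> \<le> 2 * \<bar>U\<bar>" using UV False fac by linarith
    finally have "(\<bar>q - t\<bar> * t)\<^sup>2 \<le> (2 * \<bar>U\<bar>)\<^sup>2" using t by (intro power_mono) auto
    then have "(q - t)\<^sup>2 * t\<^sup>2 \<le> 4 * U\<^sup>2" by (simp add: power_mult_distrib)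
    then have "(q - t)\<^sup>2 \<le> 4 / t\<^sup>2 * U\<^sup>2" using tp by (simp add: field_simps)
    then show "(q - t)\<^sup>2 \<le> 4 / t\<^sup>2 * U\<^sup>2 + 2 * V" using V0 by linarith
  qed
qed

lemma nn_integral_sqrt_abs_error_le:
  fixes Q U V :: "'z \<Rightarrow> real"
  assumes t: "0 \<le> t" and U0: "\<And>z. t = 0 \<Longrightarrow> U z = 0" and V: "\<And>z. \<bar>Q z - t\<^sup>2 - U z\<bar> \<le> V z"
    and iU: "integrable M (\<lambda>z. (U z)\<^sup>2)" and U: "(\<integral>z. (U z)\<^sup>2 \<partial>M) \<le> 4 * \<kappa> * t\<^sup>2" and \<kappa>: "0 \<le> \<kappa>"
    and iV: "integrable M V" and v: "(\<integral>z. V z \<partial>M) \<le> v"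
  shows "(\<integral>\<^sup>+z. ennreal ((sqrt \<bar>Q z\<bar> - t)\<^sup>2) \<partial>M) \<le> ennreal (16 * \<kappa> + 2 * v)"
proof -
  have V0: "0 \<le> V z" for z using V[of z] by linarith
  have i: "integrable M (\<lambda>z. 4 / t\<^sup>2 * (U z)\<^sup>2 + 2 * V z)"
    using iU iV by (intro Bochner_Integration.integrable_add integrable_mult_right)
  have "(\<integral>\<^sup>+z. ennreal ((sqrt \<bar>Q z\<bar> - t)\<^sup>2) \<partial>M) \<le> (\<integral>\<^sup>+z. ennreal (4 / t\<^sup>2 * (U z)\<^sup>2 + 2 * V z) \<partial>M)"
    by (intro nn_integral_mono ennreal_leI sqrt_abs_error_le t U0 V)
  also have "\<dots> = ennreal (\<integral>z. 4 / t\<^sup>2 * (U z)\<^sup>2 + 2 * V z \<partial>M)"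
    using i V0 by (intro nn_integral_eq_integral) auto
  also have "\<dots> = ennreal (4 / t\<^sup>2 * (\<integral>z. (U z)\<^sup>2 \<partial>M) + 2 * (\<integral>z. V z \<partial>M))"
    using iU iV by simp
  also have "\<dots> \<le> ennreal (16 * \<kappa> + 2 * v)"
  proof (intro ennreal_leI add_mono mult_left_mono v)
    \<comment> \<open>For \<open>t = 0\<close> the quotient is 0 by convention, in agreement with
      \<open>U = 0\<close>.\<close>
    have "4 / t\<^sup>2 * (\<integral>z. (U z)\<^sup>2 \<partial>M) \<le> 4 / t\<^sup>2 * (4 * \<kappa> * t\<^sup>2)" using U by (intro mult_left_mono) auto
    also have "\<dots> \<le> 16 * \<kappa>" using \<kappa> by (cases "t = 0") auto
    finally show "4 / t\<^sup>2 * (\<integral>z. (U z)\<^sup>2 \<partial>M) \<le> 16 * \<kappa>" .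
  qed simp
  finally show ?thesis .
qed

section \<open>Second moments of linear and quadratic statistics, and bounds for the quadratic form
  of the covariance\<close>

lemma integral_square_sum:
  fixes X :: "'i \<Rightarrow> 'z \<Rightarrow> real"
  assumes "\<And>i j. i \<in> I \<Longrightarrow> j \<in> I \<Longrightarrow> integrable M (\<lambda>z. X i z * X j z)"
  shows "integrable M (\<lambda>z. (\<Sum>i\<in>I. X i z)\<^sup>2)"
    and "(\<integral>z. (\<Sum>i\<in>I. X i z)\<^sup>2 \<partial>M) = (\<Sum>i\<in>I. \<Sum>j\<in>I. \<integral>z. X i z * X j z \<partial>M)"
  unfolding power2_eq_square sum_product using assms by auto

lemma gauss_vec_covariance:
  assumes a: "(\<Sum>k<n. (a k)\<^sup>2) = 1" and b: "(\<Sum>k<n. (b k)\<^sup>2) = 1" and r: "(\<Sum>k<n. a k * b k) = r"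
  shows "integrable (gauss_vec n) (\<lambda>z. (\<Sum>k<n. a k * z k) * (\<Sum>k<n. b k * z k))"
    and "(\<integral>z. (\<Sum>k<n. a k * z k) * (\<Sum>k<n. b k * z k) \<partial>gauss_vec n) = r"
proof -
  show i: "integrable (gauss_vec n) (\<lambda>z. (\<Sum>k<n. a k * z k) * (\<Sum>k<n. b k * z k))"
    by (rule integrable_gauss_vec_mult[OF a b, of "\<lambda>x. x" "\<lambda>x. x"]) auto
  have e: "(\<integral>v. u * (r * u + sqrt (1 - r\<^sup>2) * v) \<partial>std_gauss) = r * u\<^sup>2" for u
    by (simp add: std_gauss.prob_space[simplified] power2_eq_square)
  have "(\<integral>z. (\<Sum>k<n. a k * z k) * (\<Sum>k<n. b k * z k) \<partial>gauss_vec n)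
      = (\<integral>u. \<integral>v. u * (r * u + sqrt (1 - r\<^sup>2) * v) \<partial>std_gauss \<partial>std_gauss)"
    using integral_gauss_vec_pair[OF a b r, of "\<lambda>p. fst p * snd p"] i by simp
  then show "(\<integral>z. (\<Sum>k<n. a k * z k) * (\<Sum>k<n. b k * z k) \<partial>gauss_vec n) = r"
    by (simp only: e) simp
qed

text \<open>Conditionally on the first form \<open>u\<close>, the second factor has mean
  \<open>r\<^sup>2 * (u\<^sup>2 - 1)\<close>: the second Hermite polynomial is an eigenfunction. The
  remaining moment of \<open>(u\<^sup>2 - 1)\<^sup>2\<close> is
  \<open>3 - 2 + 1 = 2\<close>.\<close>

lemma gauss_vec_covariance_squares:
  assumes a: "(\<Sum>k<n. (a k)\<^sup>2) = 1" and b: "(\<Sum>k<n. (b k)\<^sup>2) = 1" and r: "(\<Sum>k<n. a k * b k) = r"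
  shows "integrable (gauss_vec n) (\<lambda>z. ((\<Sum>k<n. a k * z k)\<^sup>2 - 1) * ((\<Sum>k<n. b k * z k)\<^sup>2 - 1))"
    and "(\<integral>z. ((\<Sum>k<n. a k * z k)\<^sup>2 - 1) * ((\<Sum>k<n. b k * z k)\<^sup>2 - 1) \<partial>gauss_vec n) = 2 * r\<^sup>2"
proof -
  have sq: "(x\<^sup>2 - 1)\<^sup>2 = x ^ 4 - 2 * x\<^sup>2 + 1" for x :: real
    by (simp add: power2_eq_square power4_eq_xxxx algebra_simps)
  have isq: "integrable std_gauss (\<lambda>x. (x\<^sup>2 - 1)\<^sup>2)"
    unfolding sq by (intro Bochner_Integration.integrable_add Bochner_Integration.integrable_diff integrable_mult_right) auto
  show i: "integrable (gauss_vec n) (\<lambda>z. ((\<Sum>k<n. a k * z k)\<^sup>2 - 1) * ((\<Sum>k<n. b k * z k)\<^sup>2 - 1))"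
    by (rule integrable_gauss_vec_mult[OF a b, of "\<lambda>x. x\<^sup>2 - 1" "\<lambda>x. x\<^sup>2 - 1"]) (use isq in auto)
  have "\<bar>r\<bar> \<le> 1" using abs_inner_unit_le_1[OF a b] r by simp
  then have q: "(sqrt (1 - r\<^sup>2))\<^sup>2 = 1 - r\<^sup>2" by (simp add: abs_square_le_1)
  have "(\<integral>z. ((\<Sum>k<n. a k * z k)\<^sup>2 - 1) * ((\<Sum>k<n. b k * z k)\<^sup>2 - 1) \<partial>gauss_vec n)
      = (\<integral>u. \<integral>v. (u\<^sup>2 - 1) * ((r * u + sqrt (1 - r\<^sup>2) * v)\<^sup>2 - 1) \<partial>std_gauss \<partial>std_gauss)"
    using integral_gauss_vec_pair[OF a b r, of "\<lambda>p. ((fst p)\<^sup>2 - 1) * ((snd p)\<^sup>2 - 1)"] i by simp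
  also have "\<dots> = (\<integral>u. r\<^sup>2 * (u\<^sup>2 - 1)\<^sup>2 \<partial>std_gauss)"
  proof (rule Bochner_Integration.integral_cong[OF refl])
    fix u :: real
    have e: "(u\<^sup>2 - 1) * ((r * u + sqrt (1 - r\<^sup>2) * v)\<^sup>2 - 1)
        = (u\<^sup>2 - 1) * (r\<^sup>2 * u\<^sup>2 - 1) + (u\<^sup>2 - 1) * (2 * r * u * sqrt (1 - r\<^sup>2)) * v + (u\<^sup>2 - 1) * (1 - r\<^sup>2) * v\<^sup>2" for v
      unfolding power2_sum power_mult_distrib q by (simp add: algebra_simps)
    have "(\<integral>v. (u\<^sup>2 - 1) * ((r * u + sqrt (1 - r\<^sup>2) * v)\<^sup>2 - 1) \<partial>std_gauss) = (u\<^sup>2 - 1) * (r\<^sup>2 * u\<^sup>2 - 1) + (u\<^sup>2 - 1) * (1 - r\<^sup>2)"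
      unfolding e by (simp add: std_gauss.prob_space[simplified])
    then show "(\<integral>v. (u\<^sup>2 - 1) * ((r * u + sqrt (1 - r\<^sup>2) * v)\<^sup>2 - 1) \<partial>std_gauss) = r\<^sup>2 * (u\<^sup>2 - 1)\<^sup>2"
      by (simp add: power2_eq_square algebra_simps)
  qed
  also have "\<dots> = 2 * r\<^sup>2"
    unfolding sq by (simp add: std_gauss.prob_space[simplified])
  finally show "(\<integral>z. ((\<Sum>k<n. a k * z k)\<^sup>2 - 1) * ((\<Sum>k<n. b k * z k)\<^sup>2 - 1) \<partial>gauss_vec n) = 2 * r\<^sup>2" .
qed

text \<open>Cauchy-Schwarz between \<open>S\<close> and the matrix of products of entries of
  \<open>\<theta>\<close>, written as an entrywise Young inequality. The weights make each half
  contribute at most \<open>\<rho> * t / 2\<close>, with \<open>t\<close> the squared norm of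
  \<open>\<theta>\<close>.\<close>

lemma quadratic_form_le_frob:
  fixes S :: "nat \<Rightarrow> nat \<Rightarrow> real" and \<theta> :: "nat \<Rightarrow> real"
  assumes S: "(\<Sum>i<d. \<Sum>j<d. (S i j)\<^sup>2) \<le> \<rho>\<^sup>2" and \<rho>: "0 < \<rho>"
  shows "(\<Sum>i<d. \<Sum>j<d. \<theta> i * \<theta> j * S i j) \<le> \<rho> * (\<Sum>i<d. (\<theta> i)\<^sup>2)"
proof (cases "(\<Sum>i<d. (\<theta> i)\<^sup>2) = 0")
  case True
  then have "\<forall>i<d. \<theta> i = 0" using sum_nonneg_eq_0_iff[of "{..<d}" "\<lambda>i. (\<theta> i)\<^sup>2"] by simp
  then show ?thesis by simp
next
  case False
  define t where "t = (\<Sum>i<d. (\<theta> i)\<^sup>2)"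
  have t: "0 < t" using False sum_nonneg[of "{..<d}" "\<lambda>i. (\<theta> i)\<^sup>2"] by (simp add: t_def less_le)
  have "\<theta> i * \<theta> j * S i j \<le> \<rho> / (2 * t) * ((\<theta> i)\<^sup>2 * (\<theta> j)\<^sup>2) + t / (2 * \<rho>) * (S i j)\<^sup>2" for i j
  proof -
    have "0 \<le> (\<rho> * (\<theta> i * \<theta> j) - t * S i j)\<^sup>2 / (2 * t * \<rho>)" using t \<rho> by simp
    then show ?thesis using t \<rho> by (simp add: power2_diff power_mult_distrib field_simps power2_eq_square)
  qed
  then have "(\<Sum>i<d. \<Sum>j<d. \<theta> i * \<theta> j * S i j) \<le> (\<Sum>i<d. \<Sum>j<d. \<rho> / (2 * t) * ((\<theta> i)\<^sup>2 * (\<theta> j)\<^sup>2) + t / (2 * \<rho>) * (S i j)\<^sup>2)"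
    by (intro sum_mono)
  also have "\<dots> = \<rho> / (2 * t) * (\<Sum>i<d. \<Sum>j<d. (\<theta> i)\<^sup>2 * (\<theta> j)\<^sup>2) + t / (2 * \<rho>) * (\<Sum>i<d. \<Sum>j<d. (S i j)\<^sup>2)"
    by (simp only: sum.distrib sum_distrib_left)
  also have "\<dots> \<le> \<rho> / (2 * t) * (t * t) + t / (2 * \<rho>) * \<rho>\<^sup>2"
    using S t \<rho> unfolding sum_product[symmetric] t_def[symmetric] by (intro add_left_mono mult_left_mono) auto
  also have "\<dots> = \<rho> * t" using t \<rho> by (simp add: field_simps power2_eq_square)
  finally show ?thesis by (simp add: t_def)
qed

text \<open>Only pairs in the support contribute, their covariances are at most 1 in absolute value,
  and AM-GM produces the cardinality of the support as the factor.\<close>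

lemma quadratic_form_le_sparsity:
  fixes S :: "nat \<Rightarrow> nat \<Rightarrow> real" and \<theta> :: "nat \<Rightarrow> real"
  assumes S: "\<And>i j. i < d \<Longrightarrow> j < d \<Longrightarrow> \<bar>S i j\<bar> \<le> 1" and s: "l0norm d \<theta> \<le> s"
  shows "(\<Sum>i<d. \<Sum>j<d. \<theta> i * \<theta> j * S i j) \<le> real s * (\<Sum>i<d. (\<theta> i)\<^sup>2)"
proof -
  define I where "I = {i\<in>{..<d}. \<theta> i \<noteq> 0}"
  have I: "I \<subseteq> {..<d}" "finite I" "card I \<le> s" using s by (auto simp: I_def l0norm_def)
  have out: "\<theta> i = 0" if "i \<in> {..<d} - I" for i using that by (auto simp: I_def)
  have "(\<Sum>i<d. \<Sum>j<d. \<theta> i * \<theta> j * S i j) = (\<Sum>i\<in>I. \<Sum>j<d. \<theta> i * \<theta> j * S i j)"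
    using I out by (intro sum.mono_neutral_right) auto
  also have "\<dots> = (\<Sum>i\<in>I. \<Sum>j\<in>I. \<theta> i * \<theta> j * S i j)"
    using I out by (intro sum.cong refl sum.mono_neutral_right) auto
  also have "\<dots> \<le> (\<Sum>i\<in>I. \<Sum>j\<in>I. ((\<theta> i)\<^sup>2 + (\<theta> j)\<^sup>2) / 2)"
  proof (intro sum_mono)
    fix i j assume "i \<in> I" "j \<in> I"
    then have "\<bar>S i j\<bar> \<le> 1" using S I by auto
    have "\<theta> i * \<theta> j * S i j \<le> \<bar>\<theta> i * \<theta> j\<bar> * \<bar>S i j\<bar>" using abs_ge_self[of "\<theta> i * \<theta> j * S i j"] by (simp add: abs_mult)
    also have "\<dots> \<le> \<bar>\<theta> i * \<theta> j\<bar> * 1" using \<open>\<bar>S i j\<bar> \<le> 1\<close> by (intro mult_left_mono) auto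
    also have "\<dots> \<le> ((\<theta> i)\<^sup>2 + (\<theta> j)\<^sup>2) / 2"
    proof -
      have "0 \<le> (\<bar>\<theta> i\<bar> - \<bar>\<theta> j\<bar>)\<^sup>2" by simp
      then show ?thesis by (simp add: power2_diff abs_mult)
    qed
    finally show "\<theta> i * \<theta> j * S i j \<le> ((\<theta> i)\<^sup>2 + (\<theta> j)\<^sup>2) / 2" .
  qed
  also have "\<dots> = real (card I) * (\<Sum>i\<in>I. (\<theta> i)\<^sup>2)"
    by (simp add: sum_divide_distrib[symmetric] sum.distrib sum_distrib_left[symmetric])
  also have "\<dots> \<le> real s * (\<Sum>i<d. (\<theta> i)\<^sup>2)"
    using I by (intro mult_mono sum_mono2) (auto intro: sum_nonneg)
  finally show ?thesis .
qed

lemma abs_le_square_div: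
  fixes w c :: real
  assumes "0 < c"
  shows "\<bar>w\<bar> \<le> (1 / (2 * c)) * w\<^sup>2 + c / 2"
proof -
  have "0 \<le> (\<bar>w\<bar> - c)\<^sup>2 / (2 * c)" using assms by simp
  then show ?thesis using assms by (simp add: power2_diff field_simps power2_eq_square)
qed

lemma Theta_noise:
  assumes p: "(\<theta>, S) \<in> Theta s d \<rho>" and "i < d" "j < d"
  shows "(\<Sum>k<d. (cov_factor d S i k)\<^sup>2) = 1" "(\<Sum>k<d. cov_factor d S i k * cov_factor d S j k) = S i j" "\<bar>S i j\<bar> \<le> 1"
proof -
  have c: "is_cov d S" "\<And>i. i < d \<Longrightarrow> S i i = 1" using p by (auto simp: Theta_def)
  have u: "(\<Sum>k<d. (cov_factor d S i k)\<^sup>2) = 1" if "i < d" for i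
    using cov_factor[OF c(1) that that] c(2)[OF that] by (simp add: power2_eq_square)
  show "(\<Sum>k<d. (cov_factor d S i k)\<^sup>2) = 1" using u assms by simp
  show e: "(\<Sum>k<d. cov_factor d S i k * cov_factor d S j k) = S i j" using cov_factor[OF c(1)] assms by simp
  show "\<bar>S i j\<bar> \<le> 1" using abs_inner_unit_le_1[OF u[OF assms(2)] u[OF assms(3)]] e by simp
qed

lemma Theta_frob:
  assumes p: "(\<theta>, S) \<in> Theta s d \<rho>" and "0 \<le> \<rho>"
  shows "(\<Sum>i<d. \<Sum>j<d. (S i j)\<^sup>2) \<le> \<rho>\<^sup>2"
proof -
  have "sqrt (\<Sum>i<d. \<Sum>j<d. (S i j)\<^sup>2) \<le> \<rho>" using p by (auto simp: Theta_def frob_norm_def)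
  then show ?thesis using assms(2) by (metis sqrt_le_D)
qed

text \<open>The linear term \<open>U\<close> has second moment four times the quadratic form of
  \<open>S\<close> at \<open>\<theta>\<close>, bounded by \<open>\<rho> * t\<^sup>2\<close> in the
  dense case and by \<open>s * t\<^sup>2\<close> in the sparse one. What remains is a centred sum
  \<open>W\<close>, controlled by its variance, plus errors on the support in the sparse
  case.\<close>

lemma N_tilde_risk_unit:
  assumes p: "(\<theta>, S) \<in> Theta s d \<rho>" and s: "1 \<le> s" and \<rho>: "1 \<le> \<rho>"
  shows "(\<integral>\<^sup>+z. ennreal ((N_tilde d s \<rho> 1 (\<lambda>i. \<theta> i + noise d S i z) - l2norm d \<theta>)\<^sup>2) \<partial>gauss_vec d)
    \<le> ennreal (20000000 * phi s (\<rho>\<^sup>2))"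
proof -
  define t where "t = l2norm d \<theta>"
  have t: "0 \<le> t" "t\<^sup>2 = (\<Sum>i<d. (\<theta> i)\<^sup>2)" by (simp_all add: t_def l2norm_def sum_nonneg)
  have \<theta>0: "\<theta> i = 0" if "t = 0" "i < d" for i
    using that t(2) sum_nonneg_eq_0_iff[of "{..<d}" "\<lambda>i. (\<theta> i)\<^sup>2"] by simp
  define U where "U z = (\<Sum>i<d. 2 * \<theta> i * noise d S i z)" for z
  have U0: "U z = 0" if "t = 0" for z using \<theta>0[OF that] by (simp add: U_def)
  note nz = Theta_noise[OF p]
  have frob: "(\<Sum>i<d. \<Sum>j<d. (S i j)\<^sup>2) \<le> \<rho>\<^sup>2" using Theta_frob[OF p] \<rho> by simp
  have iUU: "integrable (gauss_vec d) (\<lambda>z. (2 * \<theta> i * noise d S i z) * (2 * \<theta> j * noise d S j z))"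
    and UU: "(\<integral>z. (2 * \<theta> i * noise d S i z) * (2 * \<theta> j * noise d S j z) \<partial>gauss_vec d) = 4 * (\<theta> i * \<theta> j * S i j)"
    if "i < d" "j < d" for i j
  proof -
    have e: "(2 * \<theta> i * noise d S i z) * (2 * \<theta> j * noise d S j z) = (4 * (\<theta> i * \<theta> j)) * (noise d S i z * noise d S j z)" for z
      by (simp only: mult_ac)
    note cv = gauss_vec_covariance[OF nz(1)[OF that] nz(1)[OF that(2,1)] nz(2)[OF that]]
    show "integrable (gauss_vec d) (\<lambda>z. (2 * \<theta> i * noise d S i z) * (2 * \<theta> j * noise d S j z))"
      unfolding e by (intro integrable_mult_right cv)
    show "(\<integral>z. (2 * \<theta> i * noise d S i z) * (2 * \<theta> j * noise d S j z) \<partial>gauss_vec d) = 4 * (\<theta> i * \<theta> j * S i j)"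
      unfolding e integral_mult_right_zero cv(2) by simp
  qed
  have iU: "integrable (gauss_vec d) (\<lambda>z. (U z)\<^sup>2)"
    unfolding U_def by (rule integral_square_sum) (use iUU in auto)
  have "(\<integral>z. (U z)\<^sup>2 \<partial>gauss_vec d) = (\<Sum>i<d. \<Sum>j<d. \<integral>z. (2 * \<theta> i * noise d S i z) * (2 * \<theta> j * noise d S j z) \<partial>gauss_vec d)"
    unfolding U_def by (rule integral_square_sum(2)) (rule iUU; simp)
  also have "\<dots> = (\<Sum>i<d. \<Sum>j<d. 4 * (\<theta> i * \<theta> j * S i j))"
    by (intro sum.cong refl UU) auto
  finally have EU: "(\<integral>z. (U z)\<^sup>2 \<partial>gauss_vec d) = 4 * (\<Sum>i<d. \<Sum>j<d. \<theta> i * \<theta> j * S i j)"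
    by (simp only: sum_distrib_left)
  define Q where "Q z = Q_tilde d s \<rho> 1 (\<lambda>i. \<theta> i + noise d S i z)" for z
  have goal: "?thesis \<longleftrightarrow> (\<integral>\<^sup>+z. ennreal ((sqrt \<bar>Q z\<bar> - t)\<^sup>2) \<partial>gauss_vec d) \<le> ennreal (20000000 * phi s (\<rho>\<^sup>2))"
    by (simp add: N_tilde_def Q_def t_def)
  show ?thesis
  proof (cases "real s \<le> \<rho>")
    case False
    define W where "W z = (\<Sum>i<d. (noise d S i z)\<^sup>2 - 1)" for z
    have cv: "integrable (gauss_vec d) (\<lambda>z. ((noise d S i z)\<^sup>2 - 1) * ((noise d S j z)\<^sup>2 - 1))"
      "(\<integral>z. ((noise d S i z)\<^sup>2 - 1) * ((noise d S j z)\<^sup>2 - 1) \<partial>gauss_vec d) = 2 * (S i j)\<^sup>2" if "i < d" "j < d" for i j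
      using gauss_vec_covariance_squares[OF nz(1)[OF that] nz(1)[OF that(2,1)] nz(2)[OF that]] by simp_all
    have iW: "integrable (gauss_vec d) (\<lambda>z. (W z)\<^sup>2)"
      unfolding W_def by (rule integral_square_sum) (use cv in auto)
    have "(\<integral>z. (W z)\<^sup>2 \<partial>gauss_vec d) = (\<Sum>i<d. \<Sum>j<d. 2 * (S i j)\<^sup>2)"
      unfolding W_def by (subst integral_square_sum) (use cv in auto)
    also have "\<dots> \<le> 2 * \<rho>\<^sup>2" using frob by (simp flip: sum_distrib_left)
    finally have EW: "(\<integral>z. (W z)\<^sup>2 \<partial>gauss_vec d) \<le> 2 * \<rho>\<^sup>2" .
    \<comment> \<open>Young's inequality for \<open>|W|\<close> at scale \<open>\<rho>\<close>, the
      order of its standard deviation.\<close>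
    define V where "V z = (1 / (2 * \<rho>)) * (W z)\<^sup>2 + \<rho> / 2" for z
    have iV: "integrable (gauss_vec d) V"
      unfolding V_def using iW by (intro Bochner_Integration.integrable_add integrable_mult_right)
        (simp_all add: finite_measure.emeasure_finite prob_space.finite_measure[OF prob_space_gauss_vec] finite_measure.integrable_const)
    have "(\<integral>z. V z \<partial>gauss_vec d) = (1 / (2 * \<rho>)) * (\<integral>z. (W z)\<^sup>2 \<partial>gauss_vec d) + \<rho> / 2"
      unfolding V_def using iW
      by (subst Bochner_Integration.integral_add)
        (simp_all add: finite_measure.integrable_const prob_space.finite_measure[OF prob_space_gauss_vec] prob_space.prob_space[OF prob_space_gauss_vec])
    also have "\<dots> \<le> (1 / (2 * \<rho>)) * (2 * \<rho>\<^sup>2) + \<rho> / 2"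
      using EW \<rho> by (intro add_right_mono mult_left_mono) auto
    also have "\<dots> = 3 / 2 * \<rho>" using \<rho> by (simp add: power2_eq_square)
    finally have EV: "(\<integral>z. V z \<partial>gauss_vec d) \<le> 3 / 2 * \<rho>" .
    \<comment> \<open>Without thresholding the decomposition is exact.\<close>
    have QW: "Q z - t\<^sup>2 - U z = W z" for z
      unfolding Q_def Q_tilde_def t(2) U_def W_def using False
      by (simp add: sum_subtractf[symmetric] power2_eq_square algebra_simps)
    have "(\<integral>\<^sup>+z. ennreal ((sqrt \<bar>Q z\<bar> - t)\<^sup>2) \<partial>gauss_vec d) \<le> ennreal (16 * \<rho> + 2 * (3 / 2 * \<rho>))"
    proof (rule nn_integral_sqrt_abs_error_le[OF t(1) U0 _ iU _ _ iV EV])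
      show "\<bar>Q z - t\<^sup>2 - U z\<bar> \<le> V z" for z
        unfolding QW V_def by (rule abs_le_square_div) (use \<rho> in simp)
      have "(\<Sum>i<d. \<Sum>j<d. \<theta> i * \<theta> j * S i j) \<le> \<rho> * t\<^sup>2"
        unfolding t(2) by (rule quadratic_form_le_frob[OF frob]) (use \<rho> in simp)
      then show "(\<integral>z. (U z)\<^sup>2 \<partial>gauss_vec d) \<le> 4 * \<rho> * t\<^sup>2" unfolding EU by simp
    qed (use \<rho> in auto)
    also have "\<dots> \<le> ennreal (20000000 * phi s (\<rho>\<^sup>2))"
      using False \<rho> by (intro ennreal_leI) (simp add: phi_def)
    finally show ?thesis unfolding goal .
  next
    case True
    define \<tau> \<beta> where "\<tau> = tau s \<rho>" and "\<beta> = beta s \<rho>"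
    define g where "g = hard_threshold \<tau> \<beta>"
    interpret tail_function g \<tau> unfolding g_def \<tau>_def \<beta>_def by (rule tail_function_hard_threshold[OF s True])
    note \<tau>2 = tau_square[OF s True, folded \<tau>_def] and \<beta> = beta_bounds[OF s True, folded \<tau>_def \<beta>_def]
    define I where "I = {i\<in>{..<d}. \<theta> i \<noteq> 0}"
    have I: "I \<subseteq> {..<d}" "finite I" "card I \<le> s" using p by (auto simp: I_def Theta_def l0norm_def)
    have s0: "0 < real s" using s by simp
    define W where "W z = (\<Sum>i\<in>{..<d} - I. g (noise d S i z))" for z
    have cv: "integrable (gauss_vec d) (\<lambda>z. g (noise d S i z) * g (noise d S j z))"
      "(\<integral>z. g (noise d S i z) * g (noise d S j z) \<partial>gauss_vec d) \<le> 10000000 * exp (- \<tau>\<^sup>2 / 9) * (S i j)\<^sup>2" if "i < d" "j < d" for i j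
      using integrable_pair(1)[OF nz(1)[OF that] nz(1)[OF that(2,1)]]
        covariance_bound[OF nz(1)[OF that] nz(1)[OF that(2,1)] nz(2)[OF that]] by (auto simp: abs_le_iff mult_ac)
    have iW: "integrable (gauss_vec d) (\<lambda>z. (W z)\<^sup>2)"
      unfolding W_def by (rule integral_square_sum) (use cv in auto)
    \<comment> \<open>The factor 3 in \<open>tau\<close> makes
      \<open>exp (- \<tau>\<^sup>2 / 9)\<close> equal to
      \<open>1 / (1 + \<rho>\<^sup>2 / s\<^sup>2)\<close>, so the variance of \<open>W\<close> is of
      order \<open>s\<^sup>2\<close>.\<close>
    have e9: "exp (- \<tau>\<^sup>2 / 9) * \<rho>\<^sup>2 \<le> (real s)\<^sup>2"
    proof -
      have "0 < 1 + \<rho>\<^sup>2 / (real s)\<^sup>2" by (intro add_pos_nonneg) auto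
      then have "exp (- \<tau>\<^sup>2 / 9) = 1 / (1 + \<rho>\<^sup>2 / (real s)\<^sup>2)" using \<tau>2(1) by (simp add: exp_minus inverse_eq_divide)
      also have "\<dots> = (real s)\<^sup>2 / ((real s)\<^sup>2 + \<rho>\<^sup>2)" using s0 by (simp add: field_simps)
      finally have "exp (- \<tau>\<^sup>2 / 9) * \<rho>\<^sup>2 = (real s)\<^sup>2 * (\<rho>\<^sup>2 / ((real s)\<^sup>2 + \<rho>\<^sup>2))" by simp
      also have "\<dots> \<le> (real s)\<^sup>2 * 1" using s0 by (intro mult_left_mono) (auto simp: divide_le_eq_1 add_pos_nonneg)
      finally show ?thesis by simp
    qed
    have "(\<integral>z. (W z)\<^sup>2 \<partial>gauss_vec d) = (\<Sum>i\<in>{..<d} - I. \<Sum>j\<in>{..<d} - I. \<integral>z. g (noise d S i z) * g (noise d S j z) \<partial>gauss_vec d)"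
      unfolding W_def by (subst integral_square_sum) (use cv in auto)
    also have "\<dots> \<le> (\<Sum>i\<in>{..<d} - I. \<Sum>j\<in>{..<d} - I. 10000000 * exp (- \<tau>\<^sup>2 / 9) * (S i j)\<^sup>2)"
      by (intro sum_mono cv) auto
    also have "\<dots> \<le> (\<Sum>i\<in>{..<d}. \<Sum>j\<in>{..<d} - I. 10000000 * exp (- \<tau>\<^sup>2 / 9) * (S i j)\<^sup>2)"
      by (intro sum_mono2) (auto intro!: sum_nonneg)
    also have "\<dots> \<le> (\<Sum>i<d. \<Sum>j<d. 10000000 * exp (- \<tau>\<^sup>2 / 9) * (S i j)\<^sup>2)"
      by (intro sum_mono sum_mono2) auto
    also have "\<dots> = 10000000 * exp (- \<tau>\<^sup>2 / 9) * (\<Sum>i<d. \<Sum>j<d. (S i j)\<^sup>2)"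
      by (simp only: sum_distrib_left)
    also have "\<dots> \<le> 10000000 * exp (- \<tau>\<^sup>2 / 9) * \<rho>\<^sup>2" using frob by (intro mult_left_mono) auto
    also have "\<dots> \<le> 10000000 * (real s)\<^sup>2" using e9 by simp
    finally have EW: "(\<integral>z. (W z)\<^sup>2 \<partial>gauss_vec d) \<le> 10000000 * (real s)\<^sup>2" .
    \<comment> \<open>The squared noise on the support, Young's inequality for \<open>|W|\<close> at
      scale \<open>s\<close>, and a thresholding error \<open>8 * \<tau>\<^sup>2\<close> for each of
      at most \<open>s\<close> support coordinates.\<close>
    define V where "V z = (\<Sum>i\<in>I. (noise d S i z)\<^sup>2) + ((1 / (2 * real s)) * (W z)\<^sup>2 + (8 * \<tau>\<^sup>2 * real s + real s / 2))" for z
    have n2: "integrable (gauss_vec d) (\<lambda>z. (noise d S i z)\<^sup>2)" "(\<integral>z. (noise d S i z)\<^sup>2 \<partial>gauss_vec d) = 1" if "i < d" for i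
      using integral_gauss_vec_inner[OF nz(1)[OF that that], of "\<lambda>x. x\<^sup>2"] by auto
    have iN: "integrable (gauss_vec d) (\<lambda>z. \<Sum>i\<in>I. (noise d S i z)\<^sup>2)"
      using n2 I by (intro Bochner_Integration.integrable_sum) auto
    have ic: "integrable (gauss_vec d) (\<lambda>z. c :: real)" for c
      by (rule finite_measure.integrable_const[OF prob_space.finite_measure[OF prob_space_gauss_vec]])
    have iV: "integrable (gauss_vec d) V"
      unfolding V_def by (intro Bochner_Integration.integrable_add integrable_mult_right iN iW ic)
    have "(\<integral>z. V z \<partial>gauss_vec d) = (\<integral>z. (\<Sum>i\<in>I. (noise d S i z)\<^sup>2) \<partial>gauss_vec d)
        + ((1 / (2 * real s)) * (\<integral>z. (W z)\<^sup>2 \<partial>gauss_vec d) + (8 * \<tau>\<^sup>2 * real s + real s / 2))"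
      unfolding V_def
      by (subst Bochner_Integration.integral_add, rule iN, intro Bochner_Integration.integrable_add integrable_mult_right iW ic,
          subst Bochner_Integration.integral_add, intro integrable_mult_right iW, rule ic)
        (simp add: prob_space.prob_space[OF prob_space_gauss_vec])
    also have "(\<integral>z. (\<Sum>i\<in>I. (noise d S i z)\<^sup>2) \<partial>gauss_vec d) = (\<Sum>i\<in>I. 1)"
    proof -
      have Id: "i < d" if "i \<in> I" for i using that I by auto
      show ?thesis by (subst Bochner_Integration.integral_sum) (use n2 Id in \<open>simp_all\<close>)
    qed
    also have "(\<Sum>i\<in>I. 1) + ((1 / (2 * real s)) * (\<integral>z. (W z)\<^sup>2 \<partial>gauss_vec d) + (8 * \<tau>\<^sup>2 * real s + real s / 2))
        \<le> real s + ((1 / (2 * real s)) * (10000000 * (real s)\<^sup>2) + (8 * \<tau>\<^sup>2 * real s + real s / 2))"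
      using EW I s0 by (intro add_mono mult_left_mono) auto
    also have "\<dots> = real s * (10000003 / 2 + 8 * \<tau>\<^sup>2)" using s0 by (simp add: power2_eq_square algebra_simps)
    finally have EV: "(\<integral>z. V z \<partial>gauss_vec d) \<le> real s * (10000003 / 2 + 8 * \<tau>\<^sup>2)" .
    \<comment> \<open>Above the threshold the change is the centring constant
      \<open>\<beta>\<close>; below it the lost square is at most
      \<open>\<tau>\<^sup>2\<close>.\<close>
    have gy: "\<bar>g y - y\<^sup>2\<bar> \<le> 8 * \<tau>\<^sup>2" for y
    proof (cases "\<tau> < \<bar>y\<bar>")
      case True
      then show ?thesis using \<beta> by (simp add: g_def hard_threshold_def)
    next
      case False
      then have "y\<^sup>2 \<le> \<tau>\<^sup>2" using \<tau>2(3) by (simp add: abs_le_square_iff[symmetric])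
      moreover have "0 \<le> y\<^sup>2" by simp
      ultimately have "\<bar>0 - y\<^sup>2\<bar> \<le> 8 * \<tau>\<^sup>2" by linarith
      then show ?thesis using False by (simp add: g_def hard_threshold_def)
    qed
    have QV: "\<bar>Q z - t\<^sup>2 - U z\<bar> \<le> V z" for z
    proof -
      let ?Y = "\<lambda>i. \<theta> i + noise d S i z"
      have "Q z = (\<Sum>i<d. g (?Y i))"
        unfolding Q_def Q_tilde_def using True by (simp add: g_def hard_threshold_def \<tau>_def \<beta>_def cong: if_cong)
      then have "Q z - t\<^sup>2 - U z = (\<Sum>i<d. g (?Y i) - (\<theta> i)\<^sup>2 - 2 * \<theta> i * noise d S i z)"
        unfolding t(2) U_def by (simp add: sum_subtractf)
      also have "\<dots> = (\<Sum>i\<in>I. g (?Y i) - (\<theta> i)\<^sup>2 - 2 * \<theta> i * noise d S i z) + (\<Sum>i\<in>{..<d} - I. g (?Y i) - (\<theta> i)\<^sup>2 - 2 * \<theta> i * noise d S i z)"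
        using I sum.subset_diff[of I "{..<d}"] by (simp add: add.commute)
      also have "(\<Sum>i\<in>{..<d} - I. g (?Y i) - (\<theta> i)\<^sup>2 - 2 * \<theta> i * noise d S i z) = W z"
        unfolding W_def by (intro sum.cong) (auto simp: I_def)
      finally have eq: "Q z - t\<^sup>2 - U z = (\<Sum>i\<in>I. g (?Y i) - (\<theta> i)\<^sup>2 - 2 * \<theta> i * noise d S i z) + W z" .
      have "\<bar>\<Sum>i\<in>I. g (?Y i) - (\<theta> i)\<^sup>2 - 2 * \<theta> i * noise d S i z\<bar> \<le> (\<Sum>i\<in>I. (noise d S i z)\<^sup>2 + 8 * \<tau>\<^sup>2)"
      proof (rule order_trans[OF sum_abs], rule sum_mono)
        fix i
        have "(?Y i)\<^sup>2 = (\<theta> i)\<^sup>2 + 2 * \<theta> i * noise d S i z + (noise d S i z)\<^sup>2" by (simp add: power2_sum)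
        moreover have "0 \<le> (noise d S i z)\<^sup>2" by simp
        ultimately show "\<bar>g (?Y i) - (\<theta> i)\<^sup>2 - 2 * \<theta> i * noise d S i z\<bar> \<le> (noise d S i z)\<^sup>2 + 8 * \<tau>\<^sup>2"
          using gy[of "?Y i"] by linarith
      qed
      also have "\<dots> = (\<Sum>i\<in>I. (noise d S i z)\<^sup>2) + real (card I) * (8 * \<tau>\<^sup>2)" by (simp add: sum.distrib)
      also have "\<dots> \<le> (\<Sum>i\<in>I. (noise d S i z)\<^sup>2) + real s * (8 * \<tau>\<^sup>2)"
        using I by (intro add_left_mono mult_right_mono) auto
      finally show ?thesis
        unfolding eq V_def using abs_le_square_div[OF s0, of "W z"] abs_triangle_ineq[of "\<Sum>i\<in>I. g (?Y i) - (\<theta> i)\<^sup>2 - 2 * \<theta> i * noise d S i z" "W z"]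
        by (simp add: mult_ac)
    qed
    have "(\<integral>\<^sup>+z. ennreal ((sqrt \<bar>Q z\<bar> - t)\<^sup>2) \<partial>gauss_vec d) \<le> ennreal (16 * real s + 2 * (real s * (10000003 / 2 + 8 * \<tau>\<^sup>2)))"
    proof (rule nn_integral_sqrt_abs_error_le[OF t(1) U0 QV iU _ _ iV EV])
      have "(\<Sum>i<d. \<Sum>j<d. \<theta> i * \<theta> j * S i j) \<le> real s * t\<^sup>2"
        unfolding t(2) by (rule quadratic_form_le_sparsity) (use nz(3) p in \<open>auto simp: Theta_def\<close>)
      then show "(\<integral>z. (U z)\<^sup>2 \<partial>gauss_vec d) \<le> 4 * real s * t\<^sup>2" unfolding EU by simp
    qed auto
    also have "\<dots> \<le> ennreal (20000000 * phi s (\<rho>\<^sup>2))"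
    proof (rule ennreal_leI)
      define l where "l = ln (1 + \<rho>\<^sup>2 / (real s)\<^sup>2)"
      \<comment> \<open>The lower bound on \<open>l\<close> lets the constant term be absorbed into
        \<open>20000000 * l\<close>.\<close>
      have l: "2 / 3 \<le> l" using \<tau>2(1,2) ln2_ge_two_thirds by (simp add: l_def)
      have "16 * real s + 2 * (real s * (10000003 / 2 + 8 * \<tau>\<^sup>2)) = real s * (10000019 + 144 * l)"
        unfolding \<tau>2(1) l_def[symmetric] by (simp add: algebra_simps)
      also have "\<dots> \<le> real s * (20000000 * l)" using l by (intro mult_left_mono) auto
      also have "\<dots> = 20000000 * phi s (\<rho>\<^sup>2)" using True \<rho> by (simp add: phi_def l_def)
      finally show "16 * real s + 2 * (real s * (10000003 / 2 + 8 * \<tau>\<^sup>2)) \<le> 20000000 * phi s (\<rho>\<^sup>2)" .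
    qed
    finally show ?thesis unfolding goal .
  qed
qed

section \<open>Rescaling to general noise level and conclusion\<close>

lemma N_tilde_estimator: "N_tilde d s \<rho> \<sigma> \<in> estimators d"
  unfolding estimators_def N_tilde_def Q_tilde_def by measurable

lemma N_tilde_scale:
  assumes \<sigma>: "0 < \<sigma>"
  shows "N_tilde d s \<rho> \<sigma> (\<lambda>i\<in>{..<d}. \<theta> i + \<sigma> * e i) = \<sigma> * N_tilde d s \<rho> 1 (\<lambda>i. \<theta> i / \<sigma> + e i)"
proof -
  have y: "\<theta> i + \<sigma> * e i = \<sigma> * (\<theta> i / \<sigma> + e i)" for i using \<sigma> by (simp add: field_simps)
  have "Q_tilde d s \<rho> \<sigma> (\<lambda>i\<in>{..<d}. \<theta> i + \<sigma> * e i) = \<sigma>\<^sup>2 * Q_tilde d s \<rho> 1 (\<lambda>i. \<theta> i / \<sigma> + e i)"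
    unfolding Q_tilde_def y using \<sigma>
    by (simp add: sum_distrib_left if_distrib[where f="\<lambda>x. \<sigma>\<^sup>2 * x"] abs_mult power_mult_distrib right_diff_distrib cong: if_cong)
  then show ?thesis using \<sigma> by (simp add: N_tilde_def abs_mult real_sqrt_mult)
qed

text \<open>The estimator is homogeneous when signal and noise are scaled together, and dividing
  \<open>\<theta>\<close> by \<open>\<sigma>\<close> stays in the class, so unit noise
  suffices.\<close>

lemma N_tilde_risk:
  assumes p: "(\<theta>, S) \<in> Theta s d \<rho>" and s: "1 \<le> s" and \<rho>: "1 \<le> \<rho>" and \<sigma>: "0 < \<sigma>"
  shows "risk d (N_tilde d s \<rho> \<sigma>) \<theta> \<sigma> S \<le> ennreal (20000000 * \<sigma>\<^sup>2 * phi s (\<rho>\<^sup>2))"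
proof -
  let ?\<theta> = "\<lambda>i. \<theta> i / \<sigma>"
  have p': "(?\<theta>, S) \<in> Theta s d \<rho>" using p \<sigma> by (auto simp: Theta_def l0norm_def)
  have nrm: "l2norm d \<theta> = \<sigma> * l2norm d ?\<theta>"
  proof -
    have "(\<Sum>i<d. (\<theta> i)\<^sup>2) = \<sigma>\<^sup>2 * (\<Sum>i<d. (?\<theta> i)\<^sup>2)" using \<sigma> by (simp add: sum_distrib_left power_divide)
    then show ?thesis using \<sigma> by (simp add: l2norm_def real_sqrt_mult)
  qed
  have "risk d (N_tilde d s \<rho> \<sigma>) \<theta> \<sigma> S
      = (\<integral>\<^sup>+z. ennreal (\<sigma>\<^sup>2) * ennreal ((N_tilde d s \<rho> 1 (\<lambda>i. ?\<theta> i + noise d S i z) - l2norm d ?\<theta>)\<^sup>2) \<partial>gauss_vec d)"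
    unfolding risk_eq[OF N_tilde_estimator] N_tilde_scale[OF \<sigma>] nrm
    by (simp add: ennreal_mult[symmetric] power_mult_distrib[symmetric] right_diff_distrib)
  also have "\<dots> = ennreal (\<sigma>\<^sup>2) * (\<integral>\<^sup>+z. ennreal ((N_tilde d s \<rho> 1 (\<lambda>i. ?\<theta> i + noise d S i z) - l2norm d ?\<theta>)\<^sup>2) \<partial>gauss_vec d)"
    by (rule nn_integral_cmult) (unfold N_tilde_def Q_tilde_def, measurable)
  also have "\<dots> \<le> ennreal (\<sigma>\<^sup>2) * ennreal (20000000 * phi s (\<rho>\<^sup>2))"
    by (intro mult_left_mono N_tilde_risk_unit[OF p' s \<rho>]) simp
  also have "\<dots> = ennreal (20000000 * \<sigma>\<^sup>2 * phi s (\<rho>\<^sup>2))"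
    by (simp add: ennreal_mult'[symmetric] mult_ac)
  finally show ?thesis .
qed

lemma phi_pos: "1 \<le> s \<Longrightarrow> 1 \<le> \<rho> \<Longrightarrow> 0 < phi s (\<rho>\<^sup>2)"
  unfolding phi_def by (auto intro!: mult_pos_pos ln_gt_zero)

theorem theorem4:
  "\<exists>c C :: real. 0 < c \<and> c \<le> C \<and>
    (\<forall>(d::nat) (s::nat) (\<rho>::real) (\<sigma>::real).
       1 \<le> d \<longrightarrow> 1 \<le> s \<longrightarrow> s \<le> d \<longrightarrow> sqrt (real d) \<le> \<rho> \<longrightarrow> \<rho> \<le> real d \<longrightarrow> 0 < \<sigma> \<longrightarrow>
       (SUP p\<in>Theta s d \<rho>. risk d (N_tilde d s \<rho> \<sigma>) (fst p) \<sigma> (snd p))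
          \<le> ennreal (C * \<sigma>\<^sup>2 * phi s (\<rho>\<^sup>2))
     \<and> ennreal (c * \<sigma>\<^sup>2)
          \<le> (INF T\<in>estimators d. SUP p\<in>Theta s d \<rho>.
                risk d T (fst p) \<sigma> (snd p) / ennreal (phi s (\<rho>\<^sup>2)))
     \<and> (INF T\<in>estimators d. SUP p\<in>Theta s d \<rho>.
                risk d T (fst p) \<sigma> (snd p) / ennreal (phi s (\<rho>\<^sup>2)))
          \<le> ennreal (C * \<sigma>\<^sup>2))"
proof (rule exI[of _ "1 / 256"], rule exI[of _ 20000000], intro conjI allI impI)
  fix d s :: nat and \<rho> \<sigma> :: real
  assume d: "1 \<le> d" and s: "1 \<le> s" "s \<le> d" and \<rho>: "sqrt (real d) \<le> \<rho>" "\<rho> \<le> real d" and \<sigma>: "0 < \<sigma>"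
  have "1 \<le> sqrt (real d)" using d by simp
  then have \<rho>1: "1 \<le> \<rho>" using \<rho>(1) by linarith
  define \<phi> where "\<phi> = phi s (\<rho>\<^sup>2)"
  have \<phi>: "0 < \<phi>" unfolding \<phi>_def by (rule phi_pos[OF s(1) \<rho>1])
  \<comment> \<open>Positivity of \<open>\<phi>\<close> makes the extended-real quotient
    cancel.\<close>
  have div: "ennreal (x * \<phi>) / ennreal \<phi> = ennreal x" if "0 \<le> x" for x
    using \<phi> that by (simp add: divide_ennreal)
  have upper: "risk d (N_tilde d s \<rho> \<sigma>) (fst p) \<sigma> (snd p) \<le> ennreal (20000000 * \<sigma>\<^sup>2 * \<phi>)" if "p \<in> Theta s d \<rho>" for p
    unfolding \<phi>_def by (rule N_tilde_risk) (use that s(1) \<rho>1 \<sigma> in auto)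
  show "(SUP p\<in>Theta s d \<rho>. risk d (N_tilde d s \<rho> \<sigma>) (fst p) \<sigma> (snd p)) \<le> ennreal (20000000 * \<sigma>\<^sup>2 * phi s (\<rho>\<^sup>2))"
    using upper unfolding \<phi>_def by (intro SUP_least)
  show "ennreal (1 / 256 * \<sigma>\<^sup>2) \<le> (INF T\<in>estimators d. SUP p\<in>Theta s d \<rho>. risk d T (fst p) \<sigma> (snd p) / ennreal (phi s (\<rho>\<^sup>2)))"
  proof (rule INF_greatest)
    fix T assume T: "T \<in> estimators d"
    have "ennreal (1 / 256 * \<sigma>\<^sup>2) = ennreal (\<sigma>\<^sup>2 * \<phi> / 256) / ennreal \<phi>"
      using div[of "1 / 256 * \<sigma>\<^sup>2"] by simp
    also have "\<dots> \<le> (SUP p\<in>Theta s d \<rho>. risk d T (fst p) \<sigma> (snd p)) / ennreal \<phi>"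
      unfolding \<phi>_def by (intro divide_right_mono_ennreal sup_risk_lower_bound s \<rho> \<sigma> T)
    also have "\<dots> = (SUP p\<in>Theta s d \<rho>. risk d T (fst p) \<sigma> (snd p) / ennreal \<phi>)"
      by (rule SUP_divide_ennreal)
    finally show "ennreal (1 / 256 * \<sigma>\<^sup>2) \<le> (SUP p\<in>Theta s d \<rho>. risk d T (fst p) \<sigma> (snd p) / ennreal (phi s (\<rho>\<^sup>2)))"
      by (simp add: \<phi>_def)
  qed
  show "(INF T\<in>estimators d. SUP p\<in>Theta s d \<rho>. risk d T (fst p) \<sigma> (snd p) / ennreal (phi s (\<rho>\<^sup>2))) \<le> ennreal (20000000 * \<sigma>\<^sup>2)"
  proof (rule INF_lower2[OF N_tilde_estimator[of d s \<rho> \<sigma>]], rule SUP_least)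
    fix p assume "p \<in> Theta s d \<rho>"
    then have "risk d (N_tilde d s \<rho> \<sigma>) (fst p) \<sigma> (snd p) / ennreal \<phi> \<le> ennreal (20000000 * \<sigma>\<^sup>2 * \<phi>) / ennreal \<phi>"
      by (intro divide_right_mono_ennreal upper)
    also have "\<dots> = ennreal (20000000 * \<sigma>\<^sup>2)" by (rule div) simp
    finally show "risk d (N_tilde d s \<rho> \<sigma>) (fst p) \<sigma> (snd p) / ennreal (phi s (\<rho>\<^sup>2)) \<le> ennreal (20000000 * \<sigma>\<^sup>2)"
      by (simp add: \<phi>_def)
  qed
qed simp_all

end
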